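(* Let $W_i = (Y_i(1), Y_i(0), R_i(1), R_i(0), X_i)$, $1 \le i \le n$, be i.i.d. with $Y_i(d)$ real-valued, $R_i(d)\in\{0,1\}$ for $d \in \{0,1\}$, and $X_i$ a vector of covariates. Let $n$ be even, let $\pi = \pi_n(X^{(n)})$ be a permutation of $\{1,\dots,n\}$ (possibly depending on $X^{(n)}=(X_1,\dots,X_n)$), and let $D^{(n)} = (D_1,\dots,D_n) \in \{0,1\}^n$ be the treatment assignment. Assume: (1) $E[|Y_i(d)|]<\infty$ and $E[R_i(d)]>0$ for $d\in\{0,1\}$. (2) For $d\in\{0,1\}$, the functions $x\mapsto E[R_i(d)\mid X_i=x]$ and $x\mapsto E[Y_i(d)R_i(d)\mid X_i=x]$ are Lipschitz. (3) $(Y^{(n)}(1),Y^{(n)}(0),R^{(n)}(1),R^{(n)}(0)) \perp\!\!\!\perp D^{(n)} \mid X^{(n)}$, and, conditional on $X^{(n)}$, the vectors $(D_{\pi(2j-1)},D_{\pi(2j)})$, $1\le j\le n/2$, are i.i.d. and each uniformly distributed over $\{(0,1),(1,0)\}$. (4) $\frac1n\sum_{1\le j\le n/2}\|X_{\pi(2j-1)}-X_{\pi(2j)}\|\stackrel{P}{\to}0$. Let $R_i=R_i(1)D_i+R_i(0)(1-D_i)$ and $Y_i = Y_i(1)R_i(1)D_i+Y_i(0)R_i(0)(1-D_i)$, and define \[\hat\theta_n=\frac{\sum_{1\le i\le n}Y_iR_iD_i}{\sum_{1\le i\le n}R_iD_i}-\frac{\sum_{1\le i\le n}Y_iR_i(1-D_i)}{\sum_{1\le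 i\le n}R_i(1-D_i)},\] \[\hat\theta_n^{\rm drop}=\Big(\sum_{1\le j\le n/2}R_{\pi(2j-1)}R_{\pi(2j)}\Big)^{-1}\sum_{1\le j\le n/2}R_{\pi(2j-1)}R_{\pi(2j)}\,(Y_{\pi(2j-1)}-Y_{\pi(2j)})(D_{\pi(2j-1)}-D_{\pi(2j)}).\] Then, as $n\to\infty$, $\hat\theta_n\stackrel{P}{\to}\theta^{\rm obs}$, where \[\theta^{\rm obs}=\frac{E[R_i(1)Y_i(1)]}{E[R_i(1)]}-\frac{E[R_i(0)Y_i(0)]}{E[R_i(0)]}=E[Y_i(1)\mid R_i(1)=1]-E[Y_i(0)\mid R_i(0)=1],\] and $\hat\theta_n^{\rm drop}\stackrel{P}{\to}\theta^{\rm drop}$, where $\theta^{\rm drop}=E[\tau^{\rm obs}(X_i)\rho(X_i)]$ with \[\tau^{\rm obs}(x)=E[Y_i(1)\mid R_i(1)=1,X_i=x]-E[Y_i(0)\mid R_i(0)=1,X_i=x],\] \[\rho(x)=\frac{E[R_i(0)\mid X_i=x]\,E[R_i(1)\mid X_i=x]}{E\big[E[R_i(0)\mid X_i]\,E[R_i(1)\mid X_i]\big]}.\]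
   Context: Setting: a matched-pair experiment with attrition. $Y_i(d)$ is the potential outcome and $R_i(d)$ the potential response indicator ($1$ = not attrited) of unit $i$ under treatment $d\in\{0,1\}$; $X_i$ are observed baseline covariates; $D_i$ is the treatment status. $R_i$ is the realized response indicator and $Y_i$ the observed outcome (set to zero for attrited units). For any variable indexed by $i$, e.g. $D_i$, $D^{(n)}$ denotes $(D_1,\dots,D_n)$. The matched pairs are $\{\pi(2j-1),\pi(2j)\}$, $1\le j\le n/2$. $\hat\theta_n$ is the difference in means over non-attritors; $\hat\theta_n^{\rm drop}$ is the difference in means after dropping every pair containing an attritor. $\perp\!\!\!\perp$ denotes (conditional) independence; $\|\cdot\|$ is the Euclidean norm; $\stackrel{P}{\to}$ is convergence in probability.
   Formalization: The claim about the drop estimator is proved under the added condition E[E[R_i(0)|X_i] E[R_i(1)|X_i]] > 0, which (1)–(4) do not imply and without which ρ and θ^drop are undefined (e.g. X_i uniform on {0,1}, R_i(1)=X_i, R_i(0)=1−X_i). *)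

theory Defs
  imports "HOL-Probability.Probability" "HOL-Combinatorics.Permutations"
begin

section \<open>Convergence in probability\<close>

definition conv_in_prob :: "'a measure \<Rightarrow> ('i \<Rightarrow> 'a \<Rightarrow> real) \<Rightarrow> real \<Rightarrow> 'i filter \<Rightarrow> bool" where
  "conv_in_prob M T c F \<longleftrightarrow>
     (\<forall>\<epsilon>>0. ((\<lambda>n. measure M {\<omega> \<in> space M. \<bar>T n \<omega> - c\<bar> > \<epsilon>}) \<longlongrightarrow> 0) F)"

text \<open>The limit n to infinity along even n.\<close>

definition even_at_top :: "nat filter" where
  "even_at_top = inf at_top (principal {n. even n})"

section \<open>Conditional expectation, probability, and independence\<close>

text \<open>The sigma-algebra on the sample space generated by an \<open>N\<close>-valued random element \<open>V\<close>.\<close>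

abbreviation gen_alg :: "'a measure \<Rightarrow> 'b measure \<Rightarrow> ('a \<Rightarrow> 'b) \<Rightarrow> 'a measure" where
  "gen_alg M N V \<equiv> vimage_algebra (space M) V N"

text \<open>\<open>g\<close> is a version of the regression function \<open>v \<mapsto> E[Z | V = v]\<close>.\<close>

definition cexp_version ::
  "'a measure \<Rightarrow> ('a \<Rightarrow> 'b::topological_space) \<Rightarrow> ('a \<Rightarrow> real) \<Rightarrow> ('b \<Rightarrow> real) \<Rightarrow> bool" where
  "cexp_version M V Z g \<longleftrightarrow> g \<in> borel_measurable borel \<and>
     (AE \<omega> in M. real_cond_exp M (gen_alg M borel V) Z \<omega> = g (V \<omega>))"

text \<open>\<open>E[Z | V = v]\<close>, for an arbitrary fixed version. Versions exist (next lemma) and any two of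
  them agree outside a null set of the law of \<open>V\<close>.\<close>

definition cexp_at ::
  "'a measure \<Rightarrow> ('a \<Rightarrow> 'b::topological_space) \<Rightarrow> ('a \<Rightarrow> real) \<Rightarrow> 'b \<Rightarrow> real" where
  "cexp_at M V Z = (SOME g. cexp_version M V Z g)"

lemma measurable_gen_alg_factor:
  fixes f :: "'a \<Rightarrow> real"
  assumes V: "V \<in> space M \<rightarrow> space N" and f: "f \<in> borel_measurable (gen_alg M N V)"
  shows "\<exists>g\<in>borel_measurable N. \<forall>\<omega>\<in>space M. f \<omega> = g (V \<omega>)"
proof -
  have "\<forall>q\<in>\<rat>. \<exists>A. A \<in> sets N \<and> {\<omega> \<in> space M. f \<omega> < q} = V -` A \<inter> space M"
  proof
    fix q :: real
    have "{\<omega> \<in> space (gen_alg M N V). f \<omega> < q} \<in> sets (gen_alg M N V)"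
      using f by measurable
    then show "\<exists>A. A \<in> sets N \<and> {\<omega> \<in> space M. f \<omega> < q} = V -` A \<inter> space M"
      using V by (auto simp: sets_vimage_algebra2)
  qed
  then obtain A where A: "\<And>q. q \<in> \<rat> \<Longrightarrow> A q \<in> sets N"
    and fA: "\<And>q. q \<in> \<rat> \<Longrightarrow> {\<omega> \<in> space M. f \<omega> < q} = V -` A q \<inter> space M"
    by metis
  define h where "h y = (INF q\<in>(\<rat>::real set). if y \<in> A q then ereal q else \<infinity>)" for y
  have h: "h \<in> borel_measurable N"
    unfolding h_def
  proof (rule borel_measurable_INF)
    show "countable (\<rat>::real set)" by (rule countable_rat)
    fix q :: real assume "q \<in> \<rat>"
    with A have [measurable]: "A q \<in> sets N" by blast
    show "(\<lambda>y. if y \<in> A q then ereal q else \<infinity>) \<in> borel_measurable N" by measurable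
  qed
  have "h (V \<omega>) = ereal (f \<omega>)" if "\<omega> \<in> space M" for \<omega>
  proof (rule antisym)
    have iff: "V \<omega> \<in> A q \<longleftrightarrow> f \<omega> < q" if "q \<in> \<rat>" for q
      using fA[OF that] \<open>\<omega> \<in> space M\<close> by auto
    show "ereal (f \<omega>) \<le> h (V \<omega>)"
      unfolding h_def by (rule INF_greatest) (auto simp: iff less_imp_le)
    show "h (V \<omega>) \<le> ereal (f \<omega>)"
    proof (rule dense_ge)
      fix z :: ereal assume "ereal (f \<omega>) < z"
      then obtain r where r: "ereal (f \<omega>) < ereal r" "ereal r < z"
        using ereal_dense2 by blast
      then obtain q where q: "q \<in> \<rat>" "f \<omega> < q" "q < r"
        using Rats_dense_in_real[of "f \<omega>" r] by auto
      have "h (V \<omega>) \<le> ereal q"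
        unfolding h_def using q iff[OF q(1)] by (intro INF_lower2[OF q(1)]) auto
      also have "\<dots> \<le> z" using q r by (meson ereal_less_eq(3) less_imp_le order_trans)
      finally show "h (V \<omega>) \<le> z" .
    qed
  qed
  then have "\<forall>\<omega>\<in>space M. f \<omega> = real_of_ereal (h (V \<omega>))" by simp
  moreover have "(\<lambda>y. real_of_ereal (h y)) \<in> borel_measurable N" using h by measurable
  ultimately show ?thesis by (intro bexI[where x = "\<lambda>y. real_of_ereal (h y)"])
qed

lemma cexp_version_cexp_at: "cexp_version M V Z (cexp_at M V Z)"
proof -
  have "\<exists>g\<in>borel_measurable borel.
      \<forall>\<omega>\<in>space M. real_cond_exp M (gen_alg M borel V) Z \<omega> = g (V \<omega>)"
    by (rule measurable_gen_alg_factor) (auto intro: borel_measurable_cond_exp)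
  then have "\<exists>g. cexp_version M V Z g" unfolding cexp_version_def by (auto intro: AE_I2)
  then show ?thesis unfolding cexp_at_def by (rule someI_ex)
qed

text \<open>\<open>E[Z | A]\<close> for an event \<open>A\<close> of positive probability.\<close>

definition cexp_event :: "'a measure \<Rightarrow> 'a set \<Rightarrow> ('a \<Rightarrow> real) \<Rightarrow> real" where
  "cexp_event M A Z = integral\<^sup>L (uniform_measure M A) Z"

text \<open>\<open>P(E | F)\<close> for a sub-sigma-algebra \<open>F\<close>.\<close>

definition cprob :: "'a measure \<Rightarrow> 'a measure \<Rightarrow> 'a set \<Rightarrow> 'a \<Rightarrow> real" where
  "cprob M F E = real_cond_exp M F (indicator E)"

definition cond_indep ::
  "'a measure \<Rightarrow> 'a measure \<Rightarrow> 'b measure \<Rightarrow> ('a \<Rightarrow> 'b) \<Rightarrow> 'c measure \<Rightarrow> ('a \<Rightarrow> 'c) \<Rightarrow> bool" where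
  "cond_indep M F N\<^sub>1 U N\<^sub>2 V \<longleftrightarrow> (\<forall>A\<in>sets N\<^sub>1. \<forall>B\<in>sets N\<^sub>2. AE \<omega> in M.
     cprob M F {\<omega>\<in>space M. U \<omega> \<in> A \<and> V \<omega> \<in> B} \<omega> =
     cprob M F {\<omega>\<in>space M. U \<omega> \<in> A} \<omega> * cprob M F {\<omega>\<in>space M. V \<omega> \<in> B} \<omega>)"

text \<open>Joint conditional independence of a finite family; a product formula for subfamilies
  is the special case where some of the \<open>A j\<close> are the whole space.\<close>

definition cond_indep_family ::
  "'a measure \<Rightarrow> 'a measure \<Rightarrow> 'b measure \<Rightarrow> ('j \<Rightarrow> 'a \<Rightarrow> 'b) \<Rightarrow> 'j set \<Rightarrow> bool" where
  "cond_indep_family M F N V J \<longleftrightarrow> (\<forall>A. (\<forall>j\<in>J. A j \<in> sets N) \<longrightarrow> (AE \<omega> in M.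
     cprob M F {\<omega>\<in>space M. \<forall>j\<in>J. V j \<omega> \<in> A j} \<omega> =
     (\<Prod>j\<in>J. cprob M F {\<omega>\<in>space M. V j \<omega> \<in> A j} \<omega>)))"

definition cond_distributed ::
  "'a measure \<Rightarrow> 'a measure \<Rightarrow> 'b measure \<Rightarrow> ('a \<Rightarrow> 'b) \<Rightarrow> 'b pmf \<Rightarrow> bool" where
  "cond_distributed M F N V p \<longleftrightarrow> (\<forall>A\<in>sets N. AE \<omega> in M.
     cprob M F {\<omega>\<in>space M. V \<omega> \<in> A} \<omega> = measure_pmf.prob p A)"

section \<open>The experiment\<close>

text \<open>Potential outcomes and potential responses are families \<open>Y d i\<close>, \<open>R d i\<close> indexed by treatment
  status \<open>d \<in> {0, 1}\<close> and unit \<open>i \<ge> 1\<close>; only these values of \<open>d\<close> and \<open>i\<close> matter.\<close>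

definition sample_vec :: "nat \<Rightarrow> (nat \<Rightarrow> 'a \<Rightarrow> 'b) \<Rightarrow> 'a \<Rightarrow> nat \<Rightarrow> 'b" where
  "sample_vec n Z \<omega> = (\<lambda>i\<in>{1..n}. Z i \<omega>)"

abbreviation vec_space :: "nat \<Rightarrow> (nat \<Rightarrow> 'b::topological_space) measure" where
  "vec_space n \<equiv> PiM {1..n} (\<lambda>_. borel)"

definition unit_vec ::
  "(nat \<Rightarrow> nat \<Rightarrow> 'a \<Rightarrow> real) \<Rightarrow> (nat \<Rightarrow> nat \<Rightarrow> 'a \<Rightarrow> real) \<Rightarrow> (nat \<Rightarrow> 'a \<Rightarrow> 'x) \<Rightarrow>
   nat \<Rightarrow> 'a \<Rightarrow> real \<times> real \<times> real \<times> real \<times> 'x" where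
  "unit_vec Y R X i \<omega> = (Y 1 i \<omega>, Y 0 i \<omega>, R 1 i \<omega>, R 0 i \<omega>, X i \<omega>)"

definition realized_response ::
  "(nat \<Rightarrow> nat \<Rightarrow> 'a \<Rightarrow> real) \<Rightarrow> (nat \<Rightarrow> 'a \<Rightarrow> real) \<Rightarrow> nat \<Rightarrow> 'a \<Rightarrow> real" where
  "realized_response R D i \<omega> = R 1 i \<omega> * D i \<omega> + R 0 i \<omega> * (1 - D i \<omega>)"

definition observed_outcome ::
  "(nat \<Rightarrow> nat \<Rightarrow> 'a \<Rightarrow> real) \<Rightarrow> (nat \<Rightarrow> nat \<Rightarrow> 'a \<Rightarrow> real) \<Rightarrow> (nat \<Rightarrow> 'a \<Rightarrow> real) \<Rightarrow>
   nat \<Rightarrow> 'a \<Rightarrow> real" where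
  "observed_outcome Y R D i \<omega> =
     Y 1 i \<omega> * R 1 i \<omega> * D i \<omega> + Y 0 i \<omega> * R 0 i \<omega> * (1 - D i \<omega>)"

definition theta_hat ::
  "nat \<Rightarrow> (nat \<Rightarrow> nat \<Rightarrow> 'a \<Rightarrow> real) \<Rightarrow> (nat \<Rightarrow> nat \<Rightarrow> 'a \<Rightarrow> real) \<Rightarrow> (nat \<Rightarrow> 'a \<Rightarrow> real) \<Rightarrow>
   'a \<Rightarrow> real" where
  "theta_hat n Y R D \<omega> =
    (let Yo = (\<lambda>i. observed_outcome Y R D i \<omega>); Ro = (\<lambda>i. realized_response R D i \<omega>) in
     (\<Sum>i=1..n. Yo i * Ro i * D i \<omega>) / (\<Sum>i=1..n. Ro i * D i \<omega>)
     - (\<Sum>i=1..n. Yo i * Ro i * (1 - D i \<omega>)) / (\<Sum>i=1..n. Ro i * (1 - D i \<omega>)))"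

text \<open>Here \<open>p\<close> is the permutation at the given sample point; pairs are \<open>{p (2j-1), p (2j)}\<close>.\<close>

definition theta_hat_drop ::
  "nat \<Rightarrow> (nat \<Rightarrow> nat) \<Rightarrow> (nat \<Rightarrow> nat \<Rightarrow> 'a \<Rightarrow> real) \<Rightarrow> (nat \<Rightarrow> nat \<Rightarrow> 'a \<Rightarrow> real) \<Rightarrow>
   (nat \<Rightarrow> 'a \<Rightarrow> real) \<Rightarrow> 'a \<Rightarrow> real" where
  "theta_hat_drop n p Y R D \<omega> =
    (let Yo = (\<lambda>i. observed_outcome Y R D i \<omega>); Ro = (\<lambda>i. realized_response R D i \<omega>) in
     inverse (\<Sum>j=1..n div 2. Ro (p (2*j-1)) * Ro (p (2*j))) *
     (\<Sum>j=1..n div 2. Ro (p (2*j-1)) * Ro (p (2*j)) * (Yo (p (2*j-1)) - Yo (p (2*j)))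
        * (D (p (2*j-1)) \<omega> - D (p (2*j)) \<omega>)))"

section \<open>Population parameters\<close>

text \<open>In this section \<open>Y d\<close>, \<open>R d\<close>, \<open>X\<close> are the random variables of a single unit.\<close>

definition theta_obs :: "'a measure \<Rightarrow> (nat \<Rightarrow> 'a \<Rightarrow> real) \<Rightarrow> (nat \<Rightarrow> 'a \<Rightarrow> real) \<Rightarrow> real" where
  "theta_obs M Y R =
     (\<integral>\<omega>. R 1 \<omega> * Y 1 \<omega> \<partial>M) / (\<integral>\<omega>. R 1 \<omega> \<partial>M) - (\<integral>\<omega>. R 0 \<omega> * Y 0 \<omega> \<partial>M) / (\<integral>\<omega>. R 0 \<omega> \<partial>M)"

text \<open>\<open>E[Y(d) | R(d) = 1, X = x]\<close> is the regression function of \<open>Y(d)\<close> on \<open>(R(d), X)\<close>,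
  evaluated at \<open>(1, x)\<close>.\<close>

definition tau_obs ::
  "'a measure \<Rightarrow> (nat \<Rightarrow> 'a \<Rightarrow> real) \<Rightarrow> (nat \<Rightarrow> 'a \<Rightarrow> real) \<Rightarrow> ('a \<Rightarrow> 'x::topological_space) \<Rightarrow>
   'x \<Rightarrow> real" where
  "tau_obs M Y R X x =
     cexp_at M (\<lambda>\<omega>. (R 1 \<omega>, X \<omega>)) (Y 1) (1, x) - cexp_at M (\<lambda>\<omega>. (R 0 \<omega>, X \<omega>)) (Y 0) (1, x)"

text \<open>\<open>E[E[R(0) | X] E[R(1) | X]]\<close>, the denominator of \<open>rho\<close>. It can vanish even if \<open>E[R(d)] > 0\<close> for
  both \<open>d\<close>; \<open>rho\<close> and \<open>theta_drop\<close> are only meaningful when it is positive.\<close>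

definition mean_resp_prod ::
  "'a measure \<Rightarrow> (nat \<Rightarrow> 'a \<Rightarrow> real) \<Rightarrow> ('a \<Rightarrow> 'x::topological_space) \<Rightarrow> real" where
  "mean_resp_prod M R X =
     (\<integral>\<omega>. real_cond_exp M (gen_alg M borel X) (R 0) \<omega> *
          real_cond_exp M (gen_alg M borel X) (R 1) \<omega> \<partial>M)"

definition rho ::
  "'a measure \<Rightarrow> (nat \<Rightarrow> 'a \<Rightarrow> real) \<Rightarrow> ('a \<Rightarrow> 'x::topological_space) \<Rightarrow> 'x \<Rightarrow> real" where
  "rho M R X x = cexp_at M X (R 0) x * cexp_at M X (R 1) x / mean_resp_prod M R X"

definition theta_drop ::
  "'a measure \<Rightarrow> (nat \<Rightarrow> 'a \<Rightarrow> real) \<Rightarrow> (nat \<Rightarrow> 'a \<Rightarrow> real) \<Rightarrow> ('a \<Rightarrow> 'x::topological_space) \<Rightarrow>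
   real" where
  "theta_drop M Y R X = (\<integral>\<omega>. tau_obs M Y R X (X \<omega>) * rho M R X (X \<omega>) \<partial>M)"

end

theory Submission
  imports Defs "HOL-Real_Asymp.Real_Asymp"
begin

text \<open>Given the covariates, the treatment signs \<open>S j = D (\<pi> (2j-1)) - D (\<pi> (2j))\<close> are independent
  fair signs, independent of the potential outcomes and responses. All four sums in the estimators
  have the form \<open>\<Sum>j. F a * G b * (1 + c * S j) / 2 + F b * G a * (1 - c * S j) / 2\<close> with
  \<open>c = 1\<close> or \<open>c = -1\<close>, where \<open>a, b\<close> are the units of pair \<open>j\<close>, \<open>F\<close> is integrable with Lipschitz
  regression function \<open>f\<close>, and \<open>G\<close> is bounded with regression function \<open>g\<close> (\<open>G = 1\<close> for the
  difference in means). After truncating \<open>F\<close>, the part containing \<open>S j\<close> and the deviations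
  \<open>F a * G b - f (X a) * g (X b)\<close> are sums of bounded uncorrelated terms, so their averages vanish in
  \<open>L\<^sup>2\<close>. What remains, \<open>f (X a) * g (X b) + f (X b) * g (X a)\<close>, differs from
  \<open>f (X a) * g (X a) + f (X b) * g (X b)\<close> by \<open>(f (X a) - f (X b)) * (g (X a) - g (X b))\<close>, which is
  controlled by the distance within the pair; the law of large numbers gives the limit
  \<open>E[f(X) g(X)] / 2\<close> of the sum divided by \<open>n\<close>.\<close>

section \<open>Convergence in probability\<close>

text \<open>Two obstacles shape the argument. The pairing depends on all covariates, so the units of
  a pair have random indices and independence of the units does not apply to them directly. The
  remedy is to show that a residual \<open>\<phi> (W i) - f (X i)\<close> at a fixed unit is
  orthogonal to every bounded function of the data that sees unit \<open>i\<close> only through its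
  covariates; the event that a given position of the pairing holds unit \<open>i\<close> depends on
  covariates alone, so restricting to it preserves this property. Second, truncation destroys
  smoothness: the regression function \<open>h\<close> of the truncated variable has a bounded
  version but need not be Lipschitz, while \<open>f\<close> is Lipschitz but need not be bounded. So
  \<open>h\<close> serves in the second moment estimates and is exchanged for \<open>f\<close> just
  before the distance within pairs enters; since conditional expectation is a contraction in mean,
  this costs no more than the truncation itself. The Lipschitz bound is taken from \<open>f\<close>,
  and the bound 1 on \<open>g\<close> controls the other factor. Finally, the pair distance is only
  known to vanish in probability, so errors are collected as a part of small mean plus a part
  vanishing in probability.\<close>

text \<open>Exceptional events are required to be measurable, but the variables are not: a nonmeasurable
  set has \<open>measure\<close> 0, so \<open>conv_in_prob\<close> by itself is not stable under arithmetic operations.\<close>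

definition prob_lim :: "'a measure \<Rightarrow> ('i \<Rightarrow> 'a \<Rightarrow> real) \<Rightarrow> real \<Rightarrow> 'i filter \<Rightarrow> bool" where
  "prob_lim M T c F \<longleftrightarrow> (\<forall>\<epsilon>>0. \<forall>\<delta>>0. eventually (\<lambda>n. \<exists>E\<in>sets M. measure M E \<le> \<delta> \<and>
     (\<forall>\<omega>\<in>space M - E. \<bar>T n \<omega> - c\<bar> \<le> \<epsilon>)) F)"

lemma eventually_even_at_top:
  "eventually P even_at_top \<longleftrightarrow> eventually (\<lambda>n. even n \<longrightarrow> P n) at_top"
  by (simp add: even_at_top_def eventually_inf_principal)

context prob_space
begin

lemma conv_in_prob_if_prob_lim:
  assumes "prob_lim M T c F"
  shows "conv_in_prob M T c F"
  unfolding conv_in_prob_def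
proof (intro allI impI tendstoI)
  fix \<epsilon> e :: real assume "\<epsilon> > 0" "e > 0"
  then have "eventually (\<lambda>n. \<exists>E\<in>sets M. measure M E \<le> e/2 \<and>
     (\<forall>\<omega>\<in>space M - E. \<bar>T n \<omega> - c\<bar> \<le> \<epsilon>)) F"
    using assms unfolding prob_lim_def by (meson half_gt_zero)
  then show "\<forall>\<^sub>F n in F. dist (measure M {\<omega> \<in> space M. \<epsilon> < \<bar>T n \<omega> - c\<bar>}) 0 < e"
  proof eventually_elim
    case (elim n)
    then obtain E where E: "E \<in> sets M" "measure M E \<le> e/2"
      "\<forall>\<omega>\<in>space M - E. \<bar>T n \<omega> - c\<bar> \<le> \<epsilon>" by blast
    have "{\<omega> \<in> space M. \<epsilon> < \<bar>T n \<omega> - c\<bar>} \<subseteq> E" using E(3) by force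
    \<comment> \<open>Monotonicity into the measurable \<open>E\<close> holds whether or not the
      left event is measurable, because a nonmeasurable set has \<open>measure\<close> 0.\<close>
    then have "measure M {\<omega> \<in> space M. \<epsilon> < \<bar>T n \<omega> - c\<bar>} \<le> measure M E"
      using E(1) by (rule finite_measure_mono)
    with E(2) \<open>e > 0\<close> show ?case by simp
  qed
qed

text \<open>Here the deviation event itself serves as the exceptional set, hence the measurability
  assumption. This is how the hypothesis on pair distances is imported.\<close>

lemma prob_lim_if_conv_in_prob:
  assumes conv: "conv_in_prob M T c F" and meas: "eventually (\<lambda>n. T n \<in> borel_measurable M) F"
  shows "prob_lim M T c F"
  unfolding prob_lim_def
proof (intro allI impI)
  fix \<epsilon> \<delta> :: real assume "\<epsilon> > 0" "\<delta> > 0"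
  have "((\<lambda>n. measure M {\<omega> \<in> space M. \<epsilon> < \<bar>T n \<omega> - c\<bar>}) \<longlongrightarrow> 0) F"
    using conv \<open>\<epsilon> > 0\<close> by (auto simp: conv_in_prob_def)
  then have "eventually (\<lambda>n. measure M {\<omega> \<in> space M. \<epsilon> < \<bar>T n \<omega> - c\<bar>} < \<delta>) F"
    using \<open>\<delta> > 0\<close> by (rule order_tendstoD)
  then show "\<forall>\<^sub>F n in F. \<exists>E\<in>events. prob E \<le> \<delta> \<and> (\<forall>\<omega>\<in>space M - E. \<bar>T n \<omega> - c\<bar> \<le> \<epsilon>)"
    using meas
  proof eventually_elim
    case (elim n)
    have [measurable]: "T n \<in> borel_measurable M" by fact
    have "{\<omega> \<in> space M. \<epsilon> < \<bar>T n \<omega> - c\<bar>} \<in> sets M" by measurable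
    with elim(1) show ?case
      by (intro bexI[where x="{\<omega> \<in> space M. \<epsilon> < \<bar>T n \<omega> - c\<bar>}"]) auto
  qed
qed

text \<open>The null set of disagreement joins the exceptional event, so nothing is asked of
  \<open>T'\<close> itself. The estimators are reached this way from averages with which they agree
  almost surely.\<close>

lemma prob_lim_cong:
  assumes "prob_lim M T c F" "eventually (\<lambda>n. AE \<omega> in M. T n \<omega> = T' n \<omega>) F"
  shows "prob_lim M T' c F"
  unfolding prob_lim_def
proof (intro allI impI)
  fix \<epsilon> \<delta> :: real assume "\<epsilon> > 0" "\<delta> > 0"
  then have "eventually (\<lambda>n. \<exists>E\<in>sets M. measure M E \<le> \<delta> \<and>
     (\<forall>\<omega>\<in>space M - E. \<bar>T n \<omega> - c\<bar> \<le> \<epsilon>)) F"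
    using assms unfolding prob_lim_def by blast
  then show "\<forall>\<^sub>F n in F. \<exists>E\<in>events. prob E \<le> \<delta> \<and> (\<forall>\<omega>\<in>space M - E. \<bar>T' n \<omega> - c\<bar> \<le> \<epsilon>)"
    using assms(2)
  proof eventually_elim
    case (elim n)
    then obtain E where E: "E \<in> sets M" "measure M E \<le> \<delta>"
      "\<forall>\<omega>\<in>space M - E. \<bar>T n \<omega> - c\<bar> \<le> \<epsilon>" by blast
    obtain N where N: "N \<in> null_sets M" "{\<omega>\<in>space M. T n \<omega> \<noteq> T' n \<omega>} \<subseteq> N"
      using elim(2) by (auto simp: eventually_ae_filter)
    have "measure M (E \<union> N) = measure M E"
      using E(1) N(1) by (simp add: measure_Un_null_set)
    then show ?case
      using E N by (intro bexI[where x="E \<union> N"]) (auto, force)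
  qed
qed

lemma prob_lim_continuous2:
  fixes h :: "real \<times> real \<Rightarrow> real"
  assumes S: "prob_lim M S a F" and T: "prob_lim M T b F" and h: "isCont h (a, b)"
  shows "prob_lim M (\<lambda>n \<omega>. h (S n \<omega>, T n \<omega>)) (h (a, b)) F"
  unfolding prob_lim_def
proof (intro allI impI)
  fix \<epsilon> \<delta> :: real assume "\<epsilon> > 0" "\<delta> > 0"
  obtain r where r: "r > 0" "\<And>z. dist z (a, b) < r \<Longrightarrow> dist (h z) (h (a, b)) < \<epsilon>"
    using h \<open>\<epsilon> > 0\<close> unfolding continuous_at_eps_delta by blast
  \<comment> \<open>Two coordinates, each within \<open>r/4\<close>, stay within \<open>r/2\<close>,
    hence strictly inside the open ball of radius \<open>r\<close>.\<close>
  have pos: "r/4 > 0" "\<delta>/2 > 0" using r \<open>\<delta> > 0\<close> by auto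
  have "eventually (\<lambda>n. \<exists>E\<in>sets M. measure M E \<le> \<delta>/2 \<and>
     (\<forall>\<omega>\<in>space M - E. \<bar>S n \<omega> - a\<bar> \<le> r/4)) F"
    "eventually (\<lambda>n. \<exists>E\<in>sets M. measure M E \<le> \<delta>/2 \<and>
     (\<forall>\<omega>\<in>space M - E. \<bar>T n \<omega> - b\<bar> \<le> r/4)) F"
    using S T pos unfolding prob_lim_def by blast+
  then show "\<forall>\<^sub>F n in F. \<exists>E\<in>events. prob E \<le> \<delta> \<and>
      (\<forall>\<omega>\<in>space M - E. \<bar>h (S n \<omega>, T n \<omega>) - h (a, b)\<bar> \<le> \<epsilon>)"
  proof eventually_elim
    case (elim n)
    then obtain E E' where E: "E \<in> sets M" "measure M E \<le> \<delta>/2"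
      "\<forall>\<omega>\<in>space M - E. \<bar>S n \<omega> - a\<bar> \<le> r/4"
      and E': "E' \<in> sets M" "measure M E' \<le> \<delta>/2" "\<forall>\<omega>\<in>space M - E'. \<bar>T n \<omega> - b\<bar> \<le> r/4"
      by blast
    have "measure M (E \<union> E') \<le> \<delta>"
      using measure_Un_le[OF E(1) E'(1)] E(2) E'(2) by simp
    moreover have "\<bar>h (S n \<omega>, T n \<omega>) - h (a, b)\<bar> \<le> \<epsilon>" if "\<omega> \<in> space M - (E \<union> E')" for \<omega>
    proof -
      have "dist (S n \<omega>, T n \<omega>) (a, b) \<le> dist (S n \<omega>) a + dist (T n \<omega>) b"
        by (simp add: dist_Pair_Pair sqrt_sum_squares_le_sum)
      also have "\<dots> \<le> r/4 + r/4"
        using that E(3) E'(3) by (intro add_mono) (auto simp: dist_real_def)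
      also have "\<dots> < r" using r(1) by simp
      finally show ?thesis using r(2) by (force simp: dist_real_def)
    qed
    ultimately show ?case using E(1) E'(1) by (intro bexI[where x="E \<union> E'"]) auto
  qed
qed

lemma prob_lim_diff:
  assumes "prob_lim M S a F" "prob_lim M T b F"
  shows "prob_lim M (\<lambda>n \<omega>. S n \<omega> - T n \<omega>) (a - b) F"
  using prob_lim_continuous2[OF assms, of "\<lambda>z. fst z - snd z"] by (simp add: continuous_intros)

lemma prob_lim_divide:
  assumes "prob_lim M S a F" "prob_lim M T b F" "b \<noteq> 0"
  shows "prob_lim M (\<lambda>n \<omega>. S n \<omega> / T n \<omega>) (a / b) F"
  using prob_lim_continuous2[OF assms(1,2), of "\<lambda>z. fst z / snd z"] assms(3)
  by (simp add: continuous_intros)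

lemma prob_lim_cmult:
  assumes "prob_lim M S a F"
  shows "prob_lim M (\<lambda>n \<omega>. c * S n \<omega>) (c * a) F"
  using prob_lim_continuous2[OF assms assms, of "\<lambda>z. c * fst z"] by (simp add: continuous_intros)

text \<open>Markov's inequality handles \<open>A\<close> and the assumed limit handles
  \<open>T'\<close>. The bounding variable may change with \<open>\<eta>\<close>, which leaves room
  for a truncation level chosen after the accuracy.\<close>

lemma prob_lim_L1_approx:
  assumes T': "prob_lim M T' 0 F"
    and approx: "\<And>\<eta>. \<eta> > 0 \<Longrightarrow> eventually (\<lambda>n. \<exists>A. integrable M A \<and> (\<integral>\<omega>. A \<omega> \<partial>M) \<le> \<eta> \<and>
       (AE \<omega> in M. 0 \<le> A \<omega> \<and> \<bar>T n \<omega> - c\<bar> \<le> A \<omega> + T' n \<omega>)) F"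
  shows "prob_lim M T c F"
  unfolding prob_lim_def
proof (intro allI impI)
  fix \<epsilon> \<delta> :: real assume pos: "\<epsilon> > 0" "\<delta> > 0"
  have "eventually (\<lambda>n. \<exists>E\<in>sets M. measure M E \<le> \<delta>/2 \<and>
     (\<forall>\<omega>\<in>space M - E. \<bar>T' n \<omega> - 0\<bar> \<le> \<epsilon>/2)) F"
    using T' pos unfolding prob_lim_def by (meson half_gt_zero)
  \<comment> \<open>A mean of at most \<open>\<epsilon> * \<delta> / 4\<close> gives, by Markov at
    level \<open>\<epsilon>/2\<close>, probability at most \<open>\<delta>/2\<close>.\<close>
  moreover have "\<epsilon> * \<delta> / 4 > 0" using pos by simp
  note approx[OF this]
  ultimately show "\<forall>\<^sub>F n in F. \<exists>E\<in>events. prob E \<le> \<delta> \<and> (\<forall>\<omega>\<in>space M - E. \<bar>T n \<omega> - c\<bar> \<le> \<epsilon>)"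
  proof eventually_elim
    case (elim n)
    then obtain E where E: "E \<in> sets M" "measure M E \<le> \<delta>/2"
      "\<forall>\<omega>\<in>space M - E. \<bar>T' n \<omega>\<bar> \<le> \<epsilon>/2" by auto
    obtain A where A: "integrable M A" "(\<integral>\<omega>. A \<omega> \<partial>M) \<le> \<epsilon> * \<delta> / 4"
      "AE \<omega> in M. 0 \<le> A \<omega> \<and> \<bar>T n \<omega> - c\<bar> \<le> A \<omega> + T' n \<omega>" using elim by blast
    have [measurable]: "A \<in> borel_measurable M" using A(1) by simp
    define B where "B = {\<omega>\<in>space M. A \<omega> \<ge> \<epsilon>/2}"
    have B: "B \<in> sets M" unfolding B_def by measurable
    have "measure M B \<le> (\<integral>\<omega>. A \<omega> \<partial>M) / (\<epsilon>/2)"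
      unfolding B_def using A pos by (intro integral_Markov_inequality_measure[where A="space M"]) auto
    also have "\<dots> \<le> \<delta>/2" using A(2) pos by (simp add: field_simps)
    finally have mB: "measure M B \<le> \<delta>/2" .
    obtain N where N: "N \<in> null_sets M"
      "{\<omega>\<in>space M. \<not> (0 \<le> A \<omega> \<and> \<bar>T n \<omega> - c\<bar> \<le> A \<omega> + T' n \<omega>)} \<subseteq> N"
      using A(3) by (auto simp: eventually_ae_filter)
    have "measure M (E \<union> B \<union> N) = measure M (E \<union> B)"
      using E(1) B N(1) by (simp add: measure_Un_null_set)
    also have "\<dots> \<le> \<delta>" using measure_Un_le[OF E(1) B] E(2) mB by simp
    finally have "measure M (E \<union> B \<union> N) \<le> \<delta>" .
    moreover have "\<bar>T n \<omega> - c\<bar> \<le> \<epsilon>" if "\<omega> \<in> space M - (E \<union> B \<union> N)" for \<omega>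
    proof -
      have "A \<omega> < \<epsilon>/2" "\<bar>T n \<omega> - c\<bar> \<le> A \<omega> + T' n \<omega>" "\<bar>T' n \<omega>\<bar> \<le> \<epsilon>/2"
        using that N(2) E(3) by (auto simp: B_def)
      then show ?thesis by linarith
    qed
    ultimately show ?case using E(1) B N(1) by (intro bexI[where x="E \<union> B \<union> N"]) auto
  qed
qed

section \<open>Sums of orthogonal bounded variables\<close>

lemma integrable_bounded:
  assumes "f \<in> borel_measurable M" "\<And>\<omega>. \<omega> \<in> space M \<Longrightarrow> \<bar>f \<omega>\<bar> \<le> (C::real)"
  shows "integrable M f"
  using assms by (intro integrable_const_bound[where B=C]) auto

text \<open>Only the diagonal of the squared sum survives, giving second moment at most
  \<open>card J * C\<^sup>2\<close>; nonnegativity of the variance of the absolute sum turns this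
  into a bound on the mean. Divided by the sample size, such a sum vanishes at rate
  \<open>1 / sqrt n\<close>.\<close>

lemma expectation_abs_orthogonal_sum_le:
  fixes Z :: "'j \<Rightarrow> 'a \<Rightarrow> real"
  assumes J: "finite J" and [measurable]: "\<And>j. j \<in> J \<Longrightarrow> Z j \<in> borel_measurable M"
    and bnd: "\<And>j \<omega>. j \<in> J \<Longrightarrow> \<omega> \<in> space M \<Longrightarrow> \<bar>Z j \<omega>\<bar> \<le> C" and "C \<ge> 0"
    and orth: "\<And>j k. j \<in> J \<Longrightarrow> k \<in> J \<Longrightarrow> j \<noteq> k \<Longrightarrow> expectation (\<lambda>\<omega>. Z j \<omega> * Z k \<omega>) = 0"
  shows "integrable M (\<lambda>\<omega>. \<Sum>j\<in>J. Z j \<omega>)"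
    and "expectation (\<lambda>\<omega>. \<bar>\<Sum>j\<in>J. Z j \<omega>\<bar>) \<le> C * sqrt (card J)"
proof -
  define S where "S \<omega> = (\<Sum>j\<in>J. Z j \<omega>)" for \<omega>
  have [measurable]: "S \<in> borel_measurable M" unfolding S_def by measurable
  have int: "integrable M (\<lambda>\<omega>. Z j \<omega> * Z k \<omega>)" if "j \<in> J" "k \<in> J" for j k
    using that bnd \<open>C \<ge> 0\<close>
    by (intro integrable_bounded[where C="C*C"]) (auto simp: abs_mult intro!: mult_mono)
  have "integrable M (Z j)" if "j \<in> J" for j
    using that bnd by (intro integrable_bounded[where C=C]) auto
  then show intS: "integrable M (\<lambda>\<omega>. \<Sum>j\<in>J. Z j \<omega>)" by auto
  have S2: "(S \<omega>)\<^sup>2 = (\<Sum>j\<in>J. \<Sum>k\<in>J. Z j \<omega> * Z k \<omega>)" for \<omega>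
    by (simp add: S_def power2_eq_square sum_product)
  have intS2: "integrable M (\<lambda>\<omega>. (S \<omega>)\<^sup>2)" unfolding S2 using int by auto
  have "expectation (\<lambda>\<omega>. (S \<omega>)\<^sup>2) = (\<Sum>j\<in>J. \<Sum>k\<in>J. expectation (\<lambda>\<omega>. Z j \<omega> * Z k \<omega>))"
    unfolding S2 using int by (simp add: Bochner_Integration.integral_sum)
  also have "\<dots> = (\<Sum>j\<in>J. expectation (\<lambda>\<omega>. Z j \<omega> * Z j \<omega>))"
  proof (rule sum.cong[OF refl])
    fix j assume j: "j \<in> J"
    have "(\<Sum>k\<in>J. expectation (\<lambda>\<omega>. Z j \<omega> * Z k \<omega>)) =
      expectation (\<lambda>\<omega>. Z j \<omega> * Z j \<omega>) + (\<Sum>k\<in>J-{j}. expectation (\<lambda>\<omega>. Z j \<omega> * Z k \<omega>))"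
      using j J by (simp add: sum.remove)
    also have "(\<Sum>k\<in>J-{j}. expectation (\<lambda>\<omega>. Z j \<omega> * Z k \<omega>)) = 0"
      using j orth by (intro sum.neutral) auto
    finally show "(\<Sum>k\<in>J. expectation (\<lambda>\<omega>. Z j \<omega> * Z k \<omega>)) = expectation (\<lambda>\<omega>. Z j \<omega> * Z j \<omega>)"
      by simp
  qed
  also have "\<dots> \<le> (\<Sum>j\<in>J. C\<^sup>2)"
  proof (rule sum_mono)
    fix j assume j: "j \<in> J"
    have "Z j \<omega> * Z j \<omega> \<le> C\<^sup>2" if "\<omega> \<in> space M" for \<omega>
      using power_mono[OF bnd[OF j that], of 2] by (simp add: power2_eq_square)
    then have "expectation (\<lambda>\<omega>. Z j \<omega> * Z j \<omega>) \<le> expectation (\<lambda>\<omega>. C\<^sup>2)"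
      using int[OF j j] by (intro integral_mono_AE) auto
    then show "expectation (\<lambda>\<omega>. Z j \<omega> * Z j \<omega>) \<le> C\<^sup>2" by (simp add: prob_space)
  qed
  finally have ES2: "expectation (\<lambda>\<omega>. (S \<omega>)\<^sup>2) \<le> card J * C\<^sup>2" by simp
  have "(expectation (\<lambda>\<omega>. \<bar>S \<omega>\<bar>))\<^sup>2 \<le> expectation (\<lambda>\<omega>. \<bar>S \<omega>\<bar>\<^sup>2)"
  proof -
    have iA: "integrable M (\<lambda>\<omega>. \<bar>S \<omega>\<bar>)" using intS by (simp add: S_def)
    have "0 \<le> variance (\<lambda>\<omega>. \<bar>S \<omega>\<bar>)" by (rule variance_positive)
    then show ?thesis using variance_eq[OF iA] intS2 by simp
  qed
  also have "\<dots> \<le> (C * sqrt (card J))\<^sup>2" using ES2 by (simp add: power_mult_distrib mult.commute)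
  finally show "expectation (\<lambda>\<omega>. \<bar>\<Sum>j\<in>J. Z j \<omega>\<bar>) \<le> C * sqrt (card J)"
    unfolding S_def by (rule power2_le_imp_le) (use \<open>C \<ge> 0\<close> in auto)
qed

section \<open>Conditional independence\<close>

lemma subalgebra_gen_alg:
  assumes "V \<in> measurable M N"
  shows "subalgebra M (gen_alg M N V)"
  using assms measurable_space[OF assms]
  by (auto simp: subalgebra_def sets_vimage_algebra2 Pi_iff intro: measurable_sets)

lemma sigma_finite_subalgebra_gen_alg:
  assumes "V \<in> measurable M N"
  shows "sigma_finite_subalgebra M (gen_alg M N V)"
proof -
  interpret finite_measure_subalgebra M "gen_alg M N V"
    using subalgebra_gen_alg[OF assms] by unfold_locales
  show ?thesis by (rule sigma_finite_subalgebra_axioms)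
qed

lemma measurable_gen_alg_comp:
  assumes "V \<in> measurable M N" "h \<in> borel_measurable N"
  shows "(\<lambda>\<omega>. h (V \<omega>)) \<in> borel_measurable (gen_alg M N V)"
  using assms measurable_space[OF assms(1)]
  by (intro measurable_compose[OF _ assms(2)] measurable_vimage_algebra1) auto

text \<open>The hypothesis on indicators says that the conditional expectation of \<open>Z\<close>
  given \<open>V\<close> is zero. Pulling out \<open>q\<close> then settles every integrable product
  at once, without approximating \<open>q\<close> by simple functions.\<close>

lemma integral_mult_zero_if_indicators:
  fixes Z :: "'a \<Rightarrow> real"
  assumes V: "V \<in> measurable M N" and Z: "integrable M Z"
    and ind: "\<And>A. A \<in> sets N \<Longrightarrow> expectation (\<lambda>\<omega>. indicator A (V \<omega>) * Z \<omega>) = 0"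
    and q: "q \<in> borel_measurable (gen_alg M N V)" "integrable M (\<lambda>\<omega>. q \<omega> * Z \<omega>)"
  shows "expectation (\<lambda>\<omega>. q \<omega> * Z \<omega>) = 0"
proof -
  interpret S: sigma_finite_subalgebra M "gen_alg M N V"
    by (rule sigma_finite_subalgebra_gen_alg[OF V])
  have "AE \<omega> in M. real_cond_exp M (gen_alg M N V) Z \<omega> = 0"
  proof (rule S.real_cond_exp_charact)
    fix A assume "A \<in> sets (gen_alg M N V)"
    then obtain B where B: "B \<in> sets N" "A = V -` B \<inter> space M"
      using measurable_space[OF V] by (auto simp: sets_vimage_algebra2 Pi_iff)
    have "set_lebesgue_integral M A Z = expectation (\<lambda>\<omega>. indicator B (V \<omega>) * Z \<omega>)"
      unfolding set_lebesgue_integral_def B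
      by (intro Bochner_Integration.integral_cong) (auto simp: indicator_def)
    then show "set_lebesgue_integral M A Z = (\<integral>\<omega>\<in>A. 0 \<partial>M)" using ind[OF B(1)] by simp
  qed (use Z in auto)
  then have "AE \<omega> in M. q \<omega> * real_cond_exp M (gen_alg M N V) Z \<omega> = 0" by eventually_elim simp
  then have "expectation (\<lambda>\<omega>. q \<omega> * real_cond_exp M (gen_alg M N V) Z \<omega>) = 0"
    by (rule integral_eq_zero_AE)
  then show ?thesis using S.real_cond_exp_intg(2)[OF q(2,1)] Z by simp
qed

text \<open>The sets whose indicator is orthogonal to \<open>Z\<close> form a Dynkin system, and
  rectangles are an intersection-stable generator of the product sigma-algebra; the previous lemma
  then passes from indicators to \<open>h\<close>.\<close>

lemma integral_mult_zero_if_rectangles: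
  fixes Z :: "'a \<Rightarrow> real"
  assumes V: "V \<in> measurable M N" and U: "U \<in> measurable M N'" and Z: "integrable M Z"
    and rect: "\<And>A B. A \<in> sets N \<Longrightarrow> B \<in> sets N' \<Longrightarrow>
       expectation (\<lambda>\<omega>. indicator A (V \<omega>) * indicator B (U \<omega>) * Z \<omega>) = 0"
    and h: "h \<in> borel_measurable (N \<Otimes>\<^sub>M N')" "integrable M (\<lambda>\<omega>. h (V \<omega>, U \<omega>) * Z \<omega>)"
  shows "expectation (\<lambda>\<omega>. h (V \<omega>, U \<omega>) * Z \<omega>) = 0"
proof (rule integral_mult_zero_if_indicators[OF _ Z])
  show VU: "(\<lambda>\<omega>. (V \<omega>, U \<omega>)) \<in> measurable M (N \<Otimes>\<^sub>M N')" using V U by measurable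
  show "(\<lambda>\<omega>. h (V \<omega>, U \<omega>)) \<in> borel_measurable (gen_alg M (N \<Otimes>\<^sub>M N') (\<lambda>\<omega>. (V \<omega>, U \<omega>)))"
    by (rule measurable_gen_alg_comp[OF VU h(1)])
  have Zm [measurable]: "Z \<in> borel_measurable M" using Z by auto
  have int: "integrable M (\<lambda>\<omega>. indicator C (V \<omega>, U \<omega>) * Z \<omega>)" if "C \<in> sets (N \<Otimes>\<^sub>M N')" for C
  proof (rule Bochner_Integration.integrable_bound[OF Z])
    have [measurable]: "(\<lambda>\<omega>. indicator C (V \<omega>, U \<omega>) :: real) \<in> borel_measurable M"
      by (rule measurable_compose[OF VU borel_measurable_indicator[OF that]])
    show "(\<lambda>\<omega>. indicator C (V \<omega>, U \<omega>) * Z \<omega>) \<in> borel_measurable M" by measurable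
    show "AE \<omega> in M. norm (indicator C (V \<omega>, U \<omega>) * Z \<omega>) \<le> norm (Z \<omega>)"
      by (rule AE_I2) (simp add: indicator_def)
  qed
  fix C assume C: "C \<in> sets (N \<Otimes>\<^sub>M N')"
  have sub: "{a \<times> b | a b. a \<in> sets N \<and> b \<in> sets N'} \<subseteq> Pow (space N \<times> space N')"
    by (auto dest: sets.sets_into_space)
  have Csig: "C \<in> sigma_sets (space N \<times> space N') {a \<times> b | a b. a \<in> sets N \<and> b \<in> sets N'}"
    using C by (simp add: sets_pair_measure)
  show "expectation (\<lambda>\<omega>. indicator C (V \<omega>, U \<omega>) * Z \<omega>) = 0"
    using Int_stable_pair_measure_generator sub Csig
  proof (induction rule: sigma_sets_induct_disjoint)
    case (basic C)
    then obtain a b where "C = a \<times> b" "a \<in> sets N" "b \<in> sets N'" by auto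
    then show ?case using rect[of a b] by (simp add: indicator_times)
  next
    case empty
    then show ?case by simp
  next
    case (compl C)
    then have C: "C \<in> sets (N \<Otimes>\<^sub>M N')" by (simp add: sets_pair_measure)
    \<comment> \<open>The whole product space is itself a rectangle, which supplies the total mass
      for the complement.\<close>
    have top: "expectation Z = 0"
    proof -
      have "expectation Z = expectation (\<lambda>\<omega>. indicator (space N) (V \<omega>) * indicator (space N') (U \<omega>) * Z \<omega>)"
        using measurable_space[OF V] measurable_space[OF U]
        by (intro Bochner_Integration.integral_cong) auto
      then show ?thesis using rect by simp
    qed
    have "expectation (\<lambda>\<omega>. indicator (space N \<times> space N' - C) (V \<omega>, U \<omega>) * Z \<omega>)
      = expectation (\<lambda>\<omega>. Z \<omega> - indicator C (V \<omega>, U \<omega>) * Z \<omega>)"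
      using measurable_space[OF V] measurable_space[OF U]
      by (intro Bochner_Integration.integral_cong) (auto simp: indicator_def)
    also have "\<dots> = expectation Z - expectation (\<lambda>\<omega>. indicator C (V \<omega>, U \<omega>) * Z \<omega>)"
      using Z int[OF C] by simp
    finally show ?case using compl top by simp
  next
    case (union C)
    have C: "C i \<in> sets (N \<Otimes>\<^sub>M N')" for i using union(2) by (auto simp: sets_pair_measure)
    have s: "(\<lambda>i. indicator (C i) (V \<omega>, U \<omega>) * Z \<omega>) sums (indicator (\<Union>(range C)) (V \<omega>, U \<omega>) * Z \<omega>)" for \<omega>
      by (intro sums_mult2 indicator_sums[unfolded, of C]) (use union(1) in \<open>auto simp: disjoint_family_on_def\<close>)
    \<comment> \<open>Partial sums of disjoint indicators are indicators of finite unions, so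
      \<open>\<bar>Z \<omega>\<bar>\<close> dominates all of them.\<close>
    have "(\<lambda>k. expectation (\<lambda>\<omega>. \<Sum>i<k. indicator (C i) (V \<omega>, U \<omega>) * Z \<omega>))
       \<longlonglongrightarrow> expectation (\<lambda>\<omega>. indicator (\<Union>(range C)) (V \<omega>, U \<omega>) * Z \<omega>)"
    proof (rule integral_dominated_convergence[where w="\<lambda>\<omega>. \<bar>Z \<omega>\<bar>"])
      show "AE \<omega> in M. (\<lambda>k. \<Sum>i<k. indicator (C i) (V \<omega>, U \<omega>) * Z \<omega>)
         \<longlonglongrightarrow> indicator (\<Union>(range C)) (V \<omega>, U \<omega>) * Z \<omega>"
        using s by (simp add: sums_def)
      show "AE \<omega> in M. norm (\<Sum>i<k. indicator (C i) (V \<omega>, U \<omega>) * Z \<omega>) \<le> \<bar>Z \<omega>\<bar>" for k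
      proof (rule AE_I2)
        fix \<omega>
        have "(\<Sum>i<k. indicator (C i) (V \<omega>, U \<omega>)) = (indicator (\<Union>i<k. C i) (V \<omega>, U \<omega>) :: real)"
          using union(1) by (intro indicator_UN_disjoint[symmetric, THEN trans[OF sum.cong[OF refl refl]]])
            (auto simp: disjoint_family_on_def)
        then show "norm (\<Sum>i<k. indicator (C i) (V \<omega>, U \<omega>) * Z \<omega>) \<le> \<bar>Z \<omega>\<bar>"
          by (simp add: sum_distrib_right[symmetric] abs_mult indicator_def)
      qed
      show "(\<lambda>\<omega>. \<Sum>i<k. indicator (C i) (V \<omega>, U \<omega>) * Z \<omega>) \<in> borel_measurable M" for k
        using int[OF C] by (intro borel_measurable_sum borel_measurable_integrable) auto
      show "(\<lambda>\<omega>. indicator (\<Union>(range C)) (V \<omega>, U \<omega>) * Z \<omega>) \<in> borel_measurable M"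
        using C by (intro borel_measurable_integrable int) auto
    qed (use Z in auto)
    moreover have "expectation (\<lambda>\<omega>. \<Sum>i<k. indicator (C i) (V \<omega>, U \<omega>) * Z \<omega>) = 0" for k
      by (subst Bochner_Integration.integral_sum) (use int[OF C] union(3) in simp_all)
    ultimately show ?case by (simp add: LIMSEQ_const_iff)
  qed
qed (fact h(2))

text \<open>Conditional independence of \<open>U\<close> and \<open>V\<close> given \<open>X\<close> makes \<open>P(U \<in> B | X)\<close> a version of
  \<open>P(U \<in> B | X, V)\<close>; hence \<open>t(X, V)\<close>, being orthogonal to functions of \<open>X\<close>, is also orthogonal to
  functions of \<open>(X, U)\<close>.\<close>

lemma cond_indep_orthogonal:
  fixes t :: "'x \<times> 'v \<Rightarrow> real" and h :: "'x \<times> 'u \<Rightarrow> real"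
  assumes X: "X \<in> measurable M N" and U: "U \<in> measurable M N1" and V: "V \<in> measurable M N2"
    and ci: "cond_indep M (gen_alg M N X) N1 U N2 V"
    and t: "t \<in> borel_measurable (N \<Otimes>\<^sub>M N2)" "\<And>\<omega>. \<omega> \<in> space M \<Longrightarrow> \<bar>t (X \<omega>, V \<omega>)\<bar> \<le> C"
    and tX: "\<And>A. A \<in> sets N \<Longrightarrow> expectation (\<lambda>\<omega>. indicator A (X \<omega>) * t (X \<omega>, V \<omega>)) = 0"
    and h: "h \<in> borel_measurable (N \<Otimes>\<^sub>M N1)" "\<And>\<omega>. \<omega> \<in> space M \<Longrightarrow> \<bar>h (X \<omega>, U \<omega>)\<bar> \<le> C'"
  shows "expectation (\<lambda>\<omega>. h (X \<omega>, U \<omega>) * t (X \<omega>, V \<omega>)) = 0"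
proof -
  let ?F = "gen_alg M N X"
  interpret S: sigma_finite_subalgebra M ?F by (rule sigma_finite_subalgebra_gen_alg[OF X])
  note [measurable] = X U V
  have tm [measurable]: "(\<lambda>\<omega>. t (X \<omega>, V \<omega>)) \<in> borel_measurable M"
    by (rule measurable_compose[OF _ t(1)]) measurable
  have hm [measurable]: "(\<lambda>\<omega>. h (X \<omega>, U \<omega>)) \<in> borel_measurable M"
    by (rule measurable_compose[OF _ h(1)]) measurable
  have ti: "integrable M (\<lambda>\<omega>. t (X \<omega>, V \<omega>))" by (rule integrable_bounded[OF tm t(2)])
  show ?thesis
  proof (rule integral_mult_zero_if_rectangles[OF X U ti _ h(1)])
    obtain \<omega>\<^sub>0 where "\<omega>\<^sub>0 \<in> space M" using not_empty by blast
    then have "C' \<ge> 0" using h(2) by fastforce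
    then show "integrable M (\<lambda>\<omega>. h (X \<omega>, U \<omega>) * t (X \<omega>, V \<omega>))"
      using h(2) t(2) by (intro integrable_bounded[where C="C' * C"]) (auto simp: abs_mult intro!: mult_mono)
    fix A B assume A [measurable]: "A \<in> sets N" and B [measurable]: "B \<in> sets N1"
    define EB where "EB = {\<omega>\<in>space M. U \<omega> \<in> B}"
    have EB [measurable]: "EB \<in> sets M" unfolding EB_def by measurable
    define p where "p = cprob M ?F EB"
    have pF: "p \<in> borel_measurable ?F" unfolding p_def cprob_def by (rule borel_measurable_cond_exp)
    have pM [measurable]: "p \<in> borel_measurable M" by (rule measurable_from_subalg[OF S.subalg pF])
    have iEB: "integrable M (indicator EB :: 'a \<Rightarrow> real)"
      by (rule integrable_bounded[where C=1]) (auto simp: indicator_def)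
    have pi: "integrable M p" unfolding p_def cprob_def using iEB by (rule S.real_cond_exp_int(1))
    have p01: "AE \<omega> in M. 0 \<le> p \<omega>" "AE \<omega> in M. p \<omega> \<le> 1" unfolding p_def cprob_def
      by (rule S.real_cond_exp_ge_c[OF iEB] S.real_cond_exp_le_c[OF iEB], simp)+
    have iAp: "integrable M (\<lambda>\<omega>. indicator A' (X \<omega>) * p \<omega> * indicator EC \<omega>)"
      if [measurable]: "A' \<in> sets N" "EC \<in> sets M" for A' EC
    proof (rule integrable_const_bound[where B=1])
      show "AE \<omega> in M. norm (indicator A' (X \<omega>) * p \<omega> * indicator EC \<omega>) \<le> 1"
        using p01 by eventually_elim (simp add: indicator_def)
    qed measurable
    have iABC: "integrable M (\<lambda>\<omega>. indicator A' (X \<omega>) * indicator (EB \<inter> EC) \<omega> :: real)"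
      if [measurable]: "A' \<in> sets N" "EC \<in> sets M" for A' EC
      by (rule integrable_bounded[where C=1]) (measurable, simp add: indicator_def)
    have AF: "(\<lambda>\<omega>. indicator A' (X \<omega>) :: real) \<in> borel_measurable ?F" if "A' \<in> sets N" for A'
      using that by (intro measurable_gen_alg_comp[OF X]) auto
    \<comment> \<open>The indicator of \<open>EB\<close> is split as \<open>q + p\<close>. The part
      \<open>q\<close> will be orthogonal to functions of \<open>(X, V)\<close>, in particular to
      \<open>h'\<close>; the part \<open>p\<close> is measurable with respect to \<open>X\<close>,
      so that \<open>tX\<close> applies to it.\<close>
    define q where "q \<omega> = indicator EB \<omega> - p \<omega>" for \<omega>
    have qi: "integrable M q" unfolding q_def using iEB pi by auto
    have rect: "expectation (\<lambda>\<omega>. indicator A' (X \<omega>) * indicator C (V \<omega>) * q \<omega>) = 0"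
      if A': "A' \<in> sets N" and C[measurable]: "C \<in> sets N2" for A' C
    proof -
      define EC where "EC = {\<omega>\<in>space M. V \<omega> \<in> C}"
      have EC [measurable]: "EC \<in> sets M" unfolding EC_def by measurable
      have EBC: "{\<omega>\<in>space M. U \<omega> \<in> B \<and> V \<omega> \<in> C} = EB \<inter> EC" by (auto simp: EB_def EC_def)
      have ae: "AE \<omega> in M. cprob M ?F (EB \<inter> EC) \<omega> = p \<omega> * cprob M ?F EC \<omega>"
        unfolding EBC[symmetric] unfolding p_def EB_def EC_def
        by (rule ci[unfolded cond_indep_def, rule_format, OF B C])
      \<comment> \<open>Condition on \<open>X\<close>, factor the conditional probability, and then
        undo the conditioning for \<open>EC\<close> alone, with the weight
        \<open>indicator A' (X \<omega>) * p \<omega>\<close> being measurable with respect to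
        \<open>X\<close>.\<close>
      have "expectation (\<lambda>\<omega>. indicator A' (X \<omega>) * indicator (EB \<inter> EC) \<omega>)
        = expectation (\<lambda>\<omega>. indicator A' (X \<omega>) * cprob M ?F (EB \<inter> EC) \<omega>)"
        unfolding cprob_def
      proof (rule S.real_cond_exp_intg(2)[symmetric])
        show "integrable M (\<lambda>\<omega>. indicator A' (X \<omega>) * indicator (EB \<inter> EC) \<omega> :: real)"
          by (rule iABC[OF A' EC])
      qed (use AF[OF A'] in auto)
      also have "\<dots> = expectation (\<lambda>\<omega>. (indicator A' (X \<omega>) * p \<omega>) * cprob M ?F EC \<omega>)"
      proof (rule integral_cong_AE)
        show "AE \<omega> in M. indicator A' (X \<omega>) * cprob M ?F (EB \<inter> EC) \<omega> = indicator A' (X \<omega>) * p \<omega> * cprob M ?F EC \<omega>"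
          using ae by eventually_elim simp
      qed (use A' in \<open>auto simp: cprob_def\<close>)
      also have "\<dots> = expectation (\<lambda>\<omega>. (indicator A' (X \<omega>) * p \<omega>) * indicator EC \<omega>)"
        unfolding cprob_def
      proof (rule S.real_cond_exp_intg(2))
        show "(\<lambda>\<omega>. indicator A' (X \<omega>) * p \<omega>) \<in> borel_measurable ?F"
          by (intro borel_measurable_times AF[OF A'] pF)
        show "integrable M (\<lambda>\<omega>. indicator A' (X \<omega>) * p \<omega> * indicator EC \<omega>)" by (rule iAp[OF A' EC])
      qed simp
      finally have eq: "expectation (\<lambda>\<omega>. indicator A' (X \<omega>) * indicator (EB \<inter> EC) \<omega>)
         = expectation (\<lambda>\<omega>. (indicator A' (X \<omega>) * p \<omega>) * indicator EC \<omega>)" .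
      have "expectation (\<lambda>\<omega>. indicator A' (X \<omega>) * indicator C (V \<omega>) * q \<omega>)
        = expectation (\<lambda>\<omega>. indicator A' (X \<omega>) * indicator (EB \<inter> EC) \<omega> - (indicator A' (X \<omega>) * p \<omega>) * indicator EC \<omega>)"
        by (intro Bochner_Integration.integral_cong) (auto simp: q_def EC_def indicator_def)
      also have "\<dots> = 0"
      proof (subst Bochner_Integration.integral_diff)
        show "integrable M (\<lambda>\<omega>. indicator A' (X \<omega>) * indicator (EB \<inter> EC) \<omega> :: real)"
          by (rule iABC[OF A' EC])
        show "integrable M (\<lambda>\<omega>. indicator A' (X \<omega>) * p \<omega> * indicator EC \<omega>)" by (rule iAp[OF A' EC])
      qed (use eq in simp)
      finally show ?thesis .
    qed
    define h' where "h' z = indicator A (fst z) * t z" for z :: "'x \<times> 'v"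
    have h'm: "h' \<in> borel_measurable (N \<Otimes>\<^sub>M N2)" unfolding h'_def using t(1) by measurable
    have h'b: "\<bar>h' (X \<omega>, V \<omega>)\<bar> \<le> C" if "\<omega> \<in> space M" for \<omega>
      using t(2)[OF that] by (auto simp: h'_def indicator_def)
    have h'M [measurable]: "(\<lambda>\<omega>. h' (X \<omega>, V \<omega>)) \<in> borel_measurable M"
      by (rule measurable_compose[OF _ h'm]) measurable
    have h'i: "integrable M (\<lambda>\<omega>. h' (X \<omega>, V \<omega>) * q' \<omega>)" if "integrable M q'" for q'
    proof (rule Bochner_Integration.integrable_bound[where f="\<lambda>\<omega>. C * q' \<omega>"])
      show "AE \<omega> in M. norm (h' (X \<omega>, V \<omega>) * q' \<omega>) \<le> norm (C * q' \<omega>)"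
      proof (rule AE_I2)
        fix \<omega> assume "\<omega> \<in> space M"
        then have "\<bar>h' (X \<omega>, V \<omega>)\<bar> \<le> \<bar>C\<bar>" using h'b by fastforce
        then show "norm (h' (X \<omega>, V \<omega>) * q' \<omega>) \<le> norm (C * q' \<omega>)"
          by (simp add: abs_mult mult_right_mono)
      qed
    qed (use that in auto)
    have z1: "expectation (\<lambda>\<omega>. h' (X \<omega>, V \<omega>) * q \<omega>) = 0"
      by (rule integral_mult_zero_if_rectangles[OF X V qi rect h'm h'i[OF qi]])
    have z2: "expectation (\<lambda>\<omega>. (indicator A (X \<omega>) * p \<omega>) * t (X \<omega>, V \<omega>)) = 0"
    proof (rule integral_mult_zero_if_indicators[OF X ti tX])
      show "(\<lambda>\<omega>. indicator A (X \<omega>) * p \<omega>) \<in> borel_measurable ?F"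
        by (intro borel_measurable_times AF[OF A] pF)
      show "integrable M (\<lambda>\<omega>. indicator A (X \<omega>) * p \<omega> * t (X \<omega>, V \<omega>))"
        using h'i[OF pi] by (simp add: h'_def mult_ac)
    qed
    have "expectation (\<lambda>\<omega>. indicator A (X \<omega>) * indicator B (U \<omega>) * t (X \<omega>, V \<omega>))
      = expectation (\<lambda>\<omega>. h' (X \<omega>, V \<omega>) * q \<omega> + h' (X \<omega>, V \<omega>) * p \<omega>)"
      by (intro Bochner_Integration.integral_cong) (auto simp: q_def h'_def EB_def indicator_def algebra_simps)
    also have "\<dots> = expectation (\<lambda>\<omega>. h' (X \<omega>, V \<omega>) * q \<omega>) + expectation (\<lambda>\<omega>. h' (X \<omega>, V \<omega>) * p \<omega>)"
      by (rule Bochner_Integration.integral_add[OF h'i[OF qi] h'i[OF pi]])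
    also have "\<dots> = 0" using z1 z2 by (simp add: h'_def mult_ac)
    finally show "expectation (\<lambda>\<omega>. indicator A (X \<omega>) * indicator B (U \<omega>) * t (X \<omega>, V \<omega>)) = 0" .
  qed
qed

end

lemma (in prob_space) integrable_mult_bounded:
  fixes a b :: "'a \<Rightarrow> real"
  assumes "a \<in> borel_measurable M" "b \<in> borel_measurable M"
    and "\<And>\<omega>. \<omega> \<in> space M \<Longrightarrow> \<bar>a \<omega>\<bar> \<le> C" "\<And>\<omega>. \<omega> \<in> space M \<Longrightarrow> \<bar>b \<omega>\<bar> \<le> C'"
  shows "integrable M (\<lambda>\<omega>. a \<omega> * b \<omega>)"
proof (rule integrable_bounded)
  fix \<omega> assume \<omega>: "\<omega> \<in> space M"
  show "\<bar>a \<omega> * b \<omega>\<bar> \<le> C * C'"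
    unfolding abs_mult using assms(3,4)[OF \<omega>] by (intro mult_mono) auto
qed (use assms in measurable)

section \<open>The matched-pairs experiment\<close>

type_synonym 'x unit_data = "real \<times> real \<times> real \<times> real \<times> 'x"

abbreviation cov :: "'x unit_data \<Rightarrow> 'x" where
  "cov w \<equiv> snd (snd (snd (snd w)))"

text \<open>A function unchanged by \<open>w(i := strip (w i))\<close> is one that depends on unit
  \<open>i\<close> only through its covariates. Expressing the dependence by an update avoids
  carrying a separate sigma-algebra for each unit.\<close>

abbreviation strip :: "'x unit_data \<Rightarrow> 'x unit_data" where
  "strip w \<equiv> (0, 0, 0, 0, cov w)"

definition covs :: "nat \<Rightarrow> (nat \<Rightarrow> 'x unit_data) \<Rightarrow> nat \<Rightarrow> 'x" where
  "covs n w = (\<lambda>i\<in>{1..n}. cov (w i))"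

text \<open>The pairing is a function of the covariates, so this makes it insensitive to stripping a
  unit.\<close>

lemma covs_upd_strip: "covs n (w(i := strip (w i))) = covs n w"
  by (auto simp: covs_def)

lemma measurable_cov [measurable]: "cov \<in> borel_measurable borel"
  by (intro borel_measurable_continuous_onI continuous_intros)

lemma measurable_Pair_zeros [measurable]:
  "(\<lambda>x. (0, 0, 0, 0, x) :: ('x::topological_space) unit_data) \<in> borel_measurable borel"
  by (intro borel_measurable_continuous_onI continuous_intros)

lemma measurable_covs: "covs n \<in> measurable (vec_space n) (vec_space n)"
  unfolding covs_def
  by (intro measurable_restrict measurable_compose[OF _ measurable_cov] measurable_component_singleton) auto

text \<open>Sampling and assignment only. Moment and Lipschitz conditions are kept as hypotheses on
  a general \<open>\<phi>\<close> in the lemmas, because the limits are needed for outcomes and for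
  responses in both arms.\<close>

locale matched_pairs = prob_space M for M :: "'a measure" +
  fixes Y R :: "nat \<Rightarrow> nat \<Rightarrow> 'a \<Rightarrow> real"
    and X :: "nat \<Rightarrow> 'a \<Rightarrow> 'x::euclidean_space"
    and D :: "nat \<Rightarrow> nat \<Rightarrow> 'a \<Rightarrow> real"
    and \<pi> :: "nat \<Rightarrow> (nat \<Rightarrow> 'x) \<Rightarrow> nat \<Rightarrow> nat"
  assumes W_indep: "indep_vars (\<lambda>_. borel) (unit_vec Y R X) {1..}"
    and W_ident: "\<And>i. i \<ge> 1 \<Longrightarrow>
        distr M borel (unit_vec Y R X i) = distr M borel (unit_vec Y R X 1)"
    and R_binary: "\<And>d i \<omega>. d \<in> {0, 1} \<Longrightarrow> i \<ge> 1 \<Longrightarrow> \<omega> \<in> space M \<Longrightarrow> R d i \<omega> \<in> {0, 1}"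
    and pi_permutes: "\<And>n x. even n \<Longrightarrow> x \<in> space (vec_space n) \<Longrightarrow> \<pi> n x permutes {1..n}"
    and pi_measurable: "\<And>n i. even n \<Longrightarrow> i \<in> {1..n} \<Longrightarrow>
        (\<lambda>x. \<pi> n x i) \<in> measurable (vec_space n) (count_space UNIV)"
    and D_measurable: "\<And>n i. even n \<Longrightarrow> i \<in> {1..n} \<Longrightarrow> D n i \<in> borel_measurable M"
    and D_binary: "\<And>n i \<omega>. even n \<Longrightarrow> i \<in> {1..n} \<Longrightarrow> \<omega> \<in> space M \<Longrightarrow> D n i \<omega> \<in> {0, 1}"
    and D_cond_indep: "\<And>n. even n \<Longrightarrow>
        cond_indep M (gen_alg M (vec_space n) (sample_vec n X))
          (vec_space n \<Otimes>\<^sub>M vec_space n \<Otimes>\<^sub>M vec_space n \<Otimes>\<^sub>M vec_space n)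
          (\<lambda>\<omega>. (sample_vec n (Y 1) \<omega>, sample_vec n (Y 0) \<omega>,
                 sample_vec n (R 1) \<omega>, sample_vec n (R 0) \<omega>))
          (vec_space n) (sample_vec n (D n))"
    and pairs_cond_indep: "\<And>n. even n \<Longrightarrow>
        cond_indep_family M (gen_alg M (vec_space n) (sample_vec n X)) borel
          (\<lambda>j \<omega>. (D n (\<pi> n (sample_vec n X \<omega>) (2*j-1)) \<omega>,
                   D n (\<pi> n (sample_vec n X \<omega>) (2*j)) \<omega>)) {1..n div 2}"
    and pairs_uniform: "\<And>n j. even n \<Longrightarrow> j \<in> {1..n div 2} \<Longrightarrow>
        cond_distributed M (gen_alg M (vec_space n) (sample_vec n X)) borel
          (\<lambda>\<omega>. (D n (\<pi> n (sample_vec n X \<omega>) (2*j-1)) \<omega>,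
                 D n (\<pi> n (sample_vec n X \<omega>) (2*j)) \<omega>))
          (pmf_of_set {(0, 1), (1, 0)})"
    and pairs_close: "conv_in_prob M
        (\<lambda>n \<omega>. 1 / real n * (\<Sum>j=1..n div 2.
            norm (X (\<pi> n (sample_vec n X \<omega>) (2*j-1)) \<omega> - X (\<pi> n (sample_vec n X \<omega>) (2*j)) \<omega>)))
        0 even_at_top"
begin

abbreviation "W \<equiv> unit_vec Y R X"

abbreviation "Ws n \<equiv> sample_vec n W"

text \<open>The pairing is written as a function of the data vector instead of the sample point, so
  that integrands involving it become functions \<open>K (Ws n \<omega>)\<close> to which stripping
  applies.\<close>

definition idx :: "nat \<Rightarrow> (nat \<Rightarrow> 'x unit_data) \<Rightarrow> nat \<Rightarrow> nat" where
  "idx n w = \<pi> n (covs n w)"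

lemma cov_W [simp]: "cov (W i \<omega>) = X i \<omega>"
  by (simp add: unit_vec_def)

lemma covs_Ws: "covs n (Ws n \<omega>) = sample_vec n X \<omega>"
  by (auto simp: covs_def sample_vec_def)

lemma measurable_W [measurable]: "i \<ge> 1 \<Longrightarrow> W i \<in> borel_measurable M"
  using W_indep by (auto simp: indep_vars_def)

lemma measurable_X [measurable]: "i \<ge> 1 \<Longrightarrow> X i \<in> borel_measurable M"
  using measurable_compose[OF measurable_W measurable_cov] by simp

lemma measurable_Ws: "Ws n \<in> measurable M (vec_space n)"
  unfolding sample_vec_def by (intro measurable_restrict measurable_W) auto

lemma Ws_space: "\<omega> \<in> space M \<Longrightarrow> Ws n \<omega> \<in> space (vec_space n)"
  using measurable_Ws by (rule measurable_space)

lemma Ws_apply [simp]: "i \<in> {1..n} \<Longrightarrow> Ws n \<omega> i = W i \<omega>"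
  by (simp add: sample_vec_def)

section \<open>Independence across units and versions of regression functions\<close>

lemma expectation_ident:
  fixes h :: "'x unit_data \<Rightarrow> real"
  assumes [measurable]: "h \<in> borel_measurable borel" and "i \<ge> 1"
  shows "expectation (\<lambda>\<omega>. h (W i \<omega>)) = expectation (\<lambda>\<omega>. h (W 1 \<omega>))"
    and "integrable M (\<lambda>\<omega>. h (W i \<omega>)) \<longleftrightarrow> integrable M (\<lambda>\<omega>. h (W 1 \<omega>))"
  using W_ident[OF \<open>i \<ge> 1\<close>] integral_distr[of "W i" M borel h] integral_distr[of "W 1" M borel h]
    integrable_distr_eq[of "W i" M borel h] integrable_distr_eq[of "W 1" M borel h] \<open>i \<ge> 1\<close>
    measurable_W
  by auto

text \<open>Disjoint blocks of an independent family are independent. The block is the set of all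
  other units for residuals and a single unit for centred sums.\<close>

lemma expectation_indep_mult:
  fixes a :: "'x unit_data \<Rightarrow> real" and b :: "(nat \<Rightarrow> 'x unit_data) \<Rightarrow> real"
  assumes i: "i \<ge> 1" and J: "J \<subseteq> {1..}" "i \<notin> J"
    and a: "a \<in> borel_measurable borel" "integrable M (\<lambda>\<omega>. a (W i \<omega>))"
    and b: "b \<in> borel_measurable (PiM J (\<lambda>_. borel))" "integrable M (\<lambda>\<omega>. b (\<lambda>j\<in>J. W j \<omega>))"
  shows "expectation (\<lambda>\<omega>. a (W i \<omega>) * b (\<lambda>j\<in>J. W j \<omega>)) =
    expectation (\<lambda>\<omega>. a (W i \<omega>)) * expectation (\<lambda>\<omega>. b (\<lambda>j\<in>J. W j \<omega>))"
proof -
  have "indep_var (PiM {i} (\<lambda>_. borel)) (\<lambda>\<omega>. \<lambda>j\<in>{i}. W j \<omega>) (PiM J (\<lambda>_. borel)) (\<lambda>\<omega>. \<lambda>j\<in>J. W j \<omega>)"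
    using i J by (intro indep_var_restrict[OF W_indep]) auto
  moreover have "(\<lambda>u. a (u i)) \<in> borel_measurable (PiM {i} (\<lambda>_. borel))"
    by (intro measurable_compose[OF _ a(1)] measurable_component_singleton) auto
  ultimately have "indep_var borel ((\<lambda>u. a (u i)) \<circ> (\<lambda>\<omega>. \<lambda>j\<in>{i}. W j \<omega>)) borel (b \<circ> (\<lambda>\<omega>. \<lambda>j\<in>J. W j \<omega>))"
    using b(1) by (intro indep_var_compose)
  then have "indep_var borel (\<lambda>\<omega>. a (W i \<omega>)) borel (\<lambda>\<omega>. b (\<lambda>j\<in>J. W j \<omega>))"
    by (simp add: comp_def)
  then show ?thesis using a(2) b(2) by (rule indep_var_lebesgue_integral)
qed

lemma cexp_version_integrable:
  assumes "integrable M Z" "cexp_version M (X 1) Z f"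
  shows "integrable M (\<lambda>\<omega>. f (X 1 \<omega>))"
proof -
  interpret S: sigma_finite_subalgebra M "gen_alg M borel (X 1)"
    by (rule sigma_finite_subalgebra_gen_alg) simp
  have "integrable M (real_cond_exp M (gen_alg M borel (X 1)) Z)"
    using assms(1) by (rule S.real_cond_exp_int)
  moreover have [measurable]: "f \<in> borel_measurable borel" using assms(2) by (simp add: cexp_version_def)
  ultimately show ?thesis
    using assms(2) integrable_cong_AE[of "real_cond_exp M (gen_alg M borel (X 1)) Z" M "\<lambda>\<omega>. f (X 1 \<omega>)"]
    by (auto simp: cexp_version_def)
qed

lemma cexp_version_orthogonal:
  assumes Z: "integrable M Z" and f: "cexp_version M (X 1) Z f"
    and h: "h \<in> borel_measurable borel" "\<And>x. \<bar>h x\<bar> \<le> (C::real)"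
  shows "expectation (\<lambda>\<omega>. h (X 1 \<omega>) * (Z \<omega> - f (X 1 \<omega>))) = 0"
proof -
  let ?F = "gen_alg M borel (X 1)"
  interpret S: sigma_finite_subalgebra M ?F
    by (rule sigma_finite_subalgebra_gen_alg) simp
  have [measurable]: "f \<in> borel_measurable borel" using f by (simp add: cexp_version_def)
  note h(1)[measurable]
  have fi: "integrable M (\<lambda>\<omega>. f (X 1 \<omega>))" by (rule cexp_version_integrable[OF Z f])
  have hi: "integrable M (\<lambda>\<omega>. h (X 1 \<omega>) * z \<omega>)" if "integrable M z" for z
  proof (rule Bochner_Integration.integrable_bound[where f="\<lambda>\<omega>. C * z \<omega>"])
    show "AE \<omega> in M. norm (h (X 1 \<omega>) * z \<omega>) \<le> norm (C * z \<omega>)"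
    proof (rule AE_I2)
      fix \<omega>
      have "\<bar>h (X 1 \<omega>)\<bar> \<le> \<bar>C\<bar>" using h(2)[of "X 1 \<omega>"] by linarith
      then show "norm (h (X 1 \<omega>) * z \<omega>) \<le> norm (C * z \<omega>)" by (simp add: abs_mult mult_right_mono)
    qed
  qed (use that in auto)
  have "expectation (\<lambda>\<omega>. h (X 1 \<omega>) * Z \<omega>) = expectation (\<lambda>\<omega>. h (X 1 \<omega>) * real_cond_exp M ?F Z \<omega>)"
    using Z by (intro S.real_cond_exp_intg(2)[symmetric] hi measurable_gen_alg_comp[OF _ h(1)]) auto
  also have "\<dots> = expectation (\<lambda>\<omega>. h (X 1 \<omega>) * f (X 1 \<omega>))"
    using f by (intro integral_cong_AE) (auto simp: cexp_version_def elim!: eventually_mono)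
  finally show ?thesis
    using hi[OF Z] hi[OF fi] by (simp add: right_diff_distrib)
qed

lemma cexp_version_AE_eq:
  assumes "cexp_version M (X 1) Z f" "cexp_version M (X 1) Z g"
  shows "AE \<omega> in M. f (X 1 \<omega>) = g (X 1 \<omega>)"
  using assms unfolding cexp_version_def by auto

text \<open>A conditional expectation inherits the bound almost surely, so clipping any version to
  \<open>[-C, C]\<close> gives another version. The second moment estimates use the bound at every
  point of the covariate space, which an arbitrary version satisfies only up to a null set of the
  law of \<open>X 1\<close>.\<close>

lemma cexp_version_bounded_ex:
  assumes f: "cexp_version M (X 1) Z f" and Z: "integrable M Z"
    and bnd: "\<And>\<omega>. \<omega> \<in> space M \<Longrightarrow> \<bar>Z \<omega>\<bar> \<le> C" and "C \<ge> 0"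
  shows "\<exists>g. cexp_version M (X 1) Z g \<and> (\<forall>x. \<bar>g x\<bar> \<le> C)"
proof -
  let ?F = "gen_alg M borel (X 1)"
  interpret S: sigma_finite_subalgebra M ?F
    by (rule sigma_finite_subalgebra_gen_alg) simp
  define g where "g x = max (-C) (min C (f x))" for x
  have [measurable]: "f \<in> borel_measurable borel" using f by (simp add: cexp_version_def)
  have "AE \<omega> in M. real_cond_exp M ?F Z \<omega> \<le> C" "AE \<omega> in M. real_cond_exp M ?F Z \<omega> \<ge> -C"
    using bnd by (intro S.real_cond_exp_le_c S.real_cond_exp_ge_c Z AE_I2; force)+
  moreover have "AE \<omega> in M. real_cond_exp M ?F Z \<omega> = f (X 1 \<omega>)"
    using f by (simp add: cexp_version_def)
  ultimately have "AE \<omega> in M. real_cond_exp M ?F Z \<omega> = g (X 1 \<omega>)"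
    by eventually_elim (auto simp: g_def)
  moreover have "g \<in> borel_measurable borel" unfolding g_def by measurable
  moreover have "\<bar>g x\<bar> \<le> C" for x using \<open>C \<ge> 0\<close> by (auto simp: g_def)
  ultimately show ?thesis unfolding cexp_version_def by blast
qed

text \<open>Contraction in mean, by duality: testing the difference with its own sign
  \<open>h\<close>, a bounded function of the covariate, allows both regression functions to be
  replaced by the original variables. It transfers the truncation error from \<open>Z\<close> to its
  regression function.\<close>

lemma expectation_abs_cexp_diff_le:
  assumes Z: "integrable M Z" "cexp_version M (X 1) Z f"
    and Z': "integrable M Z'" "cexp_version M (X 1) Z' f'"
  shows "expectation (\<lambda>\<omega>. \<bar>f (X 1 \<omega>) - f' (X 1 \<omega>)\<bar>) \<le> expectation (\<lambda>\<omega>. \<bar>Z \<omega> - Z' \<omega>\<bar>)"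
proof -
  have [measurable]: "f \<in> borel_measurable borel" "f' \<in> borel_measurable borel"
    using Z(2) Z'(2) by (auto simp: cexp_version_def)
  define h where "h x = sgn (f x - f' x)" for x
  have hm [measurable]: "h \<in> borel_measurable borel" unfolding h_def by measurable
  have hb: "\<bar>h x\<bar> \<le> 1" for x by (simp add: h_def sgn_if)
  note fi = cexp_version_integrable[OF Z] cexp_version_integrable[OF Z']
  have hi: "integrable M (\<lambda>\<omega>. h (X 1 \<omega>) * z \<omega>)" if "integrable M z" for z
  proof (rule Bochner_Integration.integrable_bound[OF that])
    show "AE \<omega> in M. norm (h (X 1 \<omega>) * z \<omega>) \<le> norm (z \<omega>)"
      using hb by (intro AE_I2) (simp add: abs_mult mult_left_le_one_le)
  qed (use that in auto)
  have "expectation (\<lambda>\<omega>. \<bar>f (X 1 \<omega>) - f' (X 1 \<omega>)\<bar>) = expectation (\<lambda>\<omega>. h (X 1 \<omega>) * (Z \<omega> - Z' \<omega>)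
    - (h (X 1 \<omega>) * (Z \<omega> - f (X 1 \<omega>)) - h (X 1 \<omega>) * (Z' \<omega> - f' (X 1 \<omega>))))"
    by (intro Bochner_Integration.integral_cong) (auto simp: h_def sgn_if algebra_simps)
  also have "\<dots> = expectation (\<lambda>\<omega>. h (X 1 \<omega>) * (Z \<omega> - Z' \<omega>))
    - (expectation (\<lambda>\<omega>. h (X 1 \<omega>) * (Z \<omega> - f (X 1 \<omega>))) - expectation (\<lambda>\<omega>. h (X 1 \<omega>) * (Z' \<omega> - f' (X 1 \<omega>))))"
    using hi[OF Bochner_Integration.integrable_diff[OF Z(1) Z'(1)]]
      hi[OF Bochner_Integration.integrable_diff[OF Z(1) fi(1)]]
      hi[OF Bochner_Integration.integrable_diff[OF Z'(1) fi(2)]] by simp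
  also have "\<dots> = expectation (\<lambda>\<omega>. h (X 1 \<omega>) * (Z \<omega> - Z' \<omega>))"
    using cexp_version_orthogonal[OF Z hm hb] cexp_version_orthogonal[OF Z' hm hb] by simp
  also have "\<dots> \<le> expectation (\<lambda>\<omega>. \<bar>Z \<omega> - Z' \<omega>\<bar>)"
  proof (rule integral_mono)
    fix \<omega>
    have "h (X 1 \<omega>) * (Z \<omega> - Z' \<omega>) \<le> \<bar>h (X 1 \<omega>)\<bar> * \<bar>Z \<omega> - Z' \<omega>\<bar>"
      by (metis abs_ge_self abs_mult)
    also have "\<dots> \<le> \<bar>Z \<omega> - Z' \<omega>\<bar>" using hb by (simp add: mult_left_le_one_le)
    finally show "h (X 1 \<omega>) * (Z \<omega> - Z' \<omega>) \<le> \<bar>Z \<omega> - Z' \<omega>\<bar>" .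
    show "integrable M (\<lambda>\<omega>. h (X 1 \<omega>) * (Z \<omega> - Z' \<omega>))"
      by (rule hi[OF Bochner_Integration.integrable_diff[OF Z(1) Z'(1)]])
  qed (use Z Z' in auto)
  finally show ?thesis .
qed

subsection \<open>Orthogonality of regression residuals\<close>

text \<open>By \<open>inv\<close>, \<open>K\<close> is a function of \<open>X i\<close> and of the
  other units. The residual is orthogonal to functions of \<open>X i\<close> by definition of the
  regression, and the other units are independent of \<open>W i\<close>; rectangles combine the two
  facts.\<close>

lemma expectation_residual_zero:
  fixes \<phi> :: "'x unit_data \<Rightarrow> real" and f :: "'x \<Rightarrow> real"
  assumes i: "i \<in> {1..n}"
    and K: "K \<in> borel_measurable (vec_space n)" "\<And>w. w \<in> space (vec_space n) \<Longrightarrow> \<bar>K w\<bar> \<le> (C::real)"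
    and inv: "\<And>w. w \<in> space (vec_space n) \<Longrightarrow> K (w(i := strip (w i))) = K w"
    and \<phi> [measurable]: "\<phi> \<in> borel_measurable borel" and \<phi>i: "integrable M (\<lambda>\<omega>. \<phi> (W 1 \<omega>))"
    and f: "cexp_version M (X 1) (\<lambda>\<omega>. \<phi> (W 1 \<omega>)) f"
  shows "integrable M (\<lambda>\<omega>. K (Ws n \<omega>) * (\<phi> (W i \<omega>) - f (X i \<omega>)))"
    and "expectation (\<lambda>\<omega>. K (Ws n \<omega>) * (\<phi> (W i \<omega>) - f (X i \<omega>))) = 0"
proof -
  have fm [measurable]: "f \<in> borel_measurable borel" using f by (simp add: cexp_version_def)
  have i1: "i \<ge> 1" using i by simp
  define J where "J = {1..n} - {i}"
  have J: "insert i J = {1..n}" "i \<notin> J" "J \<subseteq> {1..}" using i by (auto simp: J_def)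
  define r where "r w = \<phi> w - f (cov w)" for w
  have rm [measurable]: "r \<in> borel_measurable borel" unfolding r_def by measurable
  have "integrable M (\<lambda>\<omega>. r (W 1 \<omega>))"
    using \<phi>i cexp_version_integrable[OF \<phi>i f] by (simp add: r_def)
  then have ri: "integrable M (\<lambda>\<omega>. r (W i \<omega>))" using expectation_ident(2)[OF rm i1] by simp
  have Km [measurable]: "(\<lambda>\<omega>. K (Ws n \<omega>)) \<in> borel_measurable M"
    by (rule measurable_compose[OF measurable_Ws K(1)])
  have bnd: "integrable M (\<lambda>\<omega>. b \<omega> * r (W i \<omega>))"
    if "b \<in> borel_measurable M" "\<And>\<omega>. \<omega> \<in> space M \<Longrightarrow> \<bar>b \<omega>\<bar> \<le> C" for b C
  proof (rule Bochner_Integration.integrable_bound[where f="\<lambda>\<omega>. C * r (W i \<omega>)"])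
    show "AE \<omega> in M. norm (b \<omega> * r (W i \<omega>)) \<le> norm (C * r (W i \<omega>))"
    proof (rule AE_I2)
      fix \<omega> assume "\<omega> \<in> space M"
      then have "\<bar>b \<omega>\<bar> \<le> \<bar>C\<bar>" using that(2)[of \<omega>] by linarith
      then show "norm (b \<omega> * r (W i \<omega>)) \<le> norm (C * r (W i \<omega>))"
        by (simp add: abs_mult mult_right_mono)
    qed
  qed (use ri i1 that(1) in auto)
  have int: "integrable M (\<lambda>\<omega>. K (Ws n \<omega>) * r (W i \<omega>))"
    by (rule bnd[OF Km]) (use K(2) Ws_space in auto)
  then show "integrable M (\<lambda>\<omega>. K (Ws n \<omega>) * (\<phi> (W i \<omega>) - f (X i \<omega>)))" by (simp add: r_def)
  define U where "U \<omega> = (\<lambda>j\<in>J. W j \<omega>)" for \<omega>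
  have Um: "U \<in> measurable M (PiM J (\<lambda>_. borel))"
    unfolding U_def using J(3) by (intro measurable_restrict measurable_W) auto
  \<comment> \<open>The data vector is rebuilt from the covariate of unit \<open>i\<close> and the
    other units, with zeros in the places that \<open>K\<close> ignores.\<close>
  define h where "h z = K ((snd z)(i := (0, 0, 0, 0, fst z)))" for z
  have hm: "h \<in> borel_measurable (borel \<Otimes>\<^sub>M PiM J (\<lambda>_. borel))"
    unfolding h_def
  proof (rule measurable_compose[OF _ K(1)])
    have "(\<lambda>z :: 'x \<times> (nat \<Rightarrow> 'x unit_data). (snd z, (0::real, 0::real, 0::real, 0::real, fst z)))
      \<in> measurable (borel \<Otimes>\<^sub>M PiM J (\<lambda>_. borel)) (PiM J (\<lambda>_. borel) \<Otimes>\<^sub>M borel)"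
      by (rule measurable_Pair[OF measurable_snd measurable_compose[OF measurable_fst measurable_Pair_zeros]])
    from measurable_compose[OF this measurable_add_dim[where i=i]]
    show "(\<lambda>z :: 'x \<times> (nat \<Rightarrow> 'x unit_data). (snd z)(i := (0, 0, 0, 0, fst z))) \<in> measurable (borel \<Otimes>\<^sub>M PiM J (\<lambda>_. borel)) (vec_space n)"
      by (simp only: J(1) split_def fst_conv snd_conv)
  qed
  have hK: "h (X i \<omega>, U \<omega>) = K (Ws n \<omega>)" if "\<omega> \<in> space M" for \<omega>
  proof -
    have "(U \<omega>)(i := (0, 0, 0, 0, X i \<omega>)) = (Ws n \<omega>)(i := strip (Ws n \<omega> i))"
      using i by (auto simp: U_def J_def sample_vec_def fun_eq_iff)
    then show ?thesis using inv[OF Ws_space[OF that]] by (simp add: h_def)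
  qed
  have "expectation (\<lambda>\<omega>. h (X i \<omega>, U \<omega>) * r (W i \<omega>)) = 0"
  proof (rule integral_mult_zero_if_rectangles[OF _ Um ri _ hm])
    show "X i \<in> borel_measurable M" using i1 by measurable
    show "integrable M (\<lambda>\<omega>. h (X i \<omega>, U \<omega>) * r (W i \<omega>))"
      using int hK by (subst Bochner_Integration.integrable_cong[OF refl]) auto
    fix A :: "'x set" and B :: "(nat \<Rightarrow> 'x unit_data) set"
    assume A [measurable]: "A \<in> sets borel" and B [measurable]: "B \<in> sets (PiM J (\<lambda>_. borel))"
    have am [measurable]: "(\<lambda>w. indicator A (cov w) * r w) \<in> borel_measurable borel" by measurable
    have ai: "integrable M (\<lambda>\<omega>. indicator A (X i \<omega>) * r (W i \<omega>))"
      using i1 by (intro bnd[of "\<lambda>\<omega>. indicator A (X i \<omega>)" 1]) (auto simp: indicator_def)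
    \<comment> \<open>The factor in the other units splits off by independence. What remains
      concerns unit \<open>i\<close> alone and is moved to unit 1, for which \<open>f\<close> is
      given as a regression function.\<close>
    have "expectation (\<lambda>\<omega>. indicator A (X i \<omega>) * indicator B (U \<omega>) * r (W i \<omega>))
      = expectation (\<lambda>\<omega>. (indicator A (cov (W i \<omega>)) * r (W i \<omega>)) * indicator B (\<lambda>j\<in>J. W j \<omega>))"
      by (simp add: U_def mult_ac)
    also have "\<dots> = expectation (\<lambda>\<omega>. indicator A (cov (W i \<omega>)) * r (W i \<omega>)) *
       expectation (\<lambda>\<omega>. indicator B (\<lambda>j\<in>J. W j \<omega>))"
    proof (rule expectation_indep_mult[OF i1 J(3,2) am])
      show "integrable M (\<lambda>\<omega>. indicator B (\<lambda>j\<in>J. W j \<omega>) :: real)"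
        using measurable_compose[OF Um borel_measurable_indicator[OF B]]
        by (intro integrable_bounded[where C=1]) (auto simp: U_def indicator_def)
    qed (use ai in auto)
    also have "expectation (\<lambda>\<omega>. indicator A (cov (W i \<omega>)) * r (W i \<omega>)) =
       expectation (\<lambda>\<omega>. indicator A (cov (W 1 \<omega>)) * r (W 1 \<omega>))"
      by (rule expectation_ident(1)[OF am i1])
    also have "\<dots> = 0"
      using cexp_version_orthogonal[OF \<phi>i f, of "indicator A" 1] by (simp add: r_def indicator_def)
    finally show "expectation (\<lambda>\<omega>. indicator A (X i \<omega>) * indicator B (U \<omega>) * r (W i \<omega>)) = 0" by simp
  qed
  also have "expectation (\<lambda>\<omega>. h (X i \<omega>, U \<omega>) * r (W i \<omega>)) = expectation (\<lambda>\<omega>. K (Ws n \<omega>) * r (W i \<omega>))"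
    using hK by (intro Bochner_Integration.integral_cong) auto
  finally show "expectation (\<lambda>\<omega>. K (Ws n \<omega>) * (\<phi> (W i \<omega>) - f (X i \<omega>))) = 0" by (simp add: r_def)
qed

lemma covs_space: "w \<in> space (vec_space n) \<Longrightarrow> covs n w \<in> space (vec_space n)"
  using measurable_covs by (rule measurable_space)

lemma idx_permutes: "even n \<Longrightarrow> w \<in> space (vec_space n) \<Longrightarrow> idx n w permutes {1..n}"
  unfolding idx_def by (intro pi_permutes covs_space)

lemma idx_in: "even n \<Longrightarrow> w \<in> space (vec_space n) \<Longrightarrow> p \<in> {1..n} \<Longrightarrow> idx n w p \<in> {1..n}"
  using idx_permutes permutes_in_image by metis

lemma idx_eq_iff: "even n \<Longrightarrow> w \<in> space (vec_space n) \<Longrightarrow> idx n w p = idx n w q \<longleftrightarrow> p = q"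
  using idx_permutes permutes_inj by (metis injD)

lemma measurable_idx:
  "even n \<Longrightarrow> p \<in> {1..n} \<Longrightarrow> (\<lambda>w. idx n w p) \<in> measurable (vec_space n) (count_space UNIV)"
  unfolding idx_def by (rule measurable_compose[OF measurable_covs pi_measurable])

text \<open>The index takes finitely many values, each on a measurable event, so measurability can
  be checked for one fixed unit at a time.\<close>

lemma measurable_at_idx:
  assumes n: "even n" "p \<in> {1..n}" and \<phi>: "\<And>i. i \<in> {1..n} \<Longrightarrow> (\<lambda>w. \<phi> i w) \<in> measurable (vec_space n) N"
  shows "(\<lambda>w. \<phi> (idx n w p) w) \<in> measurable (vec_space n) N"
proof (rule measurable_compose_countable'[OF \<phi>])
  have "(\<lambda>w. idx n w p) -` {a} \<inter> space (vec_space n) \<in> sets (vec_space n)" for a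
    using measurable_idx[OF n] by (rule measurable_sets) simp
  then show "(\<lambda>w. idx n w p) \<in> measurable (vec_space n) (count_space {1..n})"
    using idx_in n by (subst measurable_count_space_eq2) auto
qed auto

lemma measurable_idx_comp:
  assumes "even n" "p \<in> {1..n}" "\<phi> \<in> borel_measurable borel"
  shows "(\<lambda>w. \<phi> (w (idx n w p))) \<in> borel_measurable (vec_space n)"
  using assms by (intro measurable_at_idx[where \<phi>="\<lambda>i w. \<phi> (w i)"] measurable_compose[OF _ assms(3)] measurable_component_singleton)

text \<open>Summing over the possible values \<open>i\<close> of the random index reduces to a fixed
  unit with weight \<open>L i\<close>. The event \<open>idx n w p = i\<close> is determined by
  covariates, so \<open>L i\<close> is invariant under stripping unit \<open>i\<close>; on that
  event \<open>inv\<close> speaks of exactly this unit, and off it both sides are zero.\<close>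

lemma expectation_residual_idx_zero:
  fixes \<phi> :: "'x unit_data \<Rightarrow> real" and f :: "'x \<Rightarrow> real"
  assumes n: "even n" "p \<in> {1..n}"
    and K: "K \<in> borel_measurable (vec_space n)" "\<And>w. w \<in> space (vec_space n) \<Longrightarrow> \<bar>K w\<bar> \<le> (C::real)"
    and inv: "\<And>w. w \<in> space (vec_space n) \<Longrightarrow> K (w(idx n w p := strip (w (idx n w p)))) = K w"
    and \<phi> [measurable]: "\<phi> \<in> borel_measurable borel" and \<phi>i: "integrable M (\<lambda>\<omega>. \<phi> (W 1 \<omega>))"
    and f: "cexp_version M (X 1) (\<lambda>\<omega>. \<phi> (W 1 \<omega>)) f"
  shows "expectation (\<lambda>\<omega>. K (Ws n \<omega>) *
    (\<phi> (W (idx n (Ws n \<omega>) p) \<omega>) - f (X (idx n (Ws n \<omega>) p) \<omega>))) = 0"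
proof -
  define L where "L i w = (if idx n w p = i then K w else 0)" for i w
  have Lm: "L i \<in> borel_measurable (vec_space n)" for i
  proof -
    note measurable_idx[OF n, measurable] K(1)[measurable]
    show ?thesis unfolding L_def by measurable
  qed
  have idx_strip: "idx n (w(i := strip (w i))) = idx n w" for w i
    by (simp only: idx_def covs_upd_strip)
  have L: "integrable M (\<lambda>\<omega>. L i (Ws n \<omega>) * (\<phi> (W i \<omega>) - f (X i \<omega>)))"
    "expectation (\<lambda>\<omega>. L i (Ws n \<omega>) * (\<phi> (W i \<omega>) - f (X i \<omega>))) = 0" if "i \<in> {1..n}" for i
  proof -
    have "\<bar>L i w\<bar> \<le> \<bar>C\<bar>" if "w \<in> space (vec_space n)" for w
      using K(2)[OF that] by (auto simp: L_def)
    moreover have "L i (w(i := strip (w i))) = L i w" if "w \<in> space (vec_space n)" for w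
      using inv[OF that] unfolding L_def idx_strip by auto
    ultimately show "integrable M (\<lambda>\<omega>. L i (Ws n \<omega>) * (\<phi> (W i \<omega>) - f (X i \<omega>)))"
      "expectation (\<lambda>\<omega>. L i (Ws n \<omega>) * (\<phi> (W i \<omega>) - f (X i \<omega>))) = 0"
      using expectation_residual_zero[OF that Lm _ _ \<phi> \<phi>i f] by blast+
  qed
  have "expectation (\<lambda>\<omega>. K (Ws n \<omega>) * (\<phi> (W (idx n (Ws n \<omega>) p) \<omega>) - f (X (idx n (Ws n \<omega>) p) \<omega>)))
    = expectation (\<lambda>\<omega>. \<Sum>i=1..n. L i (Ws n \<omega>) * (\<phi> (W i \<omega>) - f (X i \<omega>)))"
  proof (intro Bochner_Integration.integral_cong refl)
    fix \<omega> assume "\<omega> \<in> space M"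
    then have "idx n (Ws n \<omega>) p \<in> {1..n}" using n by (intro idx_in Ws_space) auto
    then show "K (Ws n \<omega>) * (\<phi> (W (idx n (Ws n \<omega>) p) \<omega>) - f (X (idx n (Ws n \<omega>) p) \<omega>))
      = (\<Sum>i=1..n. L i (Ws n \<omega>) * (\<phi> (W i \<omega>) - f (X i \<omega>)))"
      by (simp add: L_def if_distrib[of "\<lambda>x. x * _"] cong: if_cong)
  qed
  also have "\<dots> = 0" using L by (subst Bochner_Integration.integral_sum) auto
  finally show ?thesis .
qed

lemma idx_Ws_in: "even n \<Longrightarrow> \<omega> \<in> space M \<Longrightarrow> p \<in> {1..n} \<Longrightarrow> idx n (Ws n \<omega>) p \<in> {1..n}"
  by (intro idx_in Ws_space)

lemma measurable_W_idx:
  assumes n: "even n" "p \<in> {1..n}" and h: "h \<in> borel_measurable borel"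
  shows "(\<lambda>\<omega>. h (W (idx n (Ws n \<omega>) p) \<omega>)) \<in> borel_measurable M"
proof -
  have "(\<lambda>\<omega>. h (Ws n \<omega> (idx n (Ws n \<omega>) p))) \<in> borel_measurable M"
    by (rule measurable_compose[OF measurable_Ws measurable_idx_comp[OF n h]])
  moreover have "h (Ws n \<omega> (idx n (Ws n \<omega>) p)) = h (W (idx n (Ws n \<omega>) p) \<omega>)" if "\<omega> \<in> space M" for \<omega>
    by (simp only: Ws_apply[OF idx_Ws_in[OF n(1) that n(2)]])
  ultimately show ?thesis by (rule measurable_cong[THEN iffD1, rotated])
qed

text \<open>The product residual telescopes as \<open>\<phi> * \<gamma> - f * g = \<gamma> * (\<phi>
  - f) + f * (\<gamma> - g)\<close>, with \<open>\<phi>, f\<close> at position \<open>p\<close> and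
  \<open>\<gamma>, g\<close> at position \<open>q\<close>. Each summand is a single-unit residual
  whose cofactor, including the residual of the other pair, ignores all but the covariates of that
  unit because the four positions are distinct.\<close>

lemma expectation_pair_residuals_zero:
  fixes \<phi> \<gamma> :: "'x unit_data \<Rightarrow> real" and f g :: "'x \<Rightarrow> real"
  assumes n: "even n" and pq: "p \<in> {1..n}" "q \<in> {1..n}" "r \<in> {1..n}" "s \<in> {1..n}" "distinct [p, q, r, s]"
    and \<phi> [measurable]: "\<phi> \<in> borel_measurable borel" and \<phi>b: "\<And>w. \<bar>\<phi> w\<bar> \<le> C"
    and f: "cexp_version M (X 1) (\<lambda>\<omega>. \<phi> (W 1 \<omega>)) f" and fb: "\<And>x. \<bar>f x\<bar> \<le> C"
    and \<gamma> [measurable]: "\<gamma> \<in> borel_measurable borel" and \<gamma>b: "\<And>w. \<bar>\<gamma> w\<bar> \<le> 1"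
    and g: "cexp_version M (X 1) (\<lambda>\<omega>. \<gamma> (W 1 \<omega>)) g" and gb: "\<And>x. \<bar>g x\<bar> \<le> 1"
  defines "Z \<equiv> \<lambda>p q \<omega>. let i = idx n (Ws n \<omega>) p; k = idx n (Ws n \<omega>) q in
     \<phi> (W i \<omega>) * \<gamma> (W k \<omega>) - f (X i \<omega>) * g (X k \<omega>)"
  shows "expectation (\<lambda>\<omega>. Z p q \<omega> * Z r s \<omega>) = 0"
proof -
  have fm [measurable]: "f \<in> borel_measurable borel" using f by (simp add: cexp_version_def)
  have gm [measurable]: "g \<in> borel_measurable borel" using g by (simp add: cexp_version_def)
  have C0: "C \<ge> 0" using fb[of undefined] by linarith
  define z where "z w = \<phi> (w (idx n w r)) * \<gamma> (w (idx n w s)) - f (cov (w (idx n w r))) * g (cov (w (idx n w s)))" for w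
  have comp: "(\<lambda>w. h (w (idx n w t))) \<in> borel_measurable (vec_space n)"
    if "h \<in> borel_measurable borel" "t \<in> {1..n}" for h :: "'x unit_data \<Rightarrow> real" and t
    by (rule measurable_idx_comp[OF n that(2,1)])
  have [measurable]: "(\<lambda>w. f (cov w)) \<in> borel_measurable borel"
    "(\<lambda>w. g (cov w)) \<in> borel_measurable borel" by measurable
  have cf: "(\<lambda>w. f (cov (w (idx n w t)))) \<in> borel_measurable (vec_space n)" if "t \<in> {1..n}" for t
    using that comp[of "\<lambda>w. f (cov w)" t] by simp
  have cg: "(\<lambda>w. g (cov (w (idx n w t)))) \<in> borel_measurable (vec_space n)" if "t \<in> {1..n}" for t
    using that comp[of "\<lambda>w. g (cov w)" t] by simp
  have zm: "z \<in> borel_measurable (vec_space n)"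
    unfolding z_def by (intro borel_measurable_diff borel_measurable_times comp[OF \<phi>] comp[OF \<gamma>] cf cg pq)
  have zb: "\<bar>z w\<bar> \<le> 2 * C" for w
  proof -
    have "\<bar>\<phi> (w (idx n w r)) * \<gamma> (w (idx n w s))\<bar> \<le> C * 1"
      unfolding abs_mult by (intro mult_mono \<phi>b \<gamma>b C0) auto
    moreover have "\<bar>f (cov (w (idx n w r))) * g (cov (w (idx n w s)))\<bar> \<le> C * 1"
      unfolding abs_mult by (intro mult_mono fb gb C0) auto
    ultimately show ?thesis unfolding z_def by linarith
  qed
  \<comment> \<open>\<open>K1\<close> accompanies the residual at \<open>p\<close> and contains the
    raw data of \<open>q\<close>; \<open>K2\<close> accompanies the residual at \<open>q\<close> and
    sees \<open>p\<close> only through its covariates.\<close>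
  define K1 where "K1 w = \<gamma> (w (idx n w q)) * z w" for w
  define K2 where "K2 w = f (cov (w (idx n w p))) * z w" for w
  have K1m: "K1 \<in> borel_measurable (vec_space n)" unfolding K1_def by (intro borel_measurable_times comp[OF \<gamma>] zm pq)
  have K2m: "K2 \<in> borel_measurable (vec_space n)" unfolding K2_def by (intro borel_measurable_times cf zm pq)
  have K1b: "\<bar>K1 w\<bar> \<le> 1 * (2 * C)" for w
    unfolding K1_def abs_mult by (intro mult_mono \<gamma>b zb) auto
  have K2b: "\<bar>K2 w\<bar> \<le> C * (2 * C)" for w
    unfolding K2_def abs_mult by (intro mult_mono fb zb C0) auto
  have idx_strip: "idx n (w(i := strip (w i))) = idx n w" for w i
    by (simp only: idx_def covs_upd_strip)
  have covs': "cov ((w(i := strip (w i))) k) = cov (w k)" for w :: "nat \<Rightarrow> 'x unit_data" and i k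
    by simp
  have K1inv: "K1 (w(idx n w p := strip (w (idx n w p)))) = K1 w" if "w \<in> space (vec_space n)" for w
  proof -
    have ne: "idx n w q \<noteq> idx n w p" "idx n w r \<noteq> idx n w p" "idx n w s \<noteq> idx n w p"
      using pq(5) by (auto simp: idx_eq_iff[OF n that])
    show ?thesis
      unfolding K1_def z_def idx_strip covs' fun_upd_other[OF ne(1)] fun_upd_other[OF ne(2)]
        fun_upd_other[OF ne(3)] ..
  qed
  have K2inv: "K2 (w(idx n w q := strip (w (idx n w q)))) = K2 w" if "w \<in> space (vec_space n)" for w
  proof -
    have ne: "idx n w p \<noteq> idx n w q" "idx n w r \<noteq> idx n w q" "idx n w s \<noteq> idx n w q"
      using pq(5) by (auto simp: idx_eq_iff[OF n that])
    show ?thesis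
      unfolding K2_def z_def idx_strip covs' fun_upd_other[OF ne(1)] fun_upd_other[OF ne(2)]
        fun_upd_other[OF ne(3)] ..
  qed
  have \<phi>i: "integrable M (\<lambda>\<omega>. \<phi> (W 1 \<omega>))" by (rule integrable_bounded[where C=C]) (use \<phi>b in auto)
  have \<gamma>i: "integrable M (\<lambda>\<omega>. \<gamma> (W 1 \<omega>))" by (rule integrable_bounded[where C=1]) (use \<gamma>b in auto)
  let ?i = "\<lambda>\<omega>. idx n (Ws n \<omega>) p" and ?k = "\<lambda>\<omega>. idx n (Ws n \<omega>) q"
  have e1: "expectation (\<lambda>\<omega>. K1 (Ws n \<omega>) * (\<phi> (W (?i \<omega>) \<omega>) - f (X (?i \<omega>) \<omega>))) = 0"
    by (rule expectation_residual_idx_zero[where K=K1 and \<phi>=\<phi> and f=f and C="1 * (2 * C)"])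
      (rule n pq(1) K1m K1b K1inv \<phi> \<phi>i f; assumption?)+
  have e2: "expectation (\<lambda>\<omega>. K2 (Ws n \<omega>) * (\<gamma> (W (?k \<omega>) \<omega>) - g (X (?k \<omega>) \<omega>))) = 0"
    by (rule expectation_residual_idx_zero[where K=K2 and \<phi>=\<gamma> and f=g and C="C * (2 * C)"])
      (rule n pq(2) K2m K2b K2inv \<gamma> \<gamma>i g; assumption?)+
  have in_n: "idx n (Ws n \<omega>) t \<in> {1..n}" if "\<omega> \<in> space M" "t \<in> {1..n}" for \<omega> t
    using that by (intro idx_Ws_in n)
  have m1: "(\<lambda>\<omega>. \<phi> (W (?i \<omega>) \<omega>) - f (X (?i \<omega>) \<omega>)) \<in> borel_measurable M"
    using measurable_W_idx[OF n pq(1), of "\<lambda>w. \<phi> w - f (cov w)"] by simp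
  have m2: "(\<lambda>\<omega>. \<gamma> (W (?k \<omega>) \<omega>) - g (X (?k \<omega>) \<omega>)) \<in> borel_measurable M"
    using measurable_W_idx[OF n pq(2), of "\<lambda>w. \<gamma> w - g (cov w)"] by simp
  have KM: "(\<lambda>\<omega>. K1 (Ws n \<omega>)) \<in> borel_measurable M" "(\<lambda>\<omega>. K2 (Ws n \<omega>)) \<in> borel_measurable M"
    by (rule measurable_compose[OF measurable_Ws K1m] measurable_compose[OF measurable_Ws K2m])+
  have "expectation (\<lambda>\<omega>. Z p q \<omega> * Z r s \<omega>) =
    expectation (\<lambda>\<omega>. K1 (Ws n \<omega>) * (\<phi> (W (?i \<omega>) \<omega>) - f (X (?i \<omega>) \<omega>)) +
       K2 (Ws n \<omega>) * (\<gamma> (W (?k \<omega>) \<omega>) - g (X (?k \<omega>) \<omega>)))"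
  proof (intro Bochner_Integration.integral_cong refl)
    fix \<omega> assume \<omega>: "\<omega> \<in> space M"
    have z: "Z r s \<omega> = z (Ws n \<omega>)"
      unfolding Z_def z_def Let_def
      by (simp only: Ws_apply[OF in_n[OF \<omega> pq(3)]] Ws_apply[OF in_n[OF \<omega> pq(4)]] cov_W)
    have "Z p q \<omega> * z' = (\<gamma> (W (?k \<omega>) \<omega>) * z') * (\<phi> (W (?i \<omega>) \<omega>) - f (X (?i \<omega>) \<omega>)) +
       (f (X (?i \<omega>) \<omega>) * z') * (\<gamma> (W (?k \<omega>) \<omega>) - g (X (?k \<omega>) \<omega>))" for z'
      unfolding Z_def Let_def by (simp add: algebra_simps)
    then show "Z p q \<omega> * Z r s \<omega> = K1 (Ws n \<omega>) * (\<phi> (W (?i \<omega>) \<omega>) - f (X (?i \<omega>) \<omega>)) +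
       K2 (Ws n \<omega>) * (\<gamma> (W (?k \<omega>) \<omega>) - g (X (?k \<omega>) \<omega>))"
      unfolding z K1_def K2_def
      by (simp only: Ws_apply[OF in_n[OF \<omega> pq(1)]] Ws_apply[OF in_n[OF \<omega> pq(2)]] cov_W)
  qed
  also have "\<dots> = expectation (\<lambda>\<omega>. K1 (Ws n \<omega>) * (\<phi> (W (?i \<omega>) \<omega>) - f (X (?i \<omega>) \<omega>))) +
       expectation (\<lambda>\<omega>. K2 (Ws n \<omega>) * (\<gamma> (W (?k \<omega>) \<omega>) - g (X (?k \<omega>) \<omega>)))"
  proof (rule Bochner_Integration.integral_add)
    have "\<bar>\<phi> w - f x\<bar> \<le> 2 * C" "\<bar>\<gamma> w - g x\<bar> \<le> 2" for w x
      using \<phi>b[of w] fb[of x] \<gamma>b[of w] gb[of x] by linarith+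
    note b = this
    show "integrable M (\<lambda>\<omega>. K1 (Ws n \<omega>) * (\<phi> (W (?i \<omega>) \<omega>) - f (X (?i \<omega>) \<omega>)))"
      by (rule integrable_mult_bounded[OF KM(1) m1 K1b b(1)])
    show "integrable M (\<lambda>\<omega>. K2 (Ws n \<omega>) * (\<gamma> (W (?k \<omega>) \<omega>) - g (X (?k \<omega>) \<omega>)))"
      by (rule integrable_mult_bounded[OF KM(2) m2 K2b b(2)])
  qed
  finally show ?thesis using e1 e2 by simp
qed

subsection \<open>Treatment signs\<close>

definition treat_pair :: "nat \<Rightarrow> nat \<Rightarrow> 'a \<Rightarrow> real \<times> real" where
  "treat_pair n j \<omega> = (D n (idx n (Ws n \<omega>) (2*j-1)) \<omega>, D n (idx n (Ws n \<omega>) (2*j)) \<omega>)"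

text \<open>The sign is bounded by 1 everywhere, but it is 1 or -1 only almost surely: the design
  excludes equal treatments within a pair up to a null set. The identities with the estimators that
  use the pairing are therefore almost sure.\<close>

definition treat_sign :: "nat \<Rightarrow> nat \<Rightarrow> 'a \<Rightarrow> real" where
  "treat_sign n j \<omega> = fst (treat_pair n j \<omega>) - snd (treat_pair n j \<omega>)"

lemma idx_Ws: "idx n (Ws n \<omega>) = \<pi> n (sample_vec n X \<omega>)"
  by (simp add: idx_def covs_Ws)

lemma treat_pair_eq: "treat_pair n j \<omega> = (D n (\<pi> n (sample_vec n X \<omega>) (2*j-1)) \<omega>,
    D n (\<pi> n (sample_vec n X \<omega>) (2*j)) \<omega>)"
  by (simp add: treat_pair_def idx_Ws)

lemma pair_pos_in:
  fixes n j :: nat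
  assumes "j \<in> {1..n div 2}"
  shows "2*j - 1 \<in> {1..n}" "2*j \<in> {1..n}"
  using assms by auto

lemma measurable_sample_vec:
  assumes "\<And>i. i \<in> {1..n} \<Longrightarrow> Z i \<in> borel_measurable M"
  shows "sample_vec n Z \<in> measurable M (vec_space n)"
  unfolding sample_vec_def using assms by (intro measurable_restrict) auto

lemma measurable_sample_X: "sample_vec n X \<in> measurable M (vec_space n)"
  by (intro measurable_sample_vec measurable_X) auto

lemma measurable_sample_D: "even n \<Longrightarrow> sample_vec n (D n) \<in> measurable M (vec_space n)"
  by (intro measurable_sample_vec D_measurable)

text \<open>Measurability is available for the joint vector, as part of independence, and is read
  off by continuous projections.\<close>

lemma measurable_YR:
  assumes "i \<ge> 1"
  shows "Y 1 i \<in> borel_measurable M" "Y 0 i \<in> borel_measurable M"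
    "R 1 i \<in> borel_measurable M" "R 0 i \<in> borel_measurable M"
proof -
  have c: "(\<lambda>\<omega>. h (W i \<omega>)) \<in> borel_measurable M" if "continuous_on UNIV h" for h :: "'x unit_data \<Rightarrow> real"
    by (rule measurable_compose[OF measurable_W[OF assms] borel_measurable_continuous_onI[OF that]])
  show "Y 1 i \<in> borel_measurable M" "Y 0 i \<in> borel_measurable M"
    "R 1 i \<in> borel_measurable M" "R 0 i \<in> borel_measurable M"
    using c[of fst] c[of "\<lambda>w. fst (snd w)"] c[of "\<lambda>w. fst (snd (snd w))"] c[of "\<lambda>w. fst (snd (snd (snd w)))"]
    by (simp_all add: unit_vec_def continuous_intros)
qed

lemma measurable_coord_pi:
  assumes n: "even n" "p \<in> {1..n}"
  shows "(\<lambda>(x, v). v (\<pi> n x p)) \<in> borel_measurable (vec_space n \<Otimes>\<^sub>M vec_space n)"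
  unfolding split_def
proof (rule measurable_compose_countable'[where I="{1..n}"])
  have "(\<lambda>z :: (nat \<Rightarrow> 'x) \<times> (nat \<Rightarrow> 'b). \<pi> n (fst z) p) \<in> measurable (vec_space n \<Otimes>\<^sub>M vec_space n) (count_space UNIV)"
    by (rule measurable_compose[OF measurable_fst pi_measurable[OF n]])
  then have "(\<lambda>z :: (nat \<Rightarrow> 'x) \<times> (nat \<Rightarrow> 'b). \<pi> n (fst z) p) -` {a} \<inter> space (vec_space n \<Otimes>\<^sub>M vec_space n)
     \<in> sets (vec_space n \<Otimes>\<^sub>M vec_space n)" for a
    by (rule measurable_sets) simp
  moreover have "\<pi> n (fst z) p \<in> {1..n}" if "z \<in> space (vec_space n \<Otimes>\<^sub>M vec_space n)"
    for z :: "(nat \<Rightarrow> 'x) \<times> (nat \<Rightarrow> 'b)"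
  proof -
    have "fst z \<in> space (vec_space n)" using that by (auto simp: space_pair_measure)
    then show ?thesis using permutes_in_image[OF pi_permutes[OF n(1)]] n(2) by blast
  qed
  ultimately show "(\<lambda>z :: (nat \<Rightarrow> 'x) \<times> (nat \<Rightarrow> 'b). \<pi> n (fst z) p)
     \<in> measurable (vec_space n \<Otimes>\<^sub>M vec_space n) (count_space {1..n})"
    by (subst measurable_count_space_eq2) auto
qed (auto intro: measurable_compose[OF measurable_snd] measurable_component_singleton)

lemma measurable_treated:
  assumes n: "even n" "p \<in> {1..n}"
  shows "(\<lambda>\<omega>. D n (idx n (Ws n \<omega>) p) \<omega>) \<in> borel_measurable M"
proof -
  have "(\<lambda>\<omega>. (sample_vec n X \<omega>, sample_vec n (D n) \<omega>)) \<in> measurable M (vec_space n \<Otimes>\<^sub>M vec_space n)"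
    by (intro measurable_Pair measurable_sample_X measurable_sample_D n)
  from measurable_compose[OF this measurable_coord_pi[OF n]]
  have "(\<lambda>\<omega>. sample_vec n (D n) \<omega> (idx n (Ws n \<omega>) p)) \<in> borel_measurable M"
    by (simp add: idx_Ws)
  moreover have "sample_vec n (D n) \<omega> (idx n (Ws n \<omega>) p) = D n (idx n (Ws n \<omega>) p) \<omega>" if "\<omega> \<in> space M" for \<omega>
    using idx_Ws_in[OF n(1) that n(2)] by (simp add: sample_vec_def)
  ultimately show ?thesis by (rule measurable_cong[THEN iffD1, rotated])
qed

lemma measurable_treat_pair:
  assumes "even n" "j \<in> {1..n div 2}"
  shows "treat_pair n j \<in> borel_measurable M"
  unfolding treat_pair_def
  by (intro borel_measurable_Pair measurable_treated assms pair_pos_in[OF assms(2)])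

lemma measurable_treat_sign:
  assumes "even n" "j \<in> {1..n div 2}"
  shows "treat_sign n j \<in> borel_measurable M"
  unfolding treat_sign_def treat_pair_def fst_conv snd_conv
  by (intro borel_measurable_diff measurable_treated assms pair_pos_in[OF assms(2)])

lemma treat_sign_bounded:
  assumes "even n" "j \<in> {1..n div 2}" "\<omega> \<in> space M"
  shows "\<bar>treat_sign n j \<omega>\<bar> \<le> 1"
  using D_binary[OF assms(1) idx_Ws_in[OF assms(1,3) pair_pos_in(1)[OF assms(2)]] assms(3)]
    D_binary[OF assms(1) idx_Ws_in[OF assms(1,3) pair_pos_in(2)[OF assms(2)]] assms(3)]
  unfolding treat_sign_def treat_pair_def fst_conv snd_conv by auto

text \<open>Integrated form of a constant conditional probability. Through it the conditional law of
  the treatments enters as plain expectations against events in the covariates.\<close>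

lemma expectation_cprob:
  assumes n: "even n" and A: "A \<in> sets (vec_space n)" and E: "E \<in> sets M"
    and c: "AE \<omega> in M. cprob M (gen_alg M (vec_space n) (sample_vec n X)) E \<omega> = c"
  shows "expectation (\<lambda>\<omega>. indicator A (sample_vec n X \<omega>) * indicator E \<omega>) =
    c * expectation (\<lambda>\<omega>. indicator A (sample_vec n X \<omega>))"
proof -
  let ?F = "gen_alg M (vec_space n) (sample_vec n X)"
  interpret S: sigma_finite_subalgebra M ?F
    by (rule sigma_finite_subalgebra_gen_alg[OF measurable_sample_X])
  have A' [measurable]: "(\<lambda>\<omega>. indicator A (sample_vec n X \<omega>) :: real) \<in> borel_measurable M"
    by (rule measurable_compose[OF measurable_sample_X borel_measurable_indicator[OF A]])
  note E[measurable]
  have "expectation (\<lambda>\<omega>. indicator A (sample_vec n X \<omega>) * indicator E \<omega>) =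
    expectation (\<lambda>\<omega>. indicator A (sample_vec n X \<omega>) * cprob M ?F E \<omega>)"
    unfolding cprob_def
  proof (rule S.real_cond_exp_intg(2)[symmetric])
    show "integrable M (\<lambda>\<omega>. indicator A (sample_vec n X \<omega>) * indicator E \<omega> :: real)"
      by (rule integrable_mult_bounded[where C=1 and C'=1, OF A']) (use E in \<open>auto simp: indicator_def\<close>)
    show "(\<lambda>\<omega>. indicator A (sample_vec n X \<omega>) :: real) \<in> borel_measurable ?F"
      by (rule measurable_gen_alg_comp[OF measurable_sample_X borel_measurable_indicator[OF A]])
  qed simp
  also have "\<dots> = expectation (\<lambda>\<omega>. c * indicator A (sample_vec n X \<omega>))"
  proof (rule integral_cong_AE)
    show "AE \<omega> in M. indicator A (sample_vec n X \<omega>) * cprob M ?F E \<omega> = c * indicator A (sample_vec n X \<omega>)"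
      using c by eventually_elim simp
  qed (auto simp: cprob_def)
  finally show ?thesis by simp
qed

lemma AE_treat_pair:
  assumes n: "even n" and j: "j \<in> {1..n div 2}"
  shows "AE \<omega> in M. treat_pair n j \<omega> \<in> {(0, 1), (1, 0)}"
proof -
  let ?B = "- {(0, 1), (1, 0)} :: (real \<times> real) set"
  define E where "E = {\<omega>\<in>space M. treat_pair n j \<omega> \<in> ?B}"
  have B: "?B \<in> sets borel" by (intro borel_open open_Compl finite_imp_closed) auto
  have E: "E \<in> sets M"
    unfolding E_def using measurable_sets[OF measurable_treat_pair[OF n j] B]
    by (simp add: vimage_def Int_def conj_commute)
  have "measure_pmf.prob (pmf_of_set {(0, 1), (1, 0)}) ?B = 0"
    by (subst measure_pmf_of_set) auto
  then have "AE \<omega> in M. cprob M (gen_alg M (vec_space n) (sample_vec n X)) E \<omega> = 0"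
    using pairs_uniform[OF n j, unfolded cond_distributed_def treat_pair_eq[symmetric], rule_format, OF B]
    by (simp only: E_def)
  from expectation_cprob[OF n sets.top E this]
  have "expectation (\<lambda>\<omega>. indicator (space (vec_space n)) (sample_vec n X \<omega>) * indicator E \<omega> :: real) = 0" by simp
  also have "expectation (\<lambda>\<omega>. indicator (space (vec_space n)) (sample_vec n X \<omega>) * indicator E \<omega> :: real) =
     expectation (indicator E)"
    using measurable_space[OF measurable_sample_X] by (intro Bochner_Integration.integral_cong) auto
  finally have "prob E = 0" using E by simp
  then have "E \<in> null_sets M" using E by (simp add: emeasure_eq_measure null_setsI)
  then show ?thesis by (rule AE_I') (auto simp: E_def)
qed

lemma expectation_two_treat_pairs:
  assumes n: "even n" and jk: "j \<in> {1..n div 2}" "k \<in> {1..n div 2}" "j \<noteq> k"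
    and vw: "v \<in> {(0, 1), (1, 0)}" "w \<in> {(0, 1), (1, 0)}"
    and A: "A \<in> sets (vec_space n)"
  shows "expectation (\<lambda>\<omega>. indicator A (sample_vec n X \<omega>) *
      (indicator {v} (treat_pair n j \<omega>) * indicator {w} (treat_pair n k \<omega>)) :: real) =
    1/4 * expectation (\<lambda>\<omega>. indicator A (sample_vec n X \<omega>))"
proof -
  let ?F = "gen_alg M (vec_space n) (sample_vec n X)" and ?J = "{1..n div 2}"
  let ?p = "pmf_of_set {(0, 1), (1, 0)} :: (real \<times> real) pmf"
  \<comment> \<open>Taking \<open>UNIV\<close> for all other pairs specializes the product formula
    over the whole family to two pairs; the trivial factors have probability 1 and the two others
    1/2.\<close>
  define B where "B l = (if l = j then {v} else if l = k then {w} else UNIV)" for l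
  have B: "B l \<in> sets borel" for l by (simp add: B_def)
  define E where "E = {\<omega>\<in>space M. \<forall>l\<in>?J. treat_pair n l \<omega> \<in> B l}"
  have E_eq: "E = {\<omega>\<in>space M. treat_pair n j \<omega> = v \<and> treat_pair n k \<omega> = w}"
    using jk by (auto simp: E_def B_def)
  have "(treat_pair n j -` {v} \<inter> space M) \<inter> (treat_pair n k -` {w} \<inter> space M) \<in> sets M"
    by (intro sets.Int measurable_sets[OF measurable_treat_pair[OF n]] jk) auto
  then have E: "E \<in> sets M"
    unfolding E_eq by (rule back_subst[of "\<lambda>A. A \<in> sets M"]) auto
  have fam: "AE \<omega> in M. cprob M ?F E \<omega> = (\<Prod>l\<in>?J. cprob M ?F {\<omega>\<in>space M. treat_pair n l \<omega> \<in> B l} \<omega>)"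
    using pairs_cond_indep[OF n] B unfolding cond_indep_family_def treat_pair_eq[symmetric] E_def by blast
  have unif: "AE \<omega> in M. \<forall>l\<in>?J. cprob M ?F {\<omega>\<in>space M. treat_pair n l \<omega> \<in> B l} \<omega> = measure_pmf.prob ?p (B l)"
    using pairs_uniform[OF n] B unfolding cond_distributed_def treat_pair_eq[symmetric]
    by (intro AE_finite_allI) auto
  have "(\<Prod>l\<in>?J. measure_pmf.prob ?p (B l)) = 1/4"
  proof -
    have half: "measure_pmf.prob ?p {u} = 1/2" if "u \<in> {(0, 1), (1, 0)}" for u
      using that by (subst measure_pmf_of_set) auto
    have "(\<Prod>l\<in>?J. measure_pmf.prob ?p (B l)) =
      measure_pmf.prob ?p (B j) * (measure_pmf.prob ?p (B k) * (\<Prod>l\<in>?J-{j}-{k}. measure_pmf.prob ?p (B l)))"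
      using jk by (subst prod.remove[of _ j], simp, simp, subst prod.remove[of _ k]) auto
    also have "(\<Prod>l\<in>?J-{j}-{k}. measure_pmf.prob ?p (B l)) = 1"
      by (intro prod.neutral) (auto simp: B_def measure_pmf.prob_space[simplified])
    finally show ?thesis using jk half[OF vw(1)] half[OF vw(2)] by (simp add: B_def)
  qed
  note prod = this
  have "AE \<omega> in M. cprob M ?F E \<omega> = 1/4"
    using fam unif
  proof eventually_elim
    case (elim \<omega>)
    have "cprob M ?F E \<omega> = (\<Prod>l\<in>?J. measure_pmf.prob ?p (B l))"
      unfolding elim(1) using elim(2) by (intro prod.cong) auto
    then show ?case by (simp only: prod)
  qed
  from expectation_cprob[OF n A E this]
  show ?thesis
    by (rule back_subst[of "\<lambda>x. x = _"], intro Bochner_Integration.integral_cong)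
      (auto simp: E_eq indicator_def)
qed

text \<open>Of the four combinations of two treatment pairs, each carrying conditional mass 1/4, two
  give sign product 1 and two give -1.\<close>

lemma expectation_sign_prod_zero:
  assumes n: "even n" and jk: "j \<in> {1..n div 2}" "k \<in> {1..n div 2}" "j \<noteq> k"
    and A: "A \<in> sets (vec_space n)"
  shows "expectation (\<lambda>\<omega>. indicator A (sample_vec n X \<omega>) * (treat_sign n j \<omega> * treat_sign n k \<omega>)) = 0"
proof -
  let ?T = "{(0, 1), (1, 0)} :: (real \<times> real) set"
  let ?s = "\<lambda>v :: real \<times> real. fst v - snd v"
  let ?i = "\<lambda>v w \<omega>. indicator A (sample_vec n X \<omega>) *
      (indicator {v} (treat_pair n j \<omega>) * indicator {w} (treat_pair n k \<omega>)) :: real"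
  note [measurable] = measurable_treat_pair[OF n jk(1)] measurable_treat_pair[OF n jk(2)]
    measurable_treat_sign[OF n jk(1)] measurable_treat_sign[OF n jk(2)]
  have [measurable]: "(\<lambda>\<omega>. indicator A (sample_vec n X \<omega>) :: real) \<in> borel_measurable M"
    by (rule measurable_compose[OF measurable_sample_X borel_measurable_indicator[OF A]])
  have im [measurable]: "(\<lambda>\<omega>. ?i v w \<omega>) \<in> borel_measurable M" for v w by measurable
  have ii: "integrable M (\<lambda>\<omega>. ?i v w \<omega>)" for v w
    by (rule integrable_bounded[where C=1, OF im]) (auto simp: indicator_def)
  have "expectation (\<lambda>\<omega>. indicator A (sample_vec n X \<omega>) * (treat_sign n j \<omega> * treat_sign n k \<omega>)) =
    expectation (\<lambda>\<omega>. (?i (1,0) (1,0) \<omega> + ?i (0,1) (0,1) \<omega>) - (?i (1,0) (0,1) \<omega> + ?i (0,1) (1,0) \<omega>))"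
  proof (rule integral_cong_AE)
    show "AE \<omega> in M. indicator A (sample_vec n X \<omega>) * (treat_sign n j \<omega> * treat_sign n k \<omega>) =
      (?i (1,0) (1,0) \<omega> + ?i (0,1) (0,1) \<omega>) - (?i (1,0) (0,1) \<omega> + ?i (0,1) (1,0) \<omega>)"
      using AE_treat_pair[OF n jk(1)] AE_treat_pair[OF n jk(2)]
      by eventually_elim (auto simp: treat_sign_def indicator_def)
  qed measurable
  also have "\<dots> = 0"
    using expectation_two_treat_pairs[OF n jk _ _ A, of "(1,0)" "(1,0)"]
      expectation_two_treat_pairs[OF n jk _ _ A, of "(0,1)" "(0,1)"]
      expectation_two_treat_pairs[OF n jk _ _ A, of "(1,0)" "(0,1)"]
      expectation_two_treat_pairs[OF n jk _ _ A, of "(0,1)" "(1,0)"]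
    by (simp add: ii)
  finally show ?thesis .
qed

text \<open>Orthogonality to covariate events extends to the full data by
  \<open>cond_indep_orthogonal\<close>. For this the data vector is presented as a function of
  \<open>(X, U)\<close>, with \<open>U\<close> the outcomes and responses, and the signs as
  functions of the covariate and treatment vectors.\<close>

lemma expectation_mult_signs_zero:
  assumes n: "even n" and jk: "j \<in> {1..n div 2}" "k \<in> {1..n div 2}" "j \<noteq> k"
    and K: "K \<in> borel_measurable (vec_space n)" "\<And>w. w \<in> space (vec_space n) \<Longrightarrow> \<bar>K w\<bar> \<le> (C::real)"
  shows "expectation (\<lambda>\<omega>. K (Ws n \<omega>) * (treat_sign n j \<omega> * treat_sign n k \<omega>)) = 0"
proof -
  define s where "s j = (\<lambda>(x, v :: nat \<Rightarrow> real). v (\<pi> n x (2*j-1)) - v (\<pi> n x (2*j)))" for j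
  define t where "t z = s j z * s k z" for z
  \<comment> \<open>\<open>u\<close> transposes the separate samples of covariates, outcomes and
    responses back into one tuple per unit.\<close>
  define u where "u = (\<lambda>z :: (nat \<Rightarrow> 'x) \<times> (nat \<Rightarrow> real) \<times> (nat \<Rightarrow> real) \<times> (nat \<Rightarrow> real) \<times> (nat \<Rightarrow> real).
     \<lambda>i\<in>{1..n}. (fst (snd z) i, fst (snd (snd z)) i, fst (snd (snd (snd z))) i,
       snd (snd (snd (snd z))) i, fst z i))"
  define U where "U \<omega> = (sample_vec n (Y 1) \<omega>, sample_vec n (Y 0) \<omega>,
                 sample_vec n (R 1) \<omega>, sample_vec n (R 0) \<omega>)" for \<omega>
  let ?N1 = "vec_space n \<Otimes>\<^sub>M vec_space n \<Otimes>\<^sub>M vec_space n \<Otimes>\<^sub>M vec_space n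
    :: ((nat \<Rightarrow> real) \<times> (nat \<Rightarrow> real) \<times> (nat \<Rightarrow> real) \<times> (nat \<Rightarrow> real)) measure"
  have sm: "s l \<in> borel_measurable (vec_space n \<Otimes>\<^sub>M vec_space n)" if "l \<in> {1..n div 2}" for l
    using measurable_coord_pi[OF n pair_pos_in(1)[OF that]] measurable_coord_pi[OF n pair_pos_in(2)[OF that]]
    unfolding s_def split_def by (intro borel_measurable_diff)
  have s_eq: "s l (sample_vec n X \<omega>, sample_vec n (D n) \<omega>) = treat_sign n l \<omega>"
    if "\<omega> \<in> space M" "l \<in> {1..n div 2}" for \<omega> l
    using idx_Ws_in[OF n that(1) pair_pos_in(1)[OF that(2)]] idx_Ws_in[OF n that(1) pair_pos_in(2)[OF that(2)]]
    by (simp add: s_def treat_sign_def treat_pair_def sample_vec_def[of n "D n"] idx_Ws)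
  have tm: "t \<in> borel_measurable (vec_space n \<Otimes>\<^sub>M vec_space n)"
    unfolding t_def by (intro borel_measurable_times sm jk)
  have t_eq: "t (sample_vec n X \<omega>, sample_vec n (D n) \<omega>) = treat_sign n j \<omega> * treat_sign n k \<omega>"
    if "\<omega> \<in> space M" for \<omega>
    unfolding t_def using s_eq[OF that] jk by simp
  have um: "u \<in> measurable (vec_space n \<Otimes>\<^sub>M ?N1) (vec_space n)"
    unfolding u_def
    by (intro measurable_restrict borel_measurable_Pair
       measurable_compose[OF measurable_fst measurable_component_singleton]
       measurable_compose[OF measurable_compose[OF measurable_snd measurable_fst] measurable_component_singleton]
       measurable_compose[OF measurable_compose[OF measurable_compose[OF measurable_snd measurable_snd] measurable_fst] measurable_component_singleton]
       measurable_compose[OF measurable_compose[OF measurable_compose[OF measurable_compose[OF measurable_snd measurable_snd] measurable_snd] measurable_fst] measurable_component_singleton]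
       measurable_compose[OF measurable_compose[OF measurable_compose[OF measurable_compose[OF measurable_snd measurable_snd] measurable_snd] measurable_snd] measurable_component_singleton])
  have u_eq: "u (sample_vec n X \<omega>, U \<omega>) = Ws n \<omega>" for \<omega>
    by (auto simp: u_def U_def sample_vec_def unit_vec_def)
  have Um: "U \<in> measurable M ?N1"
    unfolding U_def by (intro measurable_Pair measurable_sample_vec measurable_YR) auto
  have "expectation (\<lambda>\<omega>. (\<lambda>z. K (u z)) (sample_vec n X \<omega>, U \<omega>) * t (sample_vec n X \<omega>, sample_vec n (D n) \<omega>)) = 0"
  proof (rule cond_indep_orthogonal[OF measurable_sample_X Um measurable_sample_D[OF n] _ tm, where C=1 and C'=C])
    show "cond_indep M (gen_alg M (vec_space n) (sample_vec n X)) ?N1 U (vec_space n) (sample_vec n (D n))"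
      using D_cond_indep[OF n] by (simp only: U_def[abs_def])
    show "(\<lambda>z. K (u z)) \<in> borel_measurable (vec_space n \<Otimes>\<^sub>M ?N1)"
      by (rule measurable_compose[OF um K(1)])
    fix A :: "(nat \<Rightarrow> 'x) set" assume A: "A \<in> sets (vec_space n)"
    have "expectation (\<lambda>\<omega>. indicator A (sample_vec n X \<omega>) * t (sample_vec n X \<omega>, sample_vec n (D n) \<omega>)) =
      expectation (\<lambda>\<omega>. indicator A (sample_vec n X \<omega>) * (treat_sign n j \<omega> * treat_sign n k \<omega>))"
      by (intro Bochner_Integration.integral_cong) (simp_all add: t_eq)
    then show "expectation (\<lambda>\<omega>. indicator A (sample_vec n X \<omega>) * t (sample_vec n X \<omega>, sample_vec n (D n) \<omega>)) = 0"
      using expectation_sign_prod_zero[OF n jk A] by simp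
  next
    fix \<omega> assume \<omega>: "\<omega> \<in> space M"
    show "\<bar>K (u (sample_vec n X \<omega>, U \<omega>))\<bar> \<le> C" using K(2)[OF Ws_space[OF \<omega>]] by (simp only: u_eq)
    have "\<bar>treat_sign n j \<omega>\<bar> * \<bar>treat_sign n k \<omega>\<bar> \<le> 1 * 1"
      using treat_sign_bounded[OF n jk(1) \<omega>] treat_sign_bounded[OF n jk(2) \<omega>] by (intro mult_mono) auto
    then show "\<bar>t (sample_vec n X \<omega>, sample_vec n (D n) \<omega>)\<bar> \<le> 1"
      by (simp add: t_eq[OF \<omega>] abs_mult)
  qed
  then show ?thesis
    by (simp only: u_eq) (simp add: t_eq cong: Bochner_Integration.integral_cong)
qed

end

subsection \<open>Averages over pairs\<close>

text \<open>The permutation reindexes the sum over units; for even \<open>n\<close> the positions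
  then split exactly into \<open>2*j-1\<close> and \<open>2*j\<close>.\<close>

lemma sum_pairs:
  fixes h :: "nat \<Rightarrow> 'b::comm_monoid_add"
  assumes "even n" and p: "p permutes {1..n}"
  shows "(\<Sum>i=1..n. h i) = (\<Sum>j=1..n div 2. h (p (2*j-1)) + h (p (2*j)))"
proof -
  have "(\<Sum>i=1..2*m. u i) = (\<Sum>j=1..m. u (2*j-1) + u (2*j))" for u :: "nat \<Rightarrow> 'b" and m
    by (induction m) (simp_all add: add.assoc)
  from this[of "h \<circ> p" "n div 2"] show ?thesis
    using sum.permute[OF p, of h] \<open>even n\<close> by simp
qed

text \<open>A deterministic identity per pair. The unprimed \<open>F, f\<close> stand for the
  variable and its Lipschitz regression function, the primed ones for the truncation and its bounded
  regression function, and \<open>e\<close> for the mean of \<open>f' * g\<close>. Keeping it free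
  of probability lets each group of terms be estimated by its own method.\<close>

lemma pair_sum_bound:
  fixes Fa Fb Fa' Fb' Ga Gb fa fb fa' fb' ga gb S :: "'j \<Rightarrow> real" and c e :: real
  assumes S: "\<And>j. j \<in> J \<Longrightarrow> \<bar>S j\<bar> \<le> 1" and c: "\<bar>c\<bar> = 1"
    and G: "\<And>j. j \<in> J \<Longrightarrow> \<bar>Ga j\<bar> \<le> 1" "\<And>j. j \<in> J \<Longrightarrow> \<bar>Gb j\<bar> \<le> 1"
    and g: "\<And>j. j \<in> J \<Longrightarrow> \<bar>ga j\<bar> \<le> 1" "\<And>j. j \<in> J \<Longrightarrow> \<bar>gb j\<bar> \<le> 1"
  shows "\<bar>(\<Sum>j\<in>J. Fa j * Gb j * ((1 + c * S j) / 2) + Fb j * Ga j * ((1 - c * S j) / 2)) - card J * e\<bar> \<le>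
    (\<Sum>j\<in>J. \<bar>Fa j - Fa' j\<bar> + \<bar>Fb j - Fb' j\<bar>)
    + 1/2 * \<bar>\<Sum>j\<in>J. (Fa' j * Gb j - Fb' j * Ga j) * S j\<bar>
    + 1/2 * \<bar>\<Sum>j\<in>J. Fa' j * Gb j - fa' j * gb j\<bar>
    + 1/2 * \<bar>\<Sum>j\<in>J. Fb' j * Ga j - fb' j * ga j\<bar>
    + (\<Sum>j\<in>J. \<bar>fa j - fa' j\<bar> + \<bar>fb j - fb' j\<bar>)
    + 1/2 * \<bar>\<Sum>j\<in>J. (fa' j * ga j - e) + (fb' j * gb j - e)\<bar>
    + (\<Sum>j\<in>J. \<bar>fa j - fb j\<bar>)" (is "?L \<le> _")
proof -
  \<comment> \<open>The \<open>t\<close> terms are small one by one, so their absolute values are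
    summed; the \<open>s\<close> terms are small only through cancellation, so their sums stay
    inside the absolute value.\<close>
  define t1 where "t1 j = (Fa j - Fa' j) * (Gb j * ((1 + c * S j) / 2))
    + (Fb j - Fb' j) * (Ga j * ((1 - c * S j) / 2))" for j
  \<comment> \<open>Exchanging \<open>g\<close> within the pair costs half of
    \<open>(fa' - fb') * (gb - ga)\<close>. The term \<open>t2\<close> replaces \<open>f'\<close> by
    \<open>f\<close> in it, and what is left is \<open>- t3\<close>, which the Lipschitz bound
    controls.\<close>
  define t2 where "t2 j = (fa' j - fa j) * ((gb j - ga j) / 2) + (fb' j - fb j) * ((ga j - gb j) / 2)" for j
  define t3 where "t3 j = (fa j - fb j) * ((ga j - gb j) / 2)" for j
  define s1 where "s1 j = (Fa' j * Gb j - Fb' j * Ga j) * S j" for j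
  define s2 where "s2 j = Fa' j * Gb j - fa' j * gb j" for j
  define s3 where "s3 j = Fb' j * Ga j - fb' j * ga j" for j
  define s4 where "s4 j = (fa' j * ga j - e) + (fb' j * gb j - e)" for j
  have "Fa j * Gb j * ((1 + c * S j) / 2) + Fb j * Ga j * ((1 - c * S j) / 2) - e =
    t1 j + c/2 * s1 j + 1/2 * s2 j + 1/2 * s3 j + t2 j + 1/2 * s4 j - t3 j" for j
    unfolding t1_def t2_def t3_def s1_def s2_def s3_def s4_def by (simp add: field_simps)
  then have "(\<Sum>j\<in>J. Fa j * Gb j * ((1 + c * S j) / 2) + Fb j * Ga j * ((1 - c * S j) / 2) - e) =
    (\<Sum>j\<in>J. t1 j + c/2 * s1 j + 1/2 * s2 j + 1/2 * s3 j + t2 j + 1/2 * s4 j - t3 j)"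
    by (intro sum.cong refl)
  also have "\<dots> = (\<Sum>j\<in>J. t1 j) + c/2 * (\<Sum>j\<in>J. s1 j) + 1/2 * (\<Sum>j\<in>J. s2 j) + 1/2 * (\<Sum>j\<in>J. s3 j)
    + (\<Sum>j\<in>J. t2 j) + 1/2 * (\<Sum>j\<in>J. s4 j) - (\<Sum>j\<in>J. t3 j)"
    by (simp only: sum.distrib sum_subtractf sum_distrib_left)
  finally have "(\<Sum>j\<in>J. Fa j * Gb j * ((1 + c * S j) / 2) + Fb j * Ga j * ((1 - c * S j) / 2) - e) = \<dots>" .
  moreover have "(\<Sum>j\<in>J. Fa j * Gb j * ((1 + c * S j) / 2) + Fb j * Ga j * ((1 - c * S j) / 2) - e) =
    (\<Sum>j\<in>J. Fa j * Gb j * ((1 + c * S j) / 2) + Fb j * Ga j * ((1 - c * S j) / 2)) - card J * e"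
    by (simp add: sum_subtractf)
  moreover have "\<bar>c/2 * (\<Sum>j\<in>J. s1 j)\<bar> = 1/2 * \<bar>\<Sum>j\<in>J. s1 j\<bar>"
    using c by (simp add: abs_mult)
  moreover have "\<bar>\<Sum>j\<in>J. t1 j\<bar> \<le> (\<Sum>j\<in>J. \<bar>Fa j - Fa' j\<bar> + \<bar>Fb j - Fb' j\<bar>)"
  proof (rule order_trans[OF sum_abs sum_mono])
    fix j assume j: "j \<in> J"
    have "\<bar>c * S j\<bar> \<le> 1" using S[OF j] c by (simp add: abs_mult)
    moreover have "\<bar>(1 + y) / 2\<bar> \<le> 1" "\<bar>(1 - y) / 2\<bar> \<le> 1" if "\<bar>y\<bar> \<le> 1" for y :: real
      using that by (simp_all add: abs_le_iff)
    ultimately have "\<bar>(1 + c * S j) / 2\<bar> \<le> 1" "\<bar>(1 - c * S j) / 2\<bar> \<le> 1" by blast+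
    then have "\<bar>Gb j * ((1 + c * S j) / 2)\<bar> \<le> 1 * 1" "\<bar>Ga j * ((1 - c * S j) / 2)\<bar> \<le> 1 * 1"
      using G[OF j] unfolding abs_mult[of "Gb j"] abs_mult[of "Ga j"] by (intro mult_mono; simp)+
    then have "\<bar>Fa j - Fa' j\<bar> * \<bar>Gb j * ((1 + c * S j) / 2)\<bar> \<le> \<bar>Fa j - Fa' j\<bar>"
      "\<bar>Fb j - Fb' j\<bar> * \<bar>Ga j * ((1 - c * S j) / 2)\<bar> \<le> \<bar>Fb j - Fb' j\<bar>"
      by (simp_all only: mult_1_right mult_left_le abs_ge_zero)
    then show "\<bar>t1 j\<bar> \<le> \<bar>Fa j - Fa' j\<bar> + \<bar>Fb j - Fb' j\<bar>"
      unfolding t1_def abs_mult[symmetric] by linarith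
  qed
  moreover have gg: "\<bar>(gb j - ga j) / 2\<bar> \<le> 1" "\<bar>(ga j - gb j) / 2\<bar> \<le> 1" if "j \<in> J" for j
    using g[OF that] by (simp_all add: abs_le_iff)
  have le: "\<bar>x * y\<bar> \<le> \<bar>x\<bar>" if "\<bar>y\<bar> \<le> 1" for x y :: real
    using that by (simp add: abs_mult mult_left_le)
  have "\<bar>\<Sum>j\<in>J. t2 j\<bar> \<le> (\<Sum>j\<in>J. \<bar>fa j - fa' j\<bar> + \<bar>fb j - fb' j\<bar>)"
  proof (rule order_trans[OF sum_abs sum_mono])
    fix j assume j: "j \<in> J"
    show "\<bar>t2 j\<bar> \<le> \<bar>fa j - fa' j\<bar> + \<bar>fb j - fb' j\<bar>"
      using le[OF gg(1)[OF j], of "fa' j - fa j"] le[OF gg(2)[OF j], of "fb' j - fb j"]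
      unfolding t2_def by linarith
  qed
  moreover have "\<bar>\<Sum>j\<in>J. t3 j\<bar> \<le> (\<Sum>j\<in>J. \<bar>fa j - fb j\<bar>)"
    unfolding t3_def by (rule order_trans[OF sum_abs sum_mono]) (rule le[OF gg(2)])
  ultimately show ?thesis
    unfolding s1_def[symmetric] s2_def[symmetric] s3_def[symmetric] s4_def[symmetric] by linarith
qed

context prob_space
begin

text \<open>Dominated convergence: at each point the truncation is exact from some level on, and the
  error never exceeds the absolute value of \<open>Z\<close>.\<close>

lemma truncation_L1:
  fixes Z :: "'a \<Rightarrow> real"
  assumes Z: "integrable M Z" and "\<eta> > 0"
  shows "\<exists>K\<ge>0. expectation (\<lambda>\<omega>. \<bar>Z \<omega> - (if \<bar>Z \<omega>\<bar> \<le> K then Z \<omega> else 0)\<bar>) < \<eta>"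
proof -
  have [measurable]: "Z \<in> borel_measurable M" using Z by simp
  have "(\<lambda>k. expectation (\<lambda>\<omega>. \<bar>Z \<omega> - (if \<bar>Z \<omega>\<bar> \<le> real k then Z \<omega> else 0)\<bar>)) \<longlonglongrightarrow> expectation (\<lambda>\<omega>. 0)"
  proof (rule integral_dominated_convergence[where w="\<lambda>\<omega>. \<bar>Z \<omega>\<bar>"])
    show "AE \<omega> in M. (\<lambda>k. \<bar>Z \<omega> - (if \<bar>Z \<omega>\<bar> \<le> real k then Z \<omega> else 0)\<bar>) \<longlonglongrightarrow> 0"
    proof (rule AE_I2)
      fix \<omega>
      obtain k0 where "\<bar>Z \<omega>\<bar> \<le> real k0" using real_arch_simple by blast
      then have "eventually (\<lambda>k. \<bar>Z \<omega> - (if \<bar>Z \<omega>\<bar> \<le> real k then Z \<omega> else 0)\<bar> = 0) sequentially"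
        by (intro eventually_sequentiallyI[of k0]) auto
      then show "(\<lambda>k. \<bar>Z \<omega> - (if \<bar>Z \<omega>\<bar> \<le> real k then Z \<omega> else 0)\<bar>) \<longlonglongrightarrow> 0"
        by (rule tendsto_eventually)
    qed
  qed (use Z in auto)
  then have "eventually (\<lambda>k. expectation (\<lambda>\<omega>. \<bar>Z \<omega> - (if \<bar>Z \<omega>\<bar> \<le> real k then Z \<omega> else 0)\<bar>) < \<eta>) sequentially"
    using \<open>\<eta> > 0\<close> by (intro order_tendstoD(2)) auto
  then obtain k :: nat where "expectation (\<lambda>\<omega>. \<bar>Z \<omega> - (if \<bar>Z \<omega>\<bar> \<le> real k then Z \<omega> else 0)\<bar>) < \<eta>"
    using eventually_happens'[OF sequentially_bot] by blast
  then show ?thesis by (intro exI[where x="real k"]) simp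
qed

end

context matched_pairs
begin

section \<open>Mean absolute size of the sums over units and pairs\<close>

lemma expectation_abs_sum_ident:
  fixes h :: "'x unit_data \<Rightarrow> real"
  assumes [measurable]: "h \<in> borel_measurable borel" and h: "integrable M (\<lambda>\<omega>. h (W 1 \<omega>))"
  shows "integrable M (\<lambda>\<omega>. \<Sum>i=1..n. \<bar>h (W i \<omega>)\<bar>)"
    and "expectation (\<lambda>\<omega>. \<Sum>i=1..n. \<bar>h (W i \<omega>)\<bar>) = n * expectation (\<lambda>\<omega>. \<bar>h (W 1 \<omega>)\<bar>)"
proof -
  have i: "integrable M (\<lambda>\<omega>. \<bar>h (W i \<omega>)\<bar>)" if "i \<in> {1..n}" for i
    using that h expectation_ident(2)[of h i] by simp
  then show "integrable M (\<lambda>\<omega>. \<Sum>i=1..n. \<bar>h (W i \<omega>)\<bar>)" by auto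
  have e: "expectation (\<lambda>\<omega>. \<bar>h (W i \<omega>)\<bar>) = expectation (\<lambda>\<omega>. \<bar>h (W 1 \<omega>)\<bar>)" if "i \<in> {1..n}" for i
    using that by (intro expectation_ident(1)[of "\<lambda>w. \<bar>h w\<bar>" i]) auto
  have "expectation (\<lambda>\<omega>. \<Sum>i=1..n. \<bar>h (W i \<omega>)\<bar>) = (\<Sum>i=1..n. expectation (\<lambda>\<omega>. \<bar>h (W i \<omega>)\<bar>))"
    using i by (rule Bochner_Integration.integral_sum)
  also have "\<dots> = (\<Sum>i=1..n. expectation (\<lambda>\<omega>. \<bar>h (W 1 \<omega>)\<bar>))" by (intro sum.cong refl e)
  finally show "expectation (\<lambda>\<omega>. \<Sum>i=1..n. \<bar>h (W i \<omega>)\<bar>) = n * expectation (\<lambda>\<omega>. \<bar>h (W 1 \<omega>)\<bar>)" by simp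
qed

text \<open>A law of large numbers with rate: distinct centred terms are orthogonal by independence,
  and centring at most doubles the bound \<open>C\<close>.\<close>

lemma centered_sum_L1:
  fixes h :: "'x unit_data \<Rightarrow> real"
  assumes h [measurable]: "h \<in> borel_measurable borel" and hb: "\<And>w. \<bar>h w\<bar> \<le> C"
  defines "e \<equiv> expectation (\<lambda>\<omega>. h (W 1 \<omega>))"
  shows "integrable M (\<lambda>\<omega>. \<Sum>i=1..n. h (W i \<omega>) - e)"
    and "expectation (\<lambda>\<omega>. \<bar>\<Sum>i=1..n. h (W i \<omega>) - e\<bar>) \<le> 2 * C * sqrt n"
proof -
  have hi: "integrable M (\<lambda>\<omega>. h (W i \<omega>))" if "i \<in> {1..n}" for i
    by (rule integrable_bounded[where C=C]) (use hb that in auto)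
  have C0: "C \<ge> 0" using hb[of undefined] by linarith
  have eb: "\<bar>e\<bar> \<le> C"
  proof -
    have "\<bar>e\<bar> \<le> expectation (\<lambda>\<omega>. \<bar>h (W 1 \<omega>)\<bar>)" unfolding e_def by (rule integral_abs_bound)
    also have "\<dots> \<le> expectation (\<lambda>\<omega>. C)"
    proof (rule integral_mono)
      show "integrable M (\<lambda>\<omega>. \<bar>h (W 1 \<omega>)\<bar>)"
        by (rule integrable_bounded[where C=C]) (use hb in auto)
    qed (use hb in auto)
    finally show ?thesis by (simp add: prob_space)
  qed
  have b: "\<bar>h w - e\<bar> \<le> 2 * C" for w using hb[of w] eb by linarith
  have m: "(\<lambda>\<omega>. h (W i \<omega>) - e) \<in> borel_measurable M" if "i \<in> {1..n}" for i
    using that by simp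
  have orth: "expectation (\<lambda>\<omega>. (h (W i \<omega>) - e) * (h (W k \<omega>) - e)) = 0"
    if ik: "i \<in> {1..n}" "k \<in> {1..n}" "i \<noteq> k" for i k
  proof -
    have k: "(\<lambda>\<omega>. (\<lambda>u. h (u k) - e) (\<lambda>j\<in>{k}. W j \<omega>)) = (\<lambda>\<omega>. h (W k \<omega>) - e)" by auto
    have "expectation (\<lambda>\<omega>. (\<lambda>w. h w - e) (W i \<omega>) * (\<lambda>u. h (u k) - e) (\<lambda>j\<in>{k}. W j \<omega>)) =
      expectation (\<lambda>\<omega>. (\<lambda>w. h w - e) (W i \<omega>)) * expectation (\<lambda>\<omega>. (\<lambda>u. h (u k) - e) (\<lambda>j\<in>{k}. W j \<omega>))"
    proof (rule expectation_indep_mult)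
      show "(\<lambda>u. h (u k) - e) \<in> borel_measurable (PiM {k} (\<lambda>_. borel))"
        by (intro borel_measurable_diff measurable_compose[OF _ h] measurable_component_singleton) auto
    qed (use ik hi in auto)
    also have "expectation (\<lambda>\<omega>. (\<lambda>w. h w - e) (W i \<omega>)) = 0"
      using hi[OF ik(1)] expectation_ident(1)[OF h, of i] ik(1) by (simp add: prob_space e_def)
    finally show ?thesis by simp
  qed
  have "expectation (\<lambda>\<omega>. \<bar>\<Sum>i\<in>{1..n}. h (W i \<omega>) - e\<bar>) \<le> 2 * C * sqrt (card {1..n})"
    using m b C0 orth by (intro expectation_abs_orthogonal_sum_le(2)) auto
  then show "expectation (\<lambda>\<omega>. \<bar>\<Sum>i=1..n. h (W i \<omega>) - e\<bar>) \<le> 2 * C * sqrt n" by simp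
  show "integrable M (\<lambda>\<omega>. \<Sum>i=1..n. h (W i \<omega>) - e)"
    using hi by (intro Bochner_Integration.integrable_sum Bochner_Integration.integrable_diff) auto
qed

text \<open>The orthogonality comes from the signs: for two pairs the data kernels multiply to one
  bounded function of the data vector, against which the product of two signs integrates to
  zero.\<close>

lemma signed_sum_L1:
  fixes \<phi> \<gamma> :: "'x unit_data \<Rightarrow> real"
  assumes n: "even n" and \<phi>: "\<phi> \<in> borel_measurable borel" "\<And>w. \<bar>\<phi> w\<bar> \<le> C"
    and \<gamma>: "\<gamma> \<in> borel_measurable borel" "\<And>w. \<bar>\<gamma> w\<bar> \<le> 1"
  defines "Z \<equiv> \<lambda>j \<omega>. let a = idx n (Ws n \<omega>) (2*j-1); b = idx n (Ws n \<omega>) (2*j) in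
     (\<phi> (W a \<omega>) * \<gamma> (W b \<omega>) - \<phi> (W b \<omega>) * \<gamma> (W a \<omega>)) * treat_sign n j \<omega>"
  shows "integrable M (\<lambda>\<omega>. \<Sum>j=1..n div 2. Z j \<omega>)"
    and "expectation (\<lambda>\<omega>. \<bar>\<Sum>j=1..n div 2. Z j \<omega>\<bar>) \<le> 2 * C * sqrt n"
proof -
  define k where "k j w = \<phi> (w (idx n w (2*j-1))) * \<gamma> (w (idx n w (2*j)))
     - \<phi> (w (idx n w (2*j))) * \<gamma> (w (idx n w (2*j-1)))" for j w
  have C0: "C \<ge> 0" using \<phi>(2)[of undefined] by linarith
  have km: "k j \<in> borel_measurable (vec_space n)" if "j \<in> {1..n div 2}" for j
    unfolding k_def
    by (intro borel_measurable_diff borel_measurable_times measurable_idx_comp n \<phi> \<gamma> pair_pos_in[OF that])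
  have kb: "\<bar>k j w\<bar> \<le> 2 * C" for j w
  proof -
    have "\<bar>\<phi> u * \<gamma> v\<bar> \<le> C * 1" for u v unfolding abs_mult by (intro mult_mono \<phi> \<gamma> C0) auto
    from this[of "w (idx n w (2*j-1))" "w (idx n w (2*j))"] this[of "w (idx n w (2*j))" "w (idx n w (2*j-1))"]
    show ?thesis unfolding k_def by linarith
  qed
  have Z_eq: "Z j \<omega> = k j (Ws n \<omega>) * treat_sign n j \<omega>" if "\<omega> \<in> space M" "j \<in> {1..n div 2}" for j \<omega>
    unfolding Z_def Let_def k_def
    by (simp only: Ws_apply[OF idx_Ws_in[OF n that(1) pair_pos_in(1)[OF that(2)]]]
       Ws_apply[OF idx_Ws_in[OF n that(1) pair_pos_in(2)[OF that(2)]]])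
  have Zm: "Z j \<in> borel_measurable M" if j: "j \<in> {1..n div 2}" for j
  proof -
    have "(\<lambda>\<omega>. k j (Ws n \<omega>) * treat_sign n j \<omega>) \<in> borel_measurable M"
      by (intro borel_measurable_times measurable_compose[OF measurable_Ws km] measurable_treat_sign n j)
    then show ?thesis by (rule measurable_cong[THEN iffD1, rotated]) (rule Z_eq[OF _ j, symmetric])
  qed
  have Zb: "\<bar>Z j \<omega>\<bar> \<le> 2 * C" if "j \<in> {1..n div 2}" "\<omega> \<in> space M" for j \<omega>
  proof -
    have "\<bar>k j (Ws n \<omega>)\<bar> * \<bar>treat_sign n j \<omega>\<bar> \<le> (2 * C) * 1"
      using C0 by (intro mult_mono kb treat_sign_bounded n that) auto
    then show ?thesis unfolding Z_eq[OF that(2,1)] abs_mult by simp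
  qed
  have orth: "expectation (\<lambda>\<omega>. Z i \<omega> * Z j \<omega>) = 0"
    if ij: "i \<in> {1..n div 2}" "j \<in> {1..n div 2}" "i \<noteq> j" for i j
  proof -
    have "expectation (\<lambda>\<omega>. Z i \<omega> * Z j \<omega>) =
      expectation (\<lambda>\<omega>. (\<lambda>w. k i w * k j w) (Ws n \<omega>) * (treat_sign n i \<omega> * treat_sign n j \<omega>))"
      by (intro Bochner_Integration.integral_cong refl) (simp only: Z_eq[OF _ ij(1)] Z_eq[OF _ ij(2)] mult_ac)
    also have "\<dots> = 0"
    proof (rule expectation_mult_signs_zero[OF n ij])
      show "(\<lambda>w. k i w * k j w) \<in> borel_measurable (vec_space n)" using km ij by simp
      show "\<bar>k i w * k j w\<bar> \<le> (2 * C) * (2 * C)" for w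
        unfolding abs_mult using C0 by (intro mult_mono kb) auto
    qed
    finally show ?thesis .
  qed
  note * = expectation_abs_orthogonal_sum_le[where J="{1..n div 2}" and Z=Z and C="2 * C"]
  show "integrable M (\<lambda>\<omega>. \<Sum>j=1..n div 2. Z j \<omega>)"
    using Zm Zb orth C0 by (intro *(1)) auto
  have "expectation (\<lambda>\<omega>. \<bar>\<Sum>j=1..n div 2. Z j \<omega>\<bar>) \<le> 2 * C * sqrt (card {1..n div 2})"
    using Zm Zb orth C0 by (intro *(2)) auto
  also have "\<dots> \<le> 2 * C * sqrt n"
    using C0 by (intro mult_left_mono real_sqrt_le_mono) auto
  finally show "expectation (\<lambda>\<omega>. \<bar>\<Sum>j=1..n div 2. Z j \<omega>\<bar>) \<le> 2 * C * sqrt n" .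
qed

text \<open>The positions \<open>a j\<close> and \<open>b j\<close> are left general because the
  estimate is needed in both orders, with \<open>\<phi>\<close> at either member of the
  pair.\<close>

lemma residual_sum_L1:
  fixes \<phi> \<gamma> :: "'x unit_data \<Rightarrow> real" and f g :: "'x \<Rightarrow> real" and a b :: "nat \<Rightarrow> nat"
  assumes n: "even n"
    and ab: "\<And>j. j \<in> {1..n div 2} \<Longrightarrow> a j \<in> {1..n}" "\<And>j. j \<in> {1..n div 2} \<Longrightarrow> b j \<in> {1..n}"
      "\<And>i j. i \<in> {1..n div 2} \<Longrightarrow> j \<in> {1..n div 2} \<Longrightarrow> i \<noteq> j \<Longrightarrow> distinct [a i, b i, a j, b j]"
    and \<phi>: "\<phi> \<in> borel_measurable borel" and \<phi>b: "\<And>w. \<bar>\<phi> w\<bar> \<le> C"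
    and f: "cexp_version M (X 1) (\<lambda>\<omega>. \<phi> (W 1 \<omega>)) f" and fb: "\<And>x. \<bar>f x\<bar> \<le> C"
    and \<gamma>: "\<gamma> \<in> borel_measurable borel" and \<gamma>b: "\<And>w. \<bar>\<gamma> w\<bar> \<le> 1"
    and g: "cexp_version M (X 1) (\<lambda>\<omega>. \<gamma> (W 1 \<omega>)) g" and gb: "\<And>x. \<bar>g x\<bar> \<le> 1"
  defines "Z \<equiv> \<lambda>j \<omega>. let i = idx n (Ws n \<omega>) (a j); k = idx n (Ws n \<omega>) (b j) in
     \<phi> (W i \<omega>) * \<gamma> (W k \<omega>) - f (X i \<omega>) * g (X k \<omega>)"
  shows "integrable M (\<lambda>\<omega>. \<Sum>j=1..n div 2. Z j \<omega>)"
    and "expectation (\<lambda>\<omega>. \<bar>\<Sum>j=1..n div 2. Z j \<omega>\<bar>) \<le> 2 * C * sqrt n"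
proof -
  have fm [measurable]: "f \<in> borel_measurable borel" using f by (simp add: cexp_version_def)
  have gm [measurable]: "g \<in> borel_measurable borel" using g by (simp add: cexp_version_def)
  have C0: "C \<ge> 0" using fb[of undefined] by linarith
  have Zm: "Z j \<in> borel_measurable M" if j: "j \<in> {1..n div 2}" for j
  proof -
    have "(\<lambda>\<omega>. f (X (idx n (Ws n \<omega>) (a j)) \<omega>)) \<in> borel_measurable M"
      using measurable_W_idx[OF n ab(1)[OF j], of "\<lambda>w. f (cov w)"] by simp
    moreover have "(\<lambda>\<omega>. g (X (idx n (Ws n \<omega>) (b j)) \<omega>)) \<in> borel_measurable M"
      using measurable_W_idx[OF n ab(2)[OF j], of "\<lambda>w. g (cov w)"] by simp
    ultimately show ?thesis
      unfolding Z_def Let_def using measurable_W_idx[OF n ab(1)[OF j] \<phi>] measurable_W_idx[OF n ab(2)[OF j] \<gamma>]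
      by (intro borel_measurable_diff borel_measurable_times)
  qed
  have Zb: "\<bar>Z j \<omega>\<bar> \<le> 2 * C" for j \<omega>
  proof -
    have \<phi>\<gamma>: "\<bar>\<phi> u * \<gamma> v\<bar> \<le> C * 1" for u v unfolding abs_mult by (intro mult_mono \<phi>b \<gamma>b C0) auto
    have fg: "\<bar>f u * g v\<bar> \<le> C * 1" for u v unfolding abs_mult by (intro mult_mono fb gb C0) auto
    have "\<bar>\<phi> u * \<gamma> v - f x * g y\<bar> \<le> 2 * C" for u v x y
      using \<phi>\<gamma>[of u v] fg[of x y] by linarith
    then show ?thesis unfolding Z_def Let_def .
  qed
  have orth: "expectation (\<lambda>\<omega>. Z i \<omega> * Z j \<omega>) = 0"
    if ij: "i \<in> {1..n div 2}" "j \<in> {1..n div 2}" "i \<noteq> j" for i j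
    unfolding Z_def
    by (rule expectation_pair_residuals_zero[OF n ab(1)[OF ij(1)] ab(2)[OF ij(1)] ab(1)[OF ij(2)]
        ab(2)[OF ij(2)] ab(3)[OF ij] \<phi> \<phi>b f fb \<gamma> \<gamma>b g gb])
  note * = expectation_abs_orthogonal_sum_le[where J="{1..n div 2}" and Z=Z and C="2 * C"]
  show "integrable M (\<lambda>\<omega>. \<Sum>j=1..n div 2. Z j \<omega>)"
    using Zm Zb orth C0 by (intro *(1)) auto
  have "expectation (\<lambda>\<omega>. \<bar>\<Sum>j=1..n div 2. Z j \<omega>\<bar>) \<le> 2 * C * sqrt (card {1..n div 2})"
    using Zm Zb orth C0 by (intro *(2)) auto
  also have "\<dots> \<le> 2 * C * sqrt n"
    using C0 by (intro mult_left_mono real_sqrt_le_mono) auto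
  finally show "expectation (\<lambda>\<omega>. \<bar>\<Sum>j=1..n div 2. Z j \<omega>\<bar>) \<le> 2 * C * sqrt n" .
qed

end

text \<open>Linear bookkeeping for the bounding variable of a matched average; its coefficients are
  those of \<open>pair_sum_bound\<close>, without the pair distance.\<close>

lemma (in prob_space) expectation_six_le:
  fixes a\<^sub>1 a\<^sub>2 a\<^sub>3 a\<^sub>4 a\<^sub>5 a\<^sub>6 :: "'a \<Rightarrow> real"
  assumes i: "integrable M a\<^sub>1" "integrable M a\<^sub>2" "integrable M a\<^sub>3" "integrable M a\<^sub>4" "integrable M a\<^sub>5" "integrable M a\<^sub>6"
    and b: "expectation a\<^sub>1 \<le> b\<^sub>1" "expectation a\<^sub>2 \<le> b\<^sub>2" "expectation a\<^sub>3 \<le> b\<^sub>3"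
      "expectation a\<^sub>4 \<le> b\<^sub>4" "expectation a\<^sub>5 \<le> b\<^sub>5" "expectation a\<^sub>6 \<le> b\<^sub>6"
    and "r \<ge> 0"
  shows "expectation (\<lambda>\<omega>. r * (a\<^sub>1 \<omega> + 1/2 * a\<^sub>2 \<omega> + 1/2 * a\<^sub>3 \<omega> + 1/2 * a\<^sub>4 \<omega> + a\<^sub>5 \<omega> + 1/2 * a\<^sub>6 \<omega>) + k)
    \<le> r * (b\<^sub>1 + 1/2 * b\<^sub>2 + 1/2 * b\<^sub>3 + 1/2 * b\<^sub>4 + b\<^sub>5 + 1/2 * b\<^sub>6) + k"
proof -
  have "expectation (\<lambda>\<omega>. r * (a\<^sub>1 \<omega> + 1/2 * a\<^sub>2 \<omega> + 1/2 * a\<^sub>3 \<omega> + 1/2 * a\<^sub>4 \<omega> + a\<^sub>5 \<omega> + 1/2 * a\<^sub>6 \<omega>) + k) =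
    r * (expectation a\<^sub>1 + 1/2 * expectation a\<^sub>2 + 1/2 * expectation a\<^sub>3 + 1/2 * expectation a\<^sub>4
      + expectation a\<^sub>5 + 1/2 * expectation a\<^sub>6) + k"
    using i by (simp add: prob_space)
  also have "\<dots> \<le> r * (b\<^sub>1 + 1/2 * b\<^sub>2 + 1/2 * b\<^sub>3 + 1/2 * b\<^sub>4 + b\<^sub>5 + 1/2 * b\<^sub>6) + k"
    using b \<open>r \<ge> 0\<close> by (intro add_right_mono mult_left_mono) linarith+
  finally show ?thesis .
qed

section \<open>The limit of a matched average\<close>

context matched_pairs
begin

text \<open>Indices start at 1 because natural subtraction truncates: at 0 the two positions would
  coincide.\<close>

lemma distinct_pair_pos:
  fixes i j :: nat
  assumes "i \<ge> 1" "j \<ge> 1" "i \<noteq> j"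
  shows "distinct [2*i-1, 2*i, 2*j-1, 2*j]" "distinct [2*i, 2*i-1, 2*j, 2*j-1]"
  using assms by auto

lemma pairs_close_prob_lim:
  "prob_lim M (\<lambda>n \<omega>. 1 / real n * (\<Sum>j=1..n div 2.
      norm (X (idx n (Ws n \<omega>) (2*j-1)) \<omega> - X (idx n (Ws n \<omega>) (2*j)) \<omega>))) 0 even_at_top"
proof (rule prob_lim_if_conv_in_prob)
  show "conv_in_prob M (\<lambda>n \<omega>. 1 / real n * (\<Sum>j=1..n div 2.
      norm (X (idx n (Ws n \<omega>) (2*j-1)) \<omega> - X (idx n (Ws n \<omega>) (2*j)) \<omega>))) 0 even_at_top"
    using pairs_close by (simp only: idx_Ws)
  have Xm: "(\<lambda>\<omega>. X (idx n (Ws n \<omega>) p) \<omega>) \<in> borel_measurable M" if "even n" "p \<in> {1..n}" for n p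
    using measurable_W_idx[OF that measurable_cov] by simp
  have "(\<lambda>\<omega>. 1 / real n * (\<Sum>j=1..n div 2.
      norm (X (idx n (Ws n \<omega>) (2*j-1)) \<omega> - X (idx n (Ws n \<omega>) (2*j)) \<omega>))) \<in> borel_measurable M"
    if "even n" for n
    by (intro borel_measurable_times borel_measurable_const borel_measurable_sum
        measurable_compose[OF _ borel_measurable_norm] borel_measurable_diff Xm that pair_pos_in)
  then show "\<forall>\<^sub>F n in even_at_top. (\<lambda>\<omega>. 1 / real n * (\<Sum>j=1..n div 2.
      norm (X (idx n (Ws n \<omega>) (2*j-1)) \<omega> - X (idx n (Ws n \<omega>) (2*j)) \<omega>))) \<in> borel_measurable M"
    by (simp add: eventually_even_at_top)
qed

text \<open>The common limit behind all four sums. \<open>pair_sum_bound\<close> leaves six random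
  terms of controlled mean, gathered in \<open>A\<close>, and the Lipschitz term, bounded by
  \<open>L\<close> times the average pair distance; \<open>prob_lim_L1_approx\<close> joins the two
  kinds. The value \<open>c = 1\<close> puts \<open>\<phi>\<close> on the treated unit of each pair,
  \<open>c = -1\<close> on the control.\<close>

lemma matched_average_prob_lim:
  fixes \<phi> \<gamma> :: "'x unit_data \<Rightarrow> real" and f g :: "'x \<Rightarrow> real" and c :: real
  assumes \<phi> [measurable]: "\<phi> \<in> borel_measurable borel" and \<phi>i: "integrable M (\<lambda>\<omega>. \<phi> (W 1 \<omega>))"
    and f: "cexp_version M (X 1) (\<lambda>\<omega>. \<phi> (W 1 \<omega>)) f" and L: "L-lipschitz_on UNIV f"
    and \<gamma> [measurable]: "\<gamma> \<in> borel_measurable borel" and \<gamma>b: "\<And>w. \<bar>\<gamma> w\<bar> \<le> 1"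
    and g: "cexp_version M (X 1) (\<lambda>\<omega>. \<gamma> (W 1 \<omega>)) g" and gb: "\<And>x. \<bar>g x\<bar> \<le> 1"
    and c: "\<bar>c\<bar> = 1"
  shows "prob_lim M (\<lambda>n \<omega>. 1 / real n * (\<Sum>j=1..n div 2.
      let a = idx n (Ws n \<omega>) (2*j-1); b = idx n (Ws n \<omega>) (2*j) in
      \<phi> (W a \<omega>) * \<gamma> (W b \<omega>) * ((1 + c * treat_sign n j \<omega>) / 2)
      + \<phi> (W b \<omega>) * \<gamma> (W a \<omega>) * ((1 - c * treat_sign n j \<omega>) / 2)))
    (expectation (\<lambda>\<omega>. f (X 1 \<omega>) * g (X 1 \<omega>)) / 2) even_at_top"
    (is "prob_lim M ?T (?e / 2) _")
proof (rule prob_lim_L1_approx)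
  let ?a = "\<lambda>n j \<omega>. idx n (Ws n \<omega>) (2*j-1)" and ?b = "\<lambda>n j \<omega>. idx n (Ws n \<omega>) (2*j)"
  let ?P = "\<lambda>n \<omega>. 1 / real n * (\<Sum>j=1..n div 2. norm (X (?a n j \<omega>) \<omega> - X (?b n j \<omega>) \<omega>))"
  show "prob_lim M (\<lambda>n \<omega>. L * ?P n \<omega>) 0 even_at_top"
    using prob_lim_cmult[OF pairs_close_prob_lim, of L] by simp
  have fm [measurable]: "f \<in> borel_measurable borel" using f by (simp add: cexp_version_def)
  have gm [measurable]: "g \<in> borel_measurable borel" using g by (simp add: cexp_version_def)
  have fi: "integrable M (\<lambda>\<omega>. f (X 1 \<omega>))" by (rule cexp_version_integrable[OF \<phi>i f])
  fix \<eta> :: real assume "\<eta> > 0"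
  \<comment> \<open>Budget for the mean of \<open>A\<close>: \<open>\<eta>/6\<close> each for
    truncating \<open>\<phi>\<close> and for passing from \<open>h\<close> to \<open>f\<close>,
    \<open>\<eta>/12\<close> for the change of limit, and \<open>\<eta>/2\<close> for the orthogonal
    sums, in total \<open>11 * \<eta> / 12\<close>.\<close>
  then have "\<eta> / 6 > 0" by simp
  from truncation_L1[OF \<phi>i this] obtain K where "K \<ge> 0"
    and K: "expectation (\<lambda>\<omega>. \<bar>\<phi> (W 1 \<omega>) - (if \<bar>\<phi> (W 1 \<omega>)\<bar> \<le> K then \<phi> (W 1 \<omega>) else 0)\<bar>) < \<eta> / 6"
    by blast
  define \<psi> where "\<psi> w = (if \<bar>\<phi> w\<bar> \<le> K then \<phi> w else 0)" for w
  have \<psi>m [measurable]: "\<psi> \<in> borel_measurable borel" unfolding \<psi>_def by measurable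
  have \<psi>b: "\<bar>\<psi> w\<bar> \<le> K" for w using \<open>K \<ge> 0\<close> by (simp add: \<psi>_def)
  have \<psi>i: "integrable M (\<lambda>\<omega>. \<psi> (W 1 \<omega>))" by (rule integrable_bounded[where C=K]) (use \<psi>b in auto)
  have E\<psi>: "expectation (\<lambda>\<omega>. \<bar>\<phi> (W 1 \<omega>) - \<psi> (W 1 \<omega>)\<bar>) \<le> \<eta> / 6" using K unfolding \<psi>_def by (rule less_imp_le)
  obtain h where h: "cexp_version M (X 1) (\<lambda>\<omega>. \<psi> (W 1 \<omega>)) h" and hb: "\<And>x. \<bar>h x\<bar> \<le> K"
    using cexp_version_bounded_ex[OF cexp_version_cexp_at \<psi>i \<psi>b \<open>K \<ge> 0\<close>] by blast
  have hm [measurable]: "h \<in> borel_measurable borel" using h by (simp add: cexp_version_def)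
  have hi: "integrable M (\<lambda>\<omega>. h (X 1 \<omega>))" by (rule cexp_version_integrable[OF \<psi>i h])
  have Ef: "expectation (\<lambda>\<omega>. \<bar>f (X 1 \<omega>) - h (X 1 \<omega>)\<bar>) \<le> \<eta> / 6"
    using expectation_abs_cexp_diff_le[OF \<phi>i f \<psi>i h] E\<psi> by linarith
  \<comment> \<open>The centring constant belongs to the truncated problem, since the centred sum
    must be bounded; halving its distance of at most \<open>\<eta>/6\<close> to the target yields
    the summand \<open>\<eta>/12\<close> in \<open>A\<close>.\<close>
  define e where "e = expectation (\<lambda>\<omega>. h (X 1 \<omega>) * g (X 1 \<omega>))"
  have mg: "integrable M (\<lambda>\<omega>. q \<omega> * g (X 1 \<omega>))" if "integrable M q" for q
  proof (rule Bochner_Integration.integrable_bound[OF that])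
    show "AE \<omega> in M. norm (q \<omega> * g (X 1 \<omega>)) \<le> norm (q \<omega>)"
      using gb by (intro AE_I2) (simp add: abs_mult mult_left_le)
  qed (use that in auto)
  have ee: "\<bar>e - ?e\<bar> \<le> \<eta> / 6"
  proof -
    have "e - ?e = expectation (\<lambda>\<omega>. h (X 1 \<omega>) * g (X 1 \<omega>) - f (X 1 \<omega>) * g (X 1 \<omega>))"
      unfolding e_def by (rule Bochner_Integration.integral_diff[OF mg[OF hi] mg[OF fi], symmetric])
    also have "\<dots> = expectation (\<lambda>\<omega>. (h (X 1 \<omega>) - f (X 1 \<omega>)) * g (X 1 \<omega>))" by (simp add: left_diff_distrib)
    also have "\<bar>\<dots>\<bar> \<le> expectation (\<lambda>\<omega>. \<bar>(h (X 1 \<omega>) - f (X 1 \<omega>)) * g (X 1 \<omega>)\<bar>)"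
      by (rule integral_abs_bound)
    also have "\<dots> \<le> expectation (\<lambda>\<omega>. \<bar>f (X 1 \<omega>) - h (X 1 \<omega>)\<bar>)"
    proof (rule integral_mono)
      show "integrable M (\<lambda>\<omega>. \<bar>(h (X 1 \<omega>) - f (X 1 \<omega>)) * g (X 1 \<omega>)\<bar>)"
        using mg[OF Bochner_Integration.integrable_diff[OF hi fi]] by simp
      show "\<bar>(h (X 1 \<omega>) - f (X 1 \<omega>)) * g (X 1 \<omega>)\<bar> \<le> \<bar>f (X 1 \<omega>) - h (X 1 \<omega>)\<bar>" for \<omega>
        using gb by (simp add: abs_mult abs_minus_commute mult_left_le)
    qed (use fi hi in auto)
    finally show ?thesis using Ef by linarith
  qed
  define A where "A n \<omega> = 1 / real n *
    ((\<Sum>i=1..n. \<bar>\<phi> (W i \<omega>) - \<psi> (W i \<omega>)\<bar>)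
    + 1/2 * \<bar>\<Sum>j=1..n div 2. (\<psi> (W (?a n j \<omega>) \<omega>) * \<gamma> (W (?b n j \<omega>) \<omega>)
         - \<psi> (W (?b n j \<omega>) \<omega>) * \<gamma> (W (?a n j \<omega>) \<omega>)) * treat_sign n j \<omega>\<bar>
    + 1/2 * \<bar>\<Sum>j=1..n div 2. \<psi> (W (?a n j \<omega>) \<omega>) * \<gamma> (W (?b n j \<omega>) \<omega>)
         - h (X (?a n j \<omega>) \<omega>) * g (X (?b n j \<omega>) \<omega>)\<bar>
    + 1/2 * \<bar>\<Sum>j=1..n div 2. \<psi> (W (?b n j \<omega>) \<omega>) * \<gamma> (W (?a n j \<omega>) \<omega>)
         - h (X (?b n j \<omega>) \<omega>) * g (X (?a n j \<omega>) \<omega>)\<bar>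
    + (\<Sum>i=1..n. \<bar>f (X i \<omega>) - h (X i \<omega>)\<bar>)
    + 1/2 * \<bar>\<Sum>i=1..n. h (X i \<omega>) * g (X i \<omega>) - e\<bar>) + \<eta> / 12" for n \<omega>
  \<comment> \<open>Four orthogonal sums contribute \<open>1/2 * (2 * K * sqrt n)\<close> each.
    \<open>K\<close> was fixed with \<open>\<eta>\<close>, so this vanishes after division by
    \<open>n\<close>.\<close>
  have "eventually (\<lambda>n::nat. 4 * K * sqrt n / n \<le> \<eta> / 2) at_top"
    using \<open>\<eta> > 0\<close> by real_asymp
  then have "eventually (\<lambda>n::nat. n > 0 \<and> 4 * K * sqrt n / n \<le> \<eta> / 2) at_top"
    using eventually_gt_at_top[of "0::nat"] by eventually_elim simp
  then show "\<forall>\<^sub>F n in even_at_top. \<exists>A. integrable M A \<and> expectation A \<le> \<eta> \<and>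
       (AE \<omega> in M. 0 \<le> A \<omega> \<and> \<bar>?T n \<omega> - ?e / 2\<bar> \<le> A \<omega> + L * ?P n \<omega>)"
    unfolding eventually_even_at_top
  proof (rule eventually_mono, intro impI)
    fix n :: nat assume n0: "0 < real n \<and> 4 * K * sqrt n / n \<le> \<eta> / 2" and n: "even n"
    note s1 = expectation_abs_sum_ident[of "\<lambda>w. \<phi> w - \<psi> w" n]
    have i1: "integrable M (\<lambda>\<omega>. \<Sum>i=1..n. \<bar>\<phi> (W i \<omega>) - \<psi> (W i \<omega>)\<bar>)"
      by (rule s1(1)) (use \<phi>i \<psi>i in simp_all)
    have "expectation (\<lambda>\<omega>. \<Sum>i=1..n. \<bar>\<phi> (W i \<omega>) - \<psi> (W i \<omega>)\<bar>) =
        n * expectation (\<lambda>\<omega>. \<bar>\<phi> (W 1 \<omega>) - \<psi> (W 1 \<omega>)\<bar>)"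
      by (rule s1(2)) (use \<phi>i \<psi>i in simp_all)
    also have "\<dots> \<le> n * (\<eta> / 6)" by (intro mult_left_mono E\<psi>) simp
    finally have b1: "expectation (\<lambda>\<omega>. \<Sum>i=1..n. \<bar>\<phi> (W i \<omega>) - \<psi> (W i \<omega>)\<bar>) \<le> n * (\<eta> / 6)" .
    note s2 = signed_sum_L1[OF n \<psi>m \<psi>b \<gamma> \<gamma>b, unfolded Let_def]
    note i2 = integrable_abs[OF s2(1)]
    note s3 = residual_sum_L1[where a="\<lambda>j. 2*j-1" and b="\<lambda>j. 2*j", OF n _ _ _ \<psi>m \<psi>b h hb \<gamma> \<gamma>b g gb, unfolded Let_def]
    note s4 = residual_sum_L1[where a="\<lambda>j. 2*j" and b="\<lambda>j. 2*j-1", OF n _ _ _ \<psi>m \<psi>b h hb \<gamma> \<gamma>b g gb, unfolded Let_def]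
    have i3: "integrable M (\<lambda>\<omega>. \<bar>\<Sum>j=1..n div 2. \<psi> (W (?a n j \<omega>) \<omega>) * \<gamma> (W (?b n j \<omega>) \<omega>)
         - h (X (?a n j \<omega>) \<omega>) * g (X (?b n j \<omega>) \<omega>)\<bar>)"
      and b3: "expectation (\<lambda>\<omega>. \<bar>\<Sum>j=1..n div 2. \<psi> (W (?a n j \<omega>) \<omega>) * \<gamma> (W (?b n j \<omega>) \<omega>)
         - h (X (?a n j \<omega>) \<omega>) * g (X (?b n j \<omega>) \<omega>)\<bar>) \<le> 2 * K * sqrt n"
      by (intro integrable_abs s3; (rule pair_pos_in distinct_pair_pos; simp)?)+
    have i4: "integrable M (\<lambda>\<omega>. \<bar>\<Sum>j=1..n div 2. \<psi> (W (?b n j \<omega>) \<omega>) * \<gamma> (W (?a n j \<omega>) \<omega>)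
         - h (X (?b n j \<omega>) \<omega>) * g (X (?a n j \<omega>) \<omega>)\<bar>)"
      and b4: "expectation (\<lambda>\<omega>. \<bar>\<Sum>j=1..n div 2. \<psi> (W (?b n j \<omega>) \<omega>) * \<gamma> (W (?a n j \<omega>) \<omega>)
         - h (X (?b n j \<omega>) \<omega>) * g (X (?a n j \<omega>) \<omega>)\<bar>) \<le> 2 * K * sqrt n"
      by (intro integrable_abs s4; (rule pair_pos_in distinct_pair_pos; simp)?)+
    note s5 = expectation_abs_sum_ident[of "\<lambda>w. f (cov w) - h (cov w)" n, unfolded cov_W]
    have i5: "integrable M (\<lambda>\<omega>. \<Sum>i=1..n. \<bar>f (X i \<omega>) - h (X i \<omega>)\<bar>)"
      by (rule s5(1)) (use fi hi in simp_all)
    have "expectation (\<lambda>\<omega>. \<Sum>i=1..n. \<bar>f (X i \<omega>) - h (X i \<omega>)\<bar>) =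
        n * expectation (\<lambda>\<omega>. \<bar>f (X 1 \<omega>) - h (X 1 \<omega>)\<bar>)"
      by (rule s5(2)) (use fi hi in simp_all)
    also have "\<dots> \<le> n * (\<eta> / 6)" by (intro mult_left_mono Ef) simp
    finally have b5: "expectation (\<lambda>\<omega>. \<Sum>i=1..n. \<bar>f (X i \<omega>) - h (X i \<omega>)\<bar>) \<le> n * (\<eta> / 6)" .
    have hgb: "\<bar>h (cov w) * g (cov w)\<bar> \<le> K" for w :: "'x unit_data"
      using mult_mono[OF hb[of "cov w"] gb[of "cov w"]] \<open>K \<ge> 0\<close> by (simp add: abs_mult)
    have i6: "integrable M (\<lambda>\<omega>. \<bar>\<Sum>i=1..n. h (X i \<omega>) * g (X i \<omega>) - e\<bar>)"
      and b6: "expectation (\<lambda>\<omega>. \<bar>\<Sum>i=1..n. h (X i \<omega>) * g (X i \<omega>) - e\<bar>) \<le> 2 * K * sqrt n"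
      using centered_sum_L1[of "\<lambda>w. h (cov w) * g (cov w)" K n, OF _ hgb] by (simp_all add: e_def)
    have iA: "integrable M (A n)"
      unfolding A_def
      by (intro Bochner_Integration.integrable_add integrable_mult_right i1 i2 i3 i4 i5 i6) simp_all
    have "expectation (A n) \<le> 1 / real n * (n * (\<eta> / 6) + 1/2 * (2 * K * sqrt n) + 1/2 * (2 * K * sqrt n)
       + 1/2 * (2 * K * sqrt n) + n * (\<eta> / 6) + 1/2 * (2 * K * sqrt n)) + \<eta> / 12"
      unfolding A_def
      by (rule expectation_six_le[OF i1 i2 i3 i4 i5 i6 b1 s2(2) b3 b4 b5 b6]) simp
    also have "\<dots> = \<eta> / 6 + \<eta> / 6 + \<eta> / 12 + 4 * K * sqrt n / n"
      using n0 by (simp add: field_simps)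
    also have "\<dots> \<le> \<eta>" using n0 \<open>\<eta> > 0\<close> by linarith
    finally have EA: "expectation (A n) \<le> \<eta>" .
    have "AE \<omega> in M. 0 \<le> A n \<omega> \<and> \<bar>?T n \<omega> - ?e / 2\<bar> \<le> A n \<omega> + L * ?P n \<omega>"
    proof (rule AE_I2)
      fix \<omega> assume \<omega>: "\<omega> \<in> space M"
      let ?J = "{1..n div 2}"
      have A0: "0 \<le> A n \<omega>" unfolding A_def using \<open>\<eta> > 0\<close>
        by (intro add_nonneg_nonneg mult_nonneg_nonneg sum_nonneg) auto
      have perm: "idx n (Ws n \<omega>) permutes {1..n}" using idx_permutes[OF n Ws_space[OF \<omega>]] .
      define B where "B = (\<Sum>j\<in>?J. let a = ?a n j \<omega>; b = ?b n j \<omega> in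
        \<phi> (W a \<omega>) * \<gamma> (W b \<omega>) * ((1 + c * treat_sign n j \<omega>) / 2)
        + \<phi> (W b \<omega>) * \<gamma> (W a \<omega>) * ((1 - c * treat_sign n j \<omega>) / 2))"
      have Lip: "(\<Sum>j\<in>?J. \<bar>f (X (?a n j \<omega>) \<omega>) - f (X (?b n j \<omega>) \<omega>)\<bar>) \<le>
        L * (\<Sum>j\<in>?J. norm (X (?a n j \<omega>) \<omega> - X (?b n j \<omega>) \<omega>))"
        unfolding sum_distrib_left
        using lipschitz_onD[OF L] by (intro sum_mono) (simp add: dist_norm)
      have "\<bar>B - card ?J * e\<bar> \<le>
        (\<Sum>j\<in>?J. \<bar>\<phi> (W (?a n j \<omega>) \<omega>) - \<psi> (W (?a n j \<omega>) \<omega>)\<bar> + \<bar>\<phi> (W (?b n j \<omega>) \<omega>) - \<psi> (W (?b n j \<omega>) \<omega>)\<bar>)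
        + 1/2 * \<bar>\<Sum>j\<in>?J. (\<psi> (W (?a n j \<omega>) \<omega>) * \<gamma> (W (?b n j \<omega>) \<omega>)
             - \<psi> (W (?b n j \<omega>) \<omega>) * \<gamma> (W (?a n j \<omega>) \<omega>)) * treat_sign n j \<omega>\<bar>
        + 1/2 * \<bar>\<Sum>j\<in>?J. \<psi> (W (?a n j \<omega>) \<omega>) * \<gamma> (W (?b n j \<omega>) \<omega>)
             - h (X (?a n j \<omega>) \<omega>) * g (X (?b n j \<omega>) \<omega>)\<bar>
        + 1/2 * \<bar>\<Sum>j\<in>?J. \<psi> (W (?b n j \<omega>) \<omega>) * \<gamma> (W (?a n j \<omega>) \<omega>)
             - h (X (?b n j \<omega>) \<omega>) * g (X (?a n j \<omega>) \<omega>)\<bar>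
        + (\<Sum>j\<in>?J. \<bar>f (X (?a n j \<omega>) \<omega>) - h (X (?a n j \<omega>) \<omega>)\<bar> + \<bar>f (X (?b n j \<omega>) \<omega>) - h (X (?b n j \<omega>) \<omega>)\<bar>)
        + 1/2 * \<bar>\<Sum>j\<in>?J. (h (X (?a n j \<omega>) \<omega>) * g (X (?a n j \<omega>) \<omega>) - e) + (h (X (?b n j \<omega>) \<omega>) * g (X (?b n j \<omega>) \<omega>) - e)\<bar>
        + (\<Sum>j\<in>?J. \<bar>f (X (?a n j \<omega>) \<omega>) - f (X (?b n j \<omega>) \<omega>)\<bar>)"
        unfolding B_def Let_def
        by (rule pair_sum_bound[OF treat_sign_bounded[OF n _ \<omega>] c \<gamma>b \<gamma>b gb gb])
      \<comment> \<open>Sums over both members of all pairs become sums over units, which no longer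
        involve the random pairing; this is why their means are computable from unit 1.\<close>
      also have "\<dots> \<le> n * (A n \<omega> - \<eta> / 12) + L * (\<Sum>j\<in>?J. norm (X (?a n j \<omega>) \<omega> - X (?b n j \<omega>) \<omega>))"
        using Lip n0 unfolding A_def
          sum_pairs[OF n perm, of "\<lambda>i. \<bar>\<phi> (W i \<omega>) - \<psi> (W i \<omega>)\<bar>"]
          sum_pairs[OF n perm, of "\<lambda>i. \<bar>f (X i \<omega>) - h (X i \<omega>)\<bar>"]
          sum_pairs[OF n perm, of "\<lambda>i. h (X i \<omega>) * g (X i \<omega>) - e"]
        by simp
      finally have "\<bar>B - card ?J * e\<bar> / n \<le> (n * (A n \<omega> - \<eta> / 12) + L * (\<Sum>j\<in>?J. norm (X (?a n j \<omega>) \<omega> - X (?b n j \<omega>) \<omega>))) / n"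
        by (rule divide_right_mono) simp
      also have "\<dots> = A n \<omega> - \<eta> / 12 + L * ?P n \<omega>" using n0 by (simp add: field_simps)
      also have "\<bar>B - card ?J * e\<bar> / n = \<bar>?T n \<omega> - e / 2\<bar>"
      proof -
        \<comment> \<open>Evenness makes the number of pairs exactly \<open>n / 2\<close>, the
          source of the factor 1/2 in the limit.\<close>
        have "real (card ?J) = real n / 2" using n by (auto elim: evenE)
        then have "?T n \<omega> - e / 2 = (B - card ?J * e) / n"
          unfolding B_def[symmetric] using n0 by (simp add: field_simps)
        then show ?thesis by (simp add: abs_divide)
      qed
      finally have "\<bar>?T n \<omega> - e / 2\<bar> \<le> A n \<omega> - \<eta> / 12 + L * ?P n \<omega>" .
      moreover have "\<bar>e / 2 - ?e / 2\<bar> \<le> \<eta> / 12" using ee by linarith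
      ultimately have "\<bar>?T n \<omega> - ?e / 2\<bar> \<le> A n \<omega> + L * ?P n \<omega>" by linarith
      with A0 show "0 \<le> A n \<omega> \<and> \<bar>?T n \<omega> - ?e / 2\<bar> \<le> A n \<omega> + L * ?P n \<omega>" by blast
    qed
    with iA EA show "\<exists>A. integrable M A \<and> expectation A \<le> \<eta> \<and>
       (AE \<omega> in M. 0 \<le> A \<omega> \<and> \<bar>?T n \<omega> - ?e / 2\<bar> \<le> A \<omega> + L * ?P n \<omega>)" by blast
  qed
qed

end

section \<open>Conditioning on response\<close>

lemma (in prob_space) cexp_event_eq:
  fixes R :: "'a \<Rightarrow> real"
  assumes R: "R \<in> borel_measurable M" "\<And>\<omega>. \<omega> \<in> space M \<Longrightarrow> R \<omega> \<in> {0, 1}"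
    and Z: "Z \<in> borel_measurable M" and pos: "expectation R > 0"
  shows "cexp_event M {\<omega>\<in>space M. R \<omega> = 1} Z = expectation (\<lambda>\<omega>. R \<omega> * Z \<omega>) / expectation R"
proof -
  define A where "A = {\<omega>\<in>space M. R \<omega> = 1}"
  note R(1)[measurable] Z[measurable]
  have A [measurable]: "A \<in> sets M" unfolding A_def by measurable
  have ind: "R \<omega> = indicator A \<omega>" if "\<omega> \<in> space M" for \<omega>
    using R(2)[OF that] that by (auto simp: A_def indicator_def)
  have "expectation R = expectation (indicator A)"
    by (intro Bochner_Integration.integral_cong) (auto simp: ind)
  then have PA: "prob A = expectation R" by simp
  have "expectation (\<lambda>\<omega>. R \<omega> * Z \<omega>) = expectation (\<lambda>\<omega>. indicator A \<omega> * Z \<omega>)"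
    by (intro Bochner_Integration.integral_cong) (auto simp: ind)
  moreover have "uniform_measure M A = density M (\<lambda>\<omega>. ennreal (indicator A \<omega> / prob A))"
    unfolding uniform_measure_def using pos PA divide_ennreal[of 1 "prob A"]
    by (intro density_cong) (auto simp: emeasure_eq_measure indicator_def)
  then have "cexp_event M A Z = expectation (\<lambda>\<omega>. (indicator A \<omega> / prob A) * Z \<omega>)"
    unfolding cexp_event_def by (simp add: integral_density)
  then have "cexp_event M A Z = expectation (\<lambda>\<omega>. indicator A \<omega> * Z \<omega>) / prob A" by simp
  ultimately show ?thesis using PA by (simp add: A_def)
qed

text \<open>Transfers regression functions between \<open>R d 1\<close> and the encoded
  \<open>resp d (W 1 \<omega>)\<close>, and likewise for outcomes, which agree on
  \<open>space M\<close>.\<close>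

lemma (in prob_space) cexp_version_cong:
  fixes V :: "'a \<Rightarrow> 'b::topological_space"
  assumes V: "V \<in> borel_measurable M" and Z: "Z \<in> borel_measurable M" "Z' \<in> borel_measurable M"
    and eq: "\<And>\<omega>. \<omega> \<in> space M \<Longrightarrow> Z \<omega> = Z' \<omega>" and g: "cexp_version M V Z g"
  shows "cexp_version M V Z' g"
proof -
  interpret S: sigma_finite_subalgebra M "gen_alg M borel V" by (rule sigma_finite_subalgebra_gen_alg[OF V])
  have "AE \<omega> in M. real_cond_exp M (gen_alg M borel V) Z \<omega> = real_cond_exp M (gen_alg M borel V) Z' \<omega>"
    using eq Z by (intro S.real_cond_exp_cong AE_I2)
  moreover have "AE \<omega> in M. real_cond_exp M (gen_alg M borel V) Z \<omega> = g (V \<omega>)"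
    using g by (simp add: cexp_version_def)
  ultimately have "AE \<omega> in M. real_cond_exp M (gen_alg M borel V) Z' \<omega> = g (V \<omega>)"
    by eventually_elim simp
  then show ?thesis using g by (simp add: cexp_version_def)
qed

text \<open>Tower property from \<open>\<sigma>(R, X)\<close> to \<open>\<sigma>(X)\<close>, using \<open>E[YR | R, X] = R h(1, X)\<close>.\<close>

lemma (in prob_space) cexp_given_response:
  fixes R Y :: "'a \<Rightarrow> real" and X :: "'a \<Rightarrow> 'x::second_countable_topology"
  assumes R: "R \<in> borel_measurable M" "\<And>\<omega>. \<omega> \<in> space M \<Longrightarrow> R \<omega> \<in> {0, 1}"
    and X: "X \<in> borel_measurable M" and Y: "integrable M Y"
    and h: "cexp_version M (\<lambda>\<omega>. (R \<omega>, X \<omega>)) Y h"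
  shows "AE \<omega> in M. h (1, X \<omega>) * real_cond_exp M (gen_alg M borel X) R \<omega> =
    real_cond_exp M (gen_alg M borel X) (\<lambda>\<omega>. Y \<omega> * R \<omega>) \<omega>"
proof -
  let ?F = "gen_alg M borel X" and ?G = "gen_alg M borel (\<lambda>\<omega>. (R \<omega>, X \<omega>))"
  note [measurable] = R(1) X
  have RX: "(\<lambda>\<omega>. (R \<omega>, X \<omega>)) \<in> borel_measurable M" by measurable
  have hm [measurable]: "h \<in> borel_measurable borel" using h by (simp add: cexp_version_def)
  have h1m [measurable]: "(\<lambda>x. h (1, x)) \<in> borel_measurable borel" by measurable
  interpret F: sigma_finite_subalgebra M ?F by (rule sigma_finite_subalgebra_gen_alg[OF X])
  interpret G: sigma_finite_subalgebra M ?G by (rule sigma_finite_subalgebra_gen_alg[OF RX])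
  have Ym [measurable]: "Y \<in> borel_measurable M" using Y by simp
  have YR: "integrable M (\<lambda>\<omega>. R \<omega> * Y \<omega>)"
  proof (rule Bochner_Integration.integrable_bound[OF Y])
    show "AE \<omega> in M. norm (R \<omega> * Y \<omega>) \<le> norm (Y \<omega>)"
      using R(2) by (intro AE_I2) force
  qed measurable
  have XG: "X \<in> measurable ?G borel"
    using measurable_compose[OF measurable_vimage_algebra1 borel_measurable_continuous_onI[OF continuous_on_snd[OF continuous_on_id]],
      of "\<lambda>\<omega>. (R \<omega>, X \<omega>)" "space M"]
    by simp
  have RG: "R \<in> borel_measurable ?G"
    using measurable_compose[OF measurable_vimage_algebra1 borel_measurable_continuous_onI[OF continuous_on_fst[OF continuous_on_id]],
      of "\<lambda>\<omega>. (R \<omega>, X \<omega>)" "space M"]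
    by simp
  have sub: "subalgebra ?G ?F"
    using measurable_sets[OF XG] by (auto simp: subalgebra_def sets_vimage_algebra2)
  have "AE \<omega> in M. real_cond_exp M ?G (\<lambda>\<omega>. R \<omega> * Y \<omega>) \<omega> = R \<omega> * real_cond_exp M ?G Y \<omega>"
    by (rule G.real_cond_exp_mult[OF RG _ YR]) measurable
  moreover have "AE \<omega> in M. real_cond_exp M ?G Y \<omega> = h (R \<omega>, X \<omega>)"
    using h by (simp add: cexp_version_def)
  \<comment> \<open>Where the response is 0 both sides vanish, and elsewhere
    \<open>R \<omega>\<close> is 1, so the first argument of \<open>h\<close> may be frozen at
    1.\<close>
  ultimately have ae: "AE \<omega> in M. real_cond_exp M ?G (\<lambda>\<omega>. R \<omega> * Y \<omega>) \<omega> = h (1, X \<omega>) * R \<omega>"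
    using AE_space
  proof eventually_elim
    case (elim \<omega>)
    then show ?case using R(2)[of \<omega>] by auto
  qed
  \<comment> \<open>Integrability is claimed for the product, which agrees almost surely with a
    conditional expectation of the integrable \<open>R \<omega> * Y \<omega>\<close>; nothing is
    asserted about \<open>h (1, X \<omega>)\<close> alone.\<close>
  have int: "integrable M (\<lambda>\<omega>. h (1, X \<omega>) * R \<omega>)"
    using G.real_cond_exp_int(1)[OF YR] ae
    by (subst integrable_cong_AE[of _ _ "real_cond_exp M ?G (\<lambda>\<omega>. R \<omega> * Y \<omega>)"]) auto
  have "AE \<omega> in M. real_cond_exp M ?F (real_cond_exp M ?G (\<lambda>\<omega>. R \<omega> * Y \<omega>)) \<omega> = real_cond_exp M ?F (\<lambda>\<omega>. R \<omega> * Y \<omega>) \<omega>"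
    by (rule F.real_cond_exp_nested_subalg[OF G.subalg sub YR])
  moreover have "AE \<omega> in M. real_cond_exp M ?F (real_cond_exp M ?G (\<lambda>\<omega>. R \<omega> * Y \<omega>)) \<omega> =
      real_cond_exp M ?F (\<lambda>\<omega>. h (1, X \<omega>) * R \<omega>) \<omega>"
    by (rule F.real_cond_exp_cong[OF ae]) measurable
  moreover have "AE \<omega> in M. real_cond_exp M ?F (\<lambda>\<omega>. h (1, X \<omega>) * R \<omega>) \<omega> = h (1, X \<omega>) * real_cond_exp M ?F R \<omega>"
    by (rule F.real_cond_exp_mult[OF measurable_gen_alg_comp[OF X h1m] _ int]) measurable
  ultimately show ?thesis by eventually_elim (simp add: mult.commute)
qed

text \<open>Indicators rather than the response coordinates themselves, so that the bound by 1 holds on the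
  whole value space and not just on the range of the sample.\<close>

definition resp :: "nat \<Rightarrow> 'x unit_data \<Rightarrow> real" where
  "resp d w = of_bool ((if d = 1 then fst (snd (snd w)) else fst (snd (snd (snd w)))) = 1)"

definition outc :: "nat \<Rightarrow> 'x unit_data \<Rightarrow> real" where
  "outc d w = (if d = 1 then fst w else fst (snd w)) * resp d w"

lemma measurable_resp [measurable]: "resp d \<in> borel_measurable (borel :: 'x::topological_space unit_data measure)"
proof -
  have "(\<lambda>w :: 'x unit_data. if d = 1 then fst (snd (snd w)) else fst (snd (snd (snd w)))) \<in> borel_measurable borel"
    by (cases "d = 1") (simp_all add: borel_measurable_continuous_onI continuous_intros)
  then show ?thesis unfolding resp_def by measurable
qed

lemma measurable_outc [measurable]: "outc d \<in> borel_measurable (borel :: 'x::topological_space unit_data measure)"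
proof -
  have "(\<lambda>w :: 'x unit_data. if d = 1 then fst w else fst (snd w)) \<in> borel_measurable borel"
    by (cases "d = 1") (simp_all add: borel_measurable_continuous_onI continuous_intros)
  then show ?thesis unfolding outc_def by measurable
qed

lemma resp_bounded: "\<bar>resp d w\<bar> \<le> 1"
  by (simp add: resp_def)

section \<open>The estimators as ratios of matched averages\<close>

context matched_pairs
begin

lemma resp_W: "d \<in> {0, 1} \<Longrightarrow> i \<ge> 1 \<Longrightarrow> \<omega> \<in> space M \<Longrightarrow> resp d (W i \<omega>) = R d i \<omega>"
  using R_binary[of d i \<omega>] by (auto simp: resp_def unit_vec_def)

lemma outc_W: "d \<in> {0, 1} \<Longrightarrow> i \<ge> 1 \<Longrightarrow> \<omega> \<in> space M \<Longrightarrow> outc d (W i \<omega>) = Y d i \<omega> * R d i \<omega>"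
  using resp_W[of d i \<omega>] by (auto simp: outc_def unit_vec_def)

lemma AE_all_treat_pairs:
  assumes "even n"
  shows "AE \<omega> in M. \<forall>j\<in>{1..n div 2}. treat_pair n j \<omega> \<in> {(0, 1), (1, 0)}"
  using AE_treat_pair[OF assms] by (intro AE_finite_allI) auto

text \<open>The case in which the partner's factor is constantly 1. The limit then contains the mean
  of \<open>f (X 1)\<close>, which is the mean of \<open>\<phi> (W 1)\<close>.\<close>

lemma arm_average_prob_lim:
  fixes \<phi> :: "'x unit_data \<Rightarrow> real"
  assumes \<phi>: "\<phi> \<in> borel_measurable borel" and \<phi>i: "integrable M (\<lambda>\<omega>. \<phi> (W 1 \<omega>))"
    and f: "cexp_version M (X 1) (\<lambda>\<omega>. \<phi> (W 1 \<omega>)) f" and L: "L-lipschitz_on UNIV f"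
  shows "prob_lim M (\<lambda>n \<omega>. 1 / real n * (\<Sum>i=1..n. \<phi> (W i \<omega>) * D n i \<omega>))
      (expectation (\<lambda>\<omega>. \<phi> (W 1 \<omega>)) / 2) even_at_top"
    and "prob_lim M (\<lambda>n \<omega>. 1 / real n * (\<Sum>i=1..n. \<phi> (W i \<omega>) * (1 - D n i \<omega>)))
      (expectation (\<lambda>\<omega>. \<phi> (W 1 \<omega>)) / 2) even_at_top"
proof -
  interpret S: sigma_finite_subalgebra M "gen_alg M borel (X 1)"
    by (rule sigma_finite_subalgebra_gen_alg) simp
  have one: "cexp_version M (X 1) (\<lambda>\<omega>. 1) (\<lambda>x. 1)"
    unfolding cexp_version_def using S.real_cond_exp_F_meas[of "\<lambda>_. 1"] by simp
  note avg = matched_average_prob_lim[where \<gamma>="\<lambda>w. 1" and g="\<lambda>x. 1", OF \<phi> \<phi>i f L _ _ one, unfolded Let_def]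
  have "expectation (\<lambda>\<omega>. 1 * (\<phi> (W 1 \<omega>) - f (X 1 \<omega>))) = 0"
    by (rule cexp_version_orthogonal[OF \<phi>i f, of "\<lambda>x. 1" 1]) auto
  then have e: "expectation (\<lambda>\<omega>. f (X 1 \<omega>) * 1) = expectation (\<lambda>\<omega>. \<phi> (W 1 \<omega>))"
    using \<phi>i cexp_version_integrable[OF \<phi>i f] by simp
  \<comment> \<open>Given opposite treatments in a pair, \<open>(1 + c * S) / 2\<close> is the value
    of \<open>t\<close> at the treatment of the first unit and \<open>(1 - c * S) / 2\<close> that
    of the second. Taking \<open>t\<close> as identity with \<open>c = 1\<close>, or as
    \<open>1 - x\<close> with \<open>c = -1\<close>, selects the arm.\<close>
  have eq: "AE \<omega> in M. (\<Sum>j=1..n div 2. \<phi> (W (idx n (Ws n \<omega>) (2*j-1)) \<omega>) * 1 * ((1 + c * treat_sign n j \<omega>) / 2)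
       + \<phi> (W (idx n (Ws n \<omega>) (2*j)) \<omega>) * 1 * ((1 - c * treat_sign n j \<omega>) / 2)) =
     (\<Sum>i=1..n. \<phi> (W i \<omega>) * t (D n i \<omega>))"
    if n: "even n" and t: "t 1 = (1 + c) / 2" "t 0 = (1 - c) / 2" for n c and t :: "real \<Rightarrow> real"
    using AE_all_treat_pairs[OF n] AE_space
  proof eventually_elim
    case (elim \<omega>)
    have perm: "idx n (Ws n \<omega>) permutes {1..n}" using idx_permutes[OF n Ws_space[OF elim(2)]] .
    show ?case
      unfolding sum_pairs[OF n perm, of "\<lambda>i. \<phi> (W i \<omega>) * t (D n i \<omega>)"]
    proof (intro sum.cong refl)
      fix j assume "j \<in> {1..n div 2}"
      then have "treat_pair n j \<omega> \<in> {(0, 1), (1, 0)}" using elim(1) by blast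
      then show "\<phi> (W (idx n (Ws n \<omega>) (2*j-1)) \<omega>) * 1 * ((1 + c * treat_sign n j \<omega>) / 2)
          + \<phi> (W (idx n (Ws n \<omega>) (2*j)) \<omega>) * 1 * ((1 - c * treat_sign n j \<omega>) / 2) =
        \<phi> (W (idx n (Ws n \<omega>) (2*j-1)) \<omega>) * t (D n (idx n (Ws n \<omega>) (2*j-1)) \<omega>)
          + \<phi> (W (idx n (Ws n \<omega>) (2*j)) \<omega>) * t (D n (idx n (Ws n \<omega>) (2*j)) \<omega>)"
        by (auto simp: treat_sign_def treat_pair_def t)
    qed
  qed
  show "prob_lim M (\<lambda>n \<omega>. 1 / real n * (\<Sum>i=1..n. \<phi> (W i \<omega>) * D n i \<omega>))
      (expectation (\<lambda>\<omega>. \<phi> (W 1 \<omega>)) / 2) even_at_top"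
  proof (rule prob_lim_cong[OF avg[of 1, unfolded e]])
    show "\<forall>\<^sub>F n in even_at_top. AE \<omega> in M. 1 / real n * (\<Sum>j=1..n div 2.
         \<phi> (W (idx n (Ws n \<omega>) (2*j-1)) \<omega>) * 1 * ((1 + 1 * treat_sign n j \<omega>) / 2)
         + \<phi> (W (idx n (Ws n \<omega>) (2*j)) \<omega>) * 1 * ((1 - 1 * treat_sign n j \<omega>) / 2)) =
       1 / real n * (\<Sum>i=1..n. \<phi> (W i \<omega>) * D n i \<omega>)"
      unfolding eventually_even_at_top
    proof (rule always_eventually, intro allI impI)
      fix n :: nat assume "even n"
      then have "AE \<omega> in M. (\<Sum>j=1..n div 2.
         \<phi> (W (idx n (Ws n \<omega>) (2*j-1)) \<omega>) * 1 * ((1 + 1 * treat_sign n j \<omega>) / 2)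
         + \<phi> (W (idx n (Ws n \<omega>) (2*j)) \<omega>) * 1 * ((1 - 1 * treat_sign n j \<omega>) / 2)) =
         (\<Sum>i=1..n. \<phi> (W i \<omega>) * D n i \<omega>)" by (rule eq[of _ "\<lambda>x. x" 1]) simp_all
      then show "AE \<omega> in M. 1 / real n * (\<Sum>j=1..n div 2.
         \<phi> (W (idx n (Ws n \<omega>) (2*j-1)) \<omega>) * 1 * ((1 + 1 * treat_sign n j \<omega>) / 2)
         + \<phi> (W (idx n (Ws n \<omega>) (2*j)) \<omega>) * 1 * ((1 - 1 * treat_sign n j \<omega>) / 2)) =
       1 / real n * (\<Sum>i=1..n. \<phi> (W i \<omega>) * D n i \<omega>)" by eventually_elim (simp only:)
    qed
  qed auto
  show "prob_lim M (\<lambda>n \<omega>. 1 / real n * (\<Sum>i=1..n. \<phi> (W i \<omega>) * (1 - D n i \<omega>)))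
      (expectation (\<lambda>\<omega>. \<phi> (W 1 \<omega>)) / 2) even_at_top"
  proof (rule prob_lim_cong[OF avg[of "-1", unfolded e]])
    show "\<forall>\<^sub>F n in even_at_top. AE \<omega> in M. 1 / real n * (\<Sum>j=1..n div 2.
         \<phi> (W (idx n (Ws n \<omega>) (2*j-1)) \<omega>) * 1 * ((1 + -1 * treat_sign n j \<omega>) / 2)
         + \<phi> (W (idx n (Ws n \<omega>) (2*j)) \<omega>) * 1 * ((1 - -1 * treat_sign n j \<omega>) / 2)) =
       1 / real n * (\<Sum>i=1..n. \<phi> (W i \<omega>) * (1 - D n i \<omega>))"
      unfolding eventually_even_at_top
    proof (rule always_eventually, intro allI impI)
      fix n :: nat assume "even n"
      then have "AE \<omega> in M. (\<Sum>j=1..n div 2.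
         \<phi> (W (idx n (Ws n \<omega>) (2*j-1)) \<omega>) * 1 * ((1 + -1 * treat_sign n j \<omega>) / 2)
         + \<phi> (W (idx n (Ws n \<omega>) (2*j)) \<omega>) * 1 * ((1 - -1 * treat_sign n j \<omega>) / 2)) =
         (\<Sum>i=1..n. \<phi> (W i \<omega>) * (1 - D n i \<omega>))" by (rule eq[of _ "\<lambda>x. 1 - x" "-1"]) simp_all
      then show "AE \<omega> in M. 1 / real n * (\<Sum>j=1..n div 2.
         \<phi> (W (idx n (Ws n \<omega>) (2*j-1)) \<omega>) * 1 * ((1 + -1 * treat_sign n j \<omega>) / 2)
         + \<phi> (W (idx n (Ws n \<omega>) (2*j)) \<omega>) * 1 * ((1 - -1 * treat_sign n j \<omega>) / 2)) =
       1 / real n * (\<Sum>i=1..n. \<phi> (W i \<omega>) * (1 - D n i \<omega>))" by eventually_elim (simp only:)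
    qed
  qed auto
qed

end

locale attrition = matched_pairs M Y R X D \<pi>
  for M :: "'a measure" and Y R :: "nat \<Rightarrow> nat \<Rightarrow> 'a \<Rightarrow> real"
    and X :: "nat \<Rightarrow> 'a \<Rightarrow> 'x::euclidean_space" and D and \<pi> +
  assumes Y_integrable: "\<And>d i. d \<in> {0, 1} \<Longrightarrow> i \<ge> 1 \<Longrightarrow> integrable M (Y d i)"
    and R_pos: "\<And>d i. d \<in> {0, 1} \<Longrightarrow> i \<ge> 1 \<Longrightarrow> (\<integral>\<omega>. R d i \<omega> \<partial>M) > 0"
    and R_lipschitz: "\<And>d i. d \<in> {0, 1} \<Longrightarrow> i \<ge> 1 \<Longrightarrow>
        \<exists>L g. L-lipschitz_on UNIV g \<and> cexp_version M (X i) (R d i) g"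
    and YR_lipschitz: "\<And>d i. d \<in> {0, 1} \<Longrightarrow> i \<ge> 1 \<Longrightarrow>
        \<exists>L g. L-lipschitz_on UNIV g \<and> cexp_version M (X i) (\<lambda>\<omega>. Y d i \<omega> * R d i \<omega>) g"
begin

lemma measurable_Rd: "d \<in> {0, 1} \<Longrightarrow> i \<ge> 1 \<Longrightarrow> R d i \<in> borel_measurable M"
  using measurable_YR[of i] by auto

lemma measurable_resp_W: "(\<lambda>\<omega>. resp d (W 1 \<omega>)) \<in> borel_measurable M"
  by (rule measurable_compose[OF measurable_W measurable_resp]) simp

lemma measurable_outc_W: "(\<lambda>\<omega>. outc d (W 1 \<omega>)) \<in> borel_measurable M"
  by (rule measurable_compose[OF measurable_W measurable_outc]) simp

lemma integrable_resp: "integrable M (\<lambda>\<omega>. resp d (W 1 \<omega>))"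
  by (rule integrable_bounded[OF measurable_resp_W resp_bounded])

lemma integrable_outc:
  assumes "d \<in> {0, 1}"
  shows "integrable M (\<lambda>\<omega>. outc d (W 1 \<omega>))"
proof (rule Bochner_Integration.integrable_bound[OF Y_integrable[OF assms order_refl] measurable_outc_W])
  show "AE \<omega> in M. norm (outc d (W 1 \<omega>)) \<le> norm (Y d 1 \<omega>)"
  proof (rule AE_I2)
    fix \<omega> assume "\<omega> \<in> space M"
    then show "norm (outc d (W 1 \<omega>)) \<le> norm (Y d 1 \<omega>)"
      using outc_W[OF assms order_refl] R_binary[OF assms order_refl] by force
  qed
qed

lemma expectation_resp: "d \<in> {0, 1} \<Longrightarrow> expectation (\<lambda>\<omega>. resp d (W 1 \<omega>)) = expectation (R d 1)"
  by (intro Bochner_Integration.integral_cong refl resp_W) auto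

lemma expectation_outc: "d \<in> {0, 1} \<Longrightarrow> expectation (\<lambda>\<omega>. outc d (W 1 \<omega>)) = expectation (\<lambda>\<omega>. R d 1 \<omega> * Y d 1 \<omega>)"
  by (intro Bochner_Integration.integral_cong refl) (simp add: outc_W)

lemma resp_lipschitz:
  assumes d: "d \<in> {0, 1}"
  obtains L f where "L-lipschitz_on UNIV f" "cexp_version M (X 1) (\<lambda>\<omega>. resp d (W 1 \<omega>)) f"
proof -
  obtain L f where L: "L-lipschitz_on UNIV f" and f: "cexp_version M (X 1) (R d 1) f"
    using R_lipschitz[OF d order_refl] by blast
  have "cexp_version M (X 1) (\<lambda>\<omega>. resp d (W 1 \<omega>)) f"
    by (rule cexp_version_cong[OF measurable_X measurable_Rd[OF d] measurable_resp_W _ f])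
      (simp_all add: resp_W[OF d])
  with L show ?thesis by (rule that)
qed

lemma outc_lipschitz:
  assumes d: "d \<in> {0, 1}"
  obtains L f where "L-lipschitz_on UNIV f" "cexp_version M (X 1) (\<lambda>\<omega>. outc d (W 1 \<omega>)) f"
proof -
  obtain L f where L: "L-lipschitz_on UNIV f" and f: "cexp_version M (X 1) (\<lambda>\<omega>. Y d 1 \<omega> * R d 1 \<omega>) f"
    using YR_lipschitz[OF d order_refl] by blast
  have YR: "(\<lambda>\<omega>. Y d 1 \<omega> * R d 1 \<omega>) \<in> borel_measurable M"
    using measurable_Rd[OF d, of 1] Y_integrable[OF d, of 1] by simp
  have "cexp_version M (X 1) (\<lambda>\<omega>. outc d (W 1 \<omega>)) f"
    by (rule cexp_version_cong[OF measurable_X YR measurable_outc_W _ f])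
      (simp_all add: outc_W[OF d])
  with L show ?thesis by (rule that)
qed

text \<open>Numerators and denominators are arm averages of \<open>outc\<close> and
  \<open>resp\<close>; the repeated response factor in the estimator collapses because responses are
  0 or 1. The factors \<open>1 / n\<close>, and the halves in the limits, cancel in the
  quotients.\<close>

lemma theta_hat_limit:
  "prob_lim M (\<lambda>n. theta_hat n Y R (D n)) (theta_obs M (\<lambda>d. Y d 1) (\<lambda>d. R d 1)) even_at_top"
proof -
  let ?r = "\<lambda>d. expectation (\<lambda>\<omega>. resp d (W 1 \<omega>))" and ?o = "\<lambda>d. expectation (\<lambda>\<omega>. outc d (W 1 \<omega>))"
  obtain L1 p1 where p1: "L1-lipschitz_on UNIV p1" "cexp_version M (X 1) (\<lambda>\<omega>. resp 1 (W 1 \<omega>)) p1"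
    using resp_lipschitz[of 1] by auto
  obtain L0 p0 where p0: "L0-lipschitz_on UNIV p0" "cexp_version M (X 1) (\<lambda>\<omega>. resp 0 (W 1 \<omega>)) p0"
    using resp_lipschitz[of 0] by auto
  obtain K1 u1 where u1: "K1-lipschitz_on UNIV u1" "cexp_version M (X 1) (\<lambda>\<omega>. outc 1 (W 1 \<omega>)) u1"
    using outc_lipschitz[of 1] by auto
  obtain K0 u0 where u0: "K0-lipschitz_on UNIV u0" "cexp_version M (X 1) (\<lambda>\<omega>. outc 0 (W 1 \<omega>)) u0"
    using outc_lipschitz[of 0] by auto
  have d01: "1 \<in> {0, 1 :: nat}" "0 \<in> {0, 1 :: nat}" by auto
  have r0: "?r d / 2 \<noteq> 0" if "d \<in> {0, 1}" for d
    using R_pos[OF that order_refl] expectation_resp[OF that] by simp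
  note A = arm_average_prob_lim(1)[OF measurable_outc integrable_outc[OF d01(1)] u1(2,1)]
    arm_average_prob_lim(1)[OF measurable_resp integrable_resp p1(2,1)]
    arm_average_prob_lim(2)[OF measurable_outc integrable_outc[OF d01(2)] u0(2,1)]
    arm_average_prob_lim(2)[OF measurable_resp integrable_resp p0(2,1)]
  have lim: "prob_lim M (\<lambda>n \<omega>. (1 / real n * (\<Sum>i=1..n. outc 1 (W i \<omega>) * D n i \<omega>)) / (1 / real n * (\<Sum>i=1..n. resp 1 (W i \<omega>) * D n i \<omega>))
     - (1 / real n * (\<Sum>i=1..n. outc 0 (W i \<omega>) * (1 - D n i \<omega>))) / (1 / real n * (\<Sum>i=1..n. resp 0 (W i \<omega>) * (1 - D n i \<omega>))))
     ((?o 1 / 2) / (?r 1 / 2) - (?o 0 / 2) / (?r 0 / 2)) even_at_top"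
    by (intro prob_lim_diff prob_lim_divide A r0 d01)
  have val: "(?o 1 / 2) / (?r 1 / 2) - (?o 0 / 2) / (?r 0 / 2) = theta_obs M (\<lambda>d. Y d 1) (\<lambda>d. R d 1)"
    unfolding theta_obs_def expectation_resp[OF d01(1)] expectation_resp[OF d01(2)]
      expectation_outc[OF d01(1)] expectation_outc[OF d01(2)] by simp
  have eq: "\<forall>\<^sub>F n in even_at_top. AE \<omega> in M. (1 / real n * (\<Sum>i=1..n. outc 1 (W i \<omega>) * D n i \<omega>)) / (1 / real n * (\<Sum>i=1..n. resp 1 (W i \<omega>) * D n i \<omega>))
     - (1 / real n * (\<Sum>i=1..n. outc 0 (W i \<omega>) * (1 - D n i \<omega>))) / (1 / real n * (\<Sum>i=1..n. resp 0 (W i \<omega>) * (1 - D n i \<omega>)))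
     = theta_hat n Y R (D n) \<omega>"
    unfolding eventually_even_at_top
  proof (rule eventually_mono[OF eventually_gt_at_top[of 0]], intro impI AE_I2)
    fix n :: nat and \<omega> assume n: "n > 0" "even n" and \<omega>: "\<omega> \<in> space M"
    have s: "(\<Sum>i=1..n. outc 1 (W i \<omega>) * D n i \<omega>) = (\<Sum>i=1..n. observed_outcome Y R (D n) i \<omega> * realized_response R (D n) i \<omega> * D n i \<omega>)"
      "(\<Sum>i=1..n. resp 1 (W i \<omega>) * D n i \<omega>) = (\<Sum>i=1..n. realized_response R (D n) i \<omega> * D n i \<omega>)"
      "(\<Sum>i=1..n. outc 0 (W i \<omega>) * (1 - D n i \<omega>)) = (\<Sum>i=1..n. observed_outcome Y R (D n) i \<omega> * realized_response R (D n) i \<omega> * (1 - D n i \<omega>))"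
      "(\<Sum>i=1..n. resp 0 (W i \<omega>) * (1 - D n i \<omega>)) = (\<Sum>i=1..n. realized_response R (D n) i \<omega> * (1 - D n i \<omega>))"
    proof -
      have *: "outc 1 (W i \<omega>) * D n i \<omega> = observed_outcome Y R (D n) i \<omega> * realized_response R (D n) i \<omega> * D n i \<omega> \<and>
        resp 1 (W i \<omega>) * D n i \<omega> = realized_response R (D n) i \<omega> * D n i \<omega> \<and>
        outc 0 (W i \<omega>) * (1 - D n i \<omega>) = observed_outcome Y R (D n) i \<omega> * realized_response R (D n) i \<omega> * (1 - D n i \<omega>) \<and>
        resp 0 (W i \<omega>) * (1 - D n i \<omega>) = realized_response R (D n) i \<omega> * (1 - D n i \<omega>)"
        if i: "i \<in> {1..n}" for i
      proof -
        have i1: "i \<ge> 1" using i by simp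
        have "D n i \<omega> \<in> {0, 1}" "R 1 i \<omega> \<in> {0, 1}" "R 0 i \<omega> \<in> {0, 1}"
          using D_binary[OF n(2) i \<omega>] R_binary[OF d01(1) i1 \<omega>] R_binary[OF d01(2) i1 \<omega>] by auto
        then show ?thesis
          unfolding resp_W[OF d01(1) i1 \<omega>] resp_W[OF d01(2) i1 \<omega>] outc_W[OF d01(1) i1 \<omega>] outc_W[OF d01(2) i1 \<omega>]
            observed_outcome_def realized_response_def by auto
      qed
      show "(\<Sum>i=1..n. outc 1 (W i \<omega>) * D n i \<omega>) = (\<Sum>i=1..n. observed_outcome Y R (D n) i \<omega> * realized_response R (D n) i \<omega> * D n i \<omega>)"
        "(\<Sum>i=1..n. resp 1 (W i \<omega>) * D n i \<omega>) = (\<Sum>i=1..n. realized_response R (D n) i \<omega> * D n i \<omega>)"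
        "(\<Sum>i=1..n. outc 0 (W i \<omega>) * (1 - D n i \<omega>)) = (\<Sum>i=1..n. observed_outcome Y R (D n) i \<omega> * realized_response R (D n) i \<omega> * (1 - D n i \<omega>))"
        "(\<Sum>i=1..n. resp 0 (W i \<omega>) * (1 - D n i \<omega>)) = (\<Sum>i=1..n. realized_response R (D n) i \<omega> * (1 - D n i \<omega>))"
        using * by (intro sum.cong refl; blast)+
    qed
    show "(1 / real n * (\<Sum>i=1..n. outc 1 (W i \<omega>) * D n i \<omega>)) / (1 / real n * (\<Sum>i=1..n. resp 1 (W i \<omega>) * D n i \<omega>))
     - (1 / real n * (\<Sum>i=1..n. outc 0 (W i \<omega>) * (1 - D n i \<omega>))) / (1 / real n * (\<Sum>i=1..n. resp 0 (W i \<omega>) * (1 - D n i \<omega>)))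
     = theta_hat n Y R (D n) \<omega>"
      unfolding theta_hat_def Let_def s using n(1) by (simp del: One_nat_def)
  qed
  show ?thesis by (rule prob_lim_cong[OF lim[unfolded val] eq])
qed

lemma theta_obs_eq_cexp_event:
  "theta_obs M (\<lambda>d. Y d 1) (\<lambda>d. R d 1) =
     cexp_event M {\<omega>\<in>space M. R 1 1 \<omega> = 1} (Y 1 1) - cexp_event M {\<omega>\<in>space M. R 0 1 \<omega> = 1} (Y 0 1)"
proof -
  have "cexp_event M {\<omega>\<in>space M. R d 1 \<omega> = 1} (Y d 1) = expectation (\<lambda>\<omega>. R d 1 \<omega> * Y d 1 \<omega>) / expectation (R d 1)"
    if d: "d \<in> {0, 1}" for d
    by (rule cexp_event_eq[OF measurable_Rd[OF d] R_binary[OF d]])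
      (use Y_integrable[OF d, of 1] R_pos[OF d, of 1] in auto)
  from this[of 1] this[of 0] show ?thesis by (simp add: theta_obs_def)
qed

text \<open>A retained pair contributes treated outcome times control response of the partner, minus
  control outcome times treated response of the partner, and counts with the product of the two
  responses. These are three matched averages. The first factor of each has a Lipschitz regression
  function, the partner a bounded one, so the regression of \<open>R 1\<close> appears in two
  versions, \<open>p\<close> and \<open>g1\<close>.\<close>

lemma theta_hat_drop_limit:
  assumes p: "L\<^sub>p-lipschitz_on UNIV p" "cexp_version M (X 1) (\<lambda>\<omega>. resp 1 (W 1 \<omega>)) p"
    and u: "L\<^sub>u-lipschitz_on UNIV u" "cexp_version M (X 1) (\<lambda>\<omega>. outc 1 (W 1 \<omega>)) u"
    and v: "L\<^sub>v-lipschitz_on UNIV v" "cexp_version M (X 1) (\<lambda>\<omega>. outc 0 (W 1 \<omega>)) v"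
    and g1: "cexp_version M (X 1) (\<lambda>\<omega>. resp 1 (W 1 \<omega>)) g1" "\<And>x. \<bar>g1 x\<bar> \<le> 1"
    and g0: "cexp_version M (X 1) (\<lambda>\<omega>. resp 0 (W 1 \<omega>)) g0" "\<And>x. \<bar>g0 x\<bar> \<le> 1"
    and pos: "expectation (\<lambda>\<omega>. p (X 1 \<omega>) * g0 (X 1 \<omega>)) \<noteq> 0"
  shows "prob_lim M (\<lambda>n \<omega>. theta_hat_drop n (\<pi> n (sample_vec n X \<omega>)) Y R (D n) \<omega>)
    ((expectation (\<lambda>\<omega>. u (X 1 \<omega>) * g0 (X 1 \<omega>)) - expectation (\<lambda>\<omega>. v (X 1 \<omega>) * g1 (X 1 \<omega>)))
      / expectation (\<lambda>\<omega>. p (X 1 \<omega>) * g0 (X 1 \<omega>))) even_at_top"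
proof -
  let ?a = "\<lambda>n j \<omega>. idx n (Ws n \<omega>) (2*j-1)" and ?b = "\<lambda>n j \<omega>. idx n (Ws n \<omega>) (2*j)"
  define T where "T \<phi> \<gamma> c n j \<omega> = \<phi> (W (?a n j \<omega>) \<omega>) * \<gamma> (W (?b n j \<omega>) \<omega>) * ((1 + c * treat_sign n j \<omega>) / 2)
      + \<phi> (W (?b n j \<omega>) \<omega>) * \<gamma> (W (?a n j \<omega>) \<omega>) * ((1 - c * treat_sign n j \<omega>) / 2)"
    for \<phi> \<gamma> :: "'x unit_data \<Rightarrow> real" and c n j \<omega>
  let ?E = "\<lambda>f g. expectation (\<lambda>\<omega>. f (X 1 \<omega>) * g (X 1 \<omega>))"
  have d01: "1 \<in> {0, 1 :: nat}" "0 \<in> {0, 1 :: nat}" by auto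
  have c: "\<bar>1 :: real\<bar> = 1" "\<bar>-1 :: real\<bar> = 1" by simp_all
  note lims = matched_average_prob_lim[unfolded Let_def, folded T_def]
  have l1: "prob_lim M (\<lambda>n \<omega>. 1 / real n * (\<Sum>j=1..n div 2. T (outc 1) (resp 0) 1 n j \<omega>)) (?E u g0 / 2) even_at_top"
    by (rule lims[OF measurable_outc integrable_outc[OF d01(1)] u(2,1) measurable_resp resp_bounded g0 c(1)])
  have l2: "prob_lim M (\<lambda>n \<omega>. 1 / real n * (\<Sum>j=1..n div 2. T (outc 0) (resp 1) (-1) n j \<omega>)) (?E v g1 / 2) even_at_top"
    by (rule lims[OF measurable_outc integrable_outc[OF d01(2)] v(2,1) measurable_resp resp_bounded g1 c(2)])
  have l3: "prob_lim M (\<lambda>n \<omega>. 1 / real n * (\<Sum>j=1..n div 2. T (resp 1) (resp 0) 1 n j \<omega>)) (?E p g0 / 2) even_at_top"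
    by (rule lims[OF measurable_resp integrable_resp p(2,1) measurable_resp resp_bounded g0 c(1)])
  have pos': "?E p g0 / 2 \<noteq> 0" using pos by simp
  have lim: "prob_lim M (\<lambda>n \<omega>. (1 / real n * (\<Sum>j=1..n div 2. T (outc 1) (resp 0) 1 n j \<omega>)
     - 1 / real n * (\<Sum>j=1..n div 2. T (outc 0) (resp 1) (-1) n j \<omega>))
     / (1 / real n * (\<Sum>j=1..n div 2. T (resp 1) (resp 0) 1 n j \<omega>)))
    ((?E u g0 / 2 - ?E v g1 / 2) / (?E p g0 / 2)) even_at_top"
    by (rule prob_lim_divide[OF prob_lim_diff[OF l1 l2] l3 pos'])
  have eq: "\<forall>\<^sub>F n in even_at_top. AE \<omega> in M. (1 / real n * (\<Sum>j=1..n div 2. T (outc 1) (resp 0) 1 n j \<omega>)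
     - 1 / real n * (\<Sum>j=1..n div 2. T (outc 0) (resp 1) (-1) n j \<omega>))
     / (1 / real n * (\<Sum>j=1..n div 2. T (resp 1) (resp 0) 1 n j \<omega>))
     = theta_hat_drop n (\<pi> n (sample_vec n X \<omega>)) Y R (D n) \<omega>"
    unfolding eventually_even_at_top
  proof (rule eventually_mono[OF eventually_gt_at_top[of 0]], rule impI)
    fix n :: nat assume n: "n > 0" "even n"
    show "AE \<omega> in M. (1 / real n * (\<Sum>j=1..n div 2. T (outc 1) (resp 0) 1 n j \<omega>)
       - 1 / real n * (\<Sum>j=1..n div 2. T (outc 0) (resp 1) (-1) n j \<omega>))
       / (1 / real n * (\<Sum>j=1..n div 2. T (resp 1) (resp 0) 1 n j \<omega>))
       = theta_hat_drop n (\<pi> n (sample_vec n X \<omega>)) Y R (D n) \<omega>"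
      using AE_all_treat_pairs[OF n(2)] AE_space
    proof eventually_elim
      case (elim \<omega>)
      let ?Ro = "\<lambda>i. realized_response R (D n) i \<omega>" and ?Yo = "\<lambda>i. observed_outcome Y R (D n) i \<omega>"
      have pair: "T (resp 1) (resp 0) 1 n j \<omega> = ?Ro (?a n j \<omega>) * ?Ro (?b n j \<omega>)
        \<and> T (outc 1) (resp 0) 1 n j \<omega> - T (outc 0) (resp 1) (-1) n j \<omega> =
          ?Ro (?a n j \<omega>) * ?Ro (?b n j \<omega>) * (?Yo (?a n j \<omega>) - ?Yo (?b n j \<omega>))
            * (D n (?a n j \<omega>) \<omega> - D n (?b n j \<omega>) \<omega>)"
        if j: "j \<in> {1..n div 2}" for j
      proof -
        define a b where "a = ?a n j \<omega>" and "b = ?b n j \<omega>"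
        have ab: "a \<ge> 1" "b \<ge> 1"
          using idx_Ws_in[OF n(2) elim(2) pair_pos_in(1)[OF j]] idx_Ws_in[OF n(2) elim(2) pair_pos_in(2)[OF j]]
          by (simp_all add: a_def b_def)
        have "(D n a \<omega>, D n b \<omega>) \<in> {(0, 1), (1, 0)}"
          using elim(1) j by (simp add: treat_pair_def a_def b_def)
        moreover have "R d i \<omega> \<in> {0, 1}" if "d \<in> {0, 1}" "i \<in> {a, b}" for d i
          using R_binary[OF that(1) _ elim(2), of i] that(2) ab by blast
        then have "R 1 a \<omega> \<in> {0, 1}" "R 1 b \<omega> \<in> {0, 1}" "R 0 a \<omega> \<in> {0, 1}" "R 0 b \<omega> \<in> {0, 1}"
          by auto
        ultimately show ?thesis
          unfolding T_def treat_sign_def treat_pair_def a_def[symmetric] b_def[symmetric] fst_conv snd_conv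
            resp_W[OF d01(1) ab(1) elim(2)] resp_W[OF d01(1) ab(2) elim(2)]
            resp_W[OF d01(2) ab(1) elim(2)] resp_W[OF d01(2) ab(2) elim(2)]
            outc_W[OF d01(1) ab(1) elim(2)] outc_W[OF d01(1) ab(2) elim(2)]
            outc_W[OF d01(2) ab(1) elim(2)] outc_W[OF d01(2) ab(2) elim(2)]
            observed_outcome_def realized_response_def
          \<comment> \<open>All treatment orders and all values of the four potential responses are
            enumerated.\<close>
          by (elim insertE emptyE) simp_all
      qed
      have den: "(\<Sum>j=1..n div 2. T (resp 1) (resp 0) 1 n j \<omega>) = (\<Sum>j=1..n div 2. ?Ro (?a n j \<omega>) * ?Ro (?b n j \<omega>))"
        using pair by (intro sum.cong refl) blast
      have num: "(\<Sum>j=1..n div 2. T (outc 1) (resp 0) 1 n j \<omega>) - (\<Sum>j=1..n div 2. T (outc 0) (resp 1) (-1) n j \<omega>) =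
        (\<Sum>j=1..n div 2. ?Ro (?a n j \<omega>) * ?Ro (?b n j \<omega>) * (?Yo (?a n j \<omega>) - ?Yo (?b n j \<omega>))
            * (D n (?a n j \<omega>) \<omega> - D n (?b n j \<omega>) \<omega>))"
        unfolding sum_subtractf[symmetric] using pair by (intro sum.cong refl) blast
      have "theta_hat_drop n (\<pi> n (sample_vec n X \<omega>)) Y R (D n) \<omega> =
        inverse (\<Sum>j=1..n div 2. T (resp 1) (resp 0) 1 n j \<omega>) *
        ((\<Sum>j=1..n div 2. T (outc 1) (resp 0) 1 n j \<omega>) - (\<Sum>j=1..n div 2. T (outc 0) (resp 1) (-1) n j \<omega>))"
        unfolding theta_hat_drop_def Let_def den num idx_Ws ..
      then show ?case
        unfolding right_diff_distrib[symmetric] using n(1) by (simp add: divide_inverse)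
    qed
  qed
  have val: "(x / 2 - y / 2) / (z / 2) = (x - y) / z" for x y z :: real
    by (cases "z = 0") (simp_all add: field_simps)
  show ?thesis by (rule prob_lim_cong[OF lim[unfolded val] eq])
qed

lemma mean_resp_prod_eq:
  assumes p: "cexp_version M (X 1) (\<lambda>\<omega>. resp 1 (W 1 \<omega>)) p"
    and g0: "cexp_version M (X 1) (\<lambda>\<omega>. resp 0 (W 1 \<omega>)) g0"
  shows "mean_resp_prod M (\<lambda>d. R d 1) (X 1) = expectation (\<lambda>\<omega>. p (X 1 \<omega>) * g0 (X 1 \<omega>))"
proof -
  have v: "AE \<omega> in M. real_cond_exp M (gen_alg M borel (X 1)) (R d 1) \<omega> = f (X 1 \<omega>)"
    if d: "d \<in> {0, 1}" and f: "cexp_version M (X 1) (\<lambda>\<omega>. resp d (W 1 \<omega>)) f" for d f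
    using cexp_version_cong[OF measurable_X measurable_resp_W measurable_Rd[OF d] resp_W[OF d] f]
    by (simp add: cexp_version_def)
  have [measurable]: "p \<in> borel_measurable borel" "g0 \<in> borel_measurable borel"
    using p g0 by (simp_all add: cexp_version_def)
  show ?thesis
    unfolding mean_resp_prod_def
  proof (rule integral_cong_AE)
    show "AE \<omega> in M. real_cond_exp M (gen_alg M borel (X 1)) (R 0 1) \<omega> * real_cond_exp M (gen_alg M borel (X 1)) (R 1 1) \<omega> =
      p (X 1 \<omega>) * g0 (X 1 \<omega>)"
      using v[OF _ p] v[OF _ g0] by (auto elim!: eventually_elim2)
  qed auto
qed

text \<open>The weight \<open>rho\<close> removes the conditioning on response: regression given
  response times response probability is the regression of \<open>Y d 1 * R d 1\<close> on the
  covariate. So the numerator of \<open>tau_obs * rho\<close> is \<open>u * g0 - v * g1\<close>, and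
  the regressions given response occur only in such products.\<close>

lemma theta_drop_eq:
  assumes u: "cexp_version M (X 1) (\<lambda>\<omega>. outc 1 (W 1 \<omega>)) u"
    and v: "cexp_version M (X 1) (\<lambda>\<omega>. outc 0 (W 1 \<omega>)) v"
    and g1: "cexp_version M (X 1) (\<lambda>\<omega>. resp 1 (W 1 \<omega>)) g1" "\<And>x. \<bar>g1 x\<bar> \<le> 1"
    and g0: "cexp_version M (X 1) (\<lambda>\<omega>. resp 0 (W 1 \<omega>)) g0" "\<And>x. \<bar>g0 x\<bar> \<le> 1"
  shows "theta_drop M (\<lambda>d. Y d 1) (\<lambda>d. R d 1) (X 1) =
    (expectation (\<lambda>\<omega>. u (X 1 \<omega>) * g0 (X 1 \<omega>)) - expectation (\<lambda>\<omega>. v (X 1 \<omega>) * g1 (X 1 \<omega>)))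
      / mean_resp_prod M (\<lambda>d. R d 1) (X 1)"
proof -
  let ?F = "gen_alg M borel (X 1)" and ?m = "mean_resp_prod M (\<lambda>d. R d 1) (X 1)"
  define h where "h d x = cexp_at M (\<lambda>\<omega>. (R d 1 \<omega>, X 1 \<omega>)) (Y d 1) (1, x)" for d x
  define P where "P d x = cexp_at M (X 1) (R d 1) x" for d x
  have d01: "1 \<in> {0, 1 :: nat}" "0 \<in> {0, 1 :: nat}" by auto
  have m1: "X 1 \<in> borel_measurable M" by simp
  have PF: "AE \<omega> in M. real_cond_exp M ?F (R d 1) \<omega> = P d (X 1 \<omega>)" for d
    using cexp_version_cexp_at[of M "X 1" "R d 1"] by (simp add: cexp_version_def P_def)
  have Pg: "AE \<omega> in M. P d (X 1 \<omega>) = g (X 1 \<omega>)"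
    if d: "d \<in> {0, 1}" and g: "cexp_version M (X 1) (\<lambda>\<omega>. resp d (W 1 \<omega>)) g" for d g
    unfolding P_def
    by (rule cexp_version_AE_eq[OF cexp_version_cexp_at
        cexp_version_cong[OF m1 measurable_resp_W measurable_Rd[OF d] resp_W[OF d] g]]) auto
  have hP: "AE \<omega> in M. h d (X 1 \<omega>) * P d (X 1 \<omega>) = z (X 1 \<omega>)"
    if d: "d \<in> {0, 1}" and z: "cexp_version M (X 1) (\<lambda>\<omega>. outc d (W 1 \<omega>)) z" for d z
  proof -
    have YRm: "(\<lambda>\<omega>. Y d 1 \<omega> * R d 1 \<omega>) \<in> borel_measurable M"
      using measurable_Rd[OF d, of 1] Y_integrable[OF d, of 1] by simp
    have "AE \<omega> in M. h d (X 1 \<omega>) * real_cond_exp M ?F (R d 1) \<omega> = real_cond_exp M ?F (\<lambda>\<omega>. Y d 1 \<omega> * R d 1 \<omega>) \<omega>"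
      unfolding h_def
      by (rule cexp_given_response[OF measurable_Rd[OF d] R_binary[OF d] m1 Y_integrable[OF d] cexp_version_cexp_at]) auto
    moreover have "cexp_version M (X 1) (\<lambda>\<omega>. Y d 1 \<omega> * R d 1 \<omega>) z"
      by (rule cexp_version_cong[OF m1 measurable_outc_W YRm outc_W[OF d] z]) auto
    then have "AE \<omega> in M. real_cond_exp M ?F (\<lambda>\<omega>. Y d 1 \<omega> * R d 1 \<omega>) \<omega> = z (X 1 \<omega>)"
      by (simp add: cexp_version_def)
    ultimately show ?thesis using PF[of d] by eventually_elim simp
  qed
  have gm [measurable]: "u \<in> borel_measurable borel" "v \<in> borel_measurable borel"
    "g1 \<in> borel_measurable borel" "g0 \<in> borel_measurable borel"
    using u v g1 g0 by (simp_all add: cexp_version_def)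
  have hm [measurable]: "h d \<in> borel_measurable borel" for d
  proof -
    have "cexp_at M (\<lambda>\<omega>. (R d 1 \<omega>, X 1 \<omega>)) (Y d 1) \<in> borel_measurable borel"
      using cexp_version_cexp_at[of M "\<lambda>\<omega>. (R d 1 \<omega>, X 1 \<omega>)" "Y d 1"] by (simp add: cexp_version_def)
    moreover have "(\<lambda>x :: 'x. (1 :: real, x)) \<in> borel_measurable borel" by measurable
    ultimately show ?thesis unfolding h_def by (rule measurable_compose[rotated])
  qed
  have Pm [measurable]: "P d \<in> borel_measurable borel" for d
    using cexp_version_cexp_at[of M "X 1" "R d 1"] by (simp add: cexp_version_def P_def[abs_def])
  have ug: "integrable M (\<lambda>\<omega>. z (X 1 \<omega>) * g (X 1 \<omega>))"
    if z: "cexp_version M (X 1) (\<lambda>\<omega>. outc d (W 1 \<omega>)) z" and d: "d \<in> {0, 1}" and g: "g \<in> borel_measurable borel" "\<And>x. \<bar>g x\<bar> \<le> 1"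
    for d z and g :: "'x \<Rightarrow> real"
  proof (rule Bochner_Integration.integrable_bound[OF cexp_version_integrable[OF integrable_outc[OF d] z]])
    show "AE \<omega> in M. norm (z (X 1 \<omega>) * g (X 1 \<omega>)) \<le> norm (z (X 1 \<omega>))"
      using g(2) by (intro AE_I2) (simp add: abs_mult mult_left_le)
    have [measurable]: "z \<in> borel_measurable borel" using z by (simp add: cexp_version_def)
    note g(1)[measurable]
    show "(\<lambda>\<omega>. z (X 1 \<omega>) * g (X 1 \<omega>)) \<in> borel_measurable M" by measurable
  qed
  have "theta_drop M (\<lambda>d. Y d 1) (\<lambda>d. R d 1) (X 1) =
    expectation (\<lambda>\<omega>. (h 1 (X 1 \<omega>) - h 0 (X 1 \<omega>)) * (P 0 (X 1 \<omega>) * P 1 (X 1 \<omega>) / ?m))"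
    unfolding theta_drop_def tau_obs_def rho_def h_def P_def ..
  also have "\<dots> = expectation (\<lambda>\<omega>. (u (X 1 \<omega>) * g0 (X 1 \<omega>) - v (X 1 \<omega>) * g1 (X 1 \<omega>)) / ?m)"
  proof (rule integral_cong_AE)
    show "AE \<omega> in M. (h 1 (X 1 \<omega>) - h 0 (X 1 \<omega>)) * (P 0 (X 1 \<omega>) * P 1 (X 1 \<omega>) / ?m) =
      (u (X 1 \<omega>) * g0 (X 1 \<omega>) - v (X 1 \<omega>) * g1 (X 1 \<omega>)) / ?m"
      using hP[OF d01(1) u] hP[OF d01(2) v] Pg[OF d01(1) g1(1)] Pg[OF d01(2) g0(1)]
    proof eventually_elim
      case (elim \<omega>)
      \<comment> \<open>Each \<open>h d\<close> is grouped with its own \<open>P d\<close>, the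
        product to which \<open>hP\<close> applies; the other arm's probability is left as the
        partner's factor.\<close>
      have "(h 1 (X 1 \<omega>) - h 0 (X 1 \<omega>)) * (P 0 (X 1 \<omega>) * P 1 (X 1 \<omega>) / ?m) =
        ((h 1 (X 1 \<omega>) * P 1 (X 1 \<omega>)) * P 0 (X 1 \<omega>) - (h 0 (X 1 \<omega>) * P 0 (X 1 \<omega>)) * P 1 (X 1 \<omega>)) / ?m"
        by (simp add: algebra_simps diff_divide_distrib)
      then show ?case using elim by simp
    qed
  qed measurable
  also have "\<dots> = (expectation (\<lambda>\<omega>. u (X 1 \<omega>) * g0 (X 1 \<omega>)) - expectation (\<lambda>\<omega>. v (X 1 \<omega>) * g1 (X 1 \<omega>))) / ?m"
    using Bochner_Integration.integral_diff[OF ug[OF u d01(1) gm(4) g0(2)] ug[OF v d01(2) gm(3) g1(2)]] by simp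
  finally show ?thesis .
qed

end

theorem theorem3p1:
  fixes M :: "'a measure"
    and Y R :: "nat \<Rightarrow> nat \<Rightarrow> 'a \<Rightarrow> real"
    and X :: "nat \<Rightarrow> 'a \<Rightarrow> 'x::euclidean_space"
    and D :: "nat \<Rightarrow> nat \<Rightarrow> 'a \<Rightarrow> real"
    and \<pi> :: "nat \<Rightarrow> (nat \<Rightarrow> 'x) \<Rightarrow> nat \<Rightarrow> nat"
  assumes M: "prob_space M"
    and W_indep: "prob_space.indep_vars M (\<lambda>_. borel) (unit_vec Y R X) {1..}"
    and W_ident: "\<And>i. i \<ge> 1 \<Longrightarrow>
        distr M borel (unit_vec Y R X i) = distr M borel (unit_vec Y R X 1)"
    and R_binary: "\<And>d i \<omega>. d \<in> {0, 1} \<Longrightarrow> i \<ge> 1 \<Longrightarrow> \<omega> \<in> space M \<Longrightarrow> R d i \<omega> \<in> {0, 1}"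
    and pi_permutes: "\<And>n x. even n \<Longrightarrow> x \<in> space (vec_space n) \<Longrightarrow> \<pi> n x permutes {1..n}"
    and pi_measurable: "\<And>n i. even n \<Longrightarrow> i \<in> {1..n} \<Longrightarrow>
        (\<lambda>x. \<pi> n x i) \<in> measurable (vec_space n) (count_space UNIV)"
    and D_measurable: "\<And>n i. even n \<Longrightarrow> i \<in> {1..n} \<Longrightarrow> D n i \<in> borel_measurable M"
    and D_binary: "\<And>n i \<omega>. even n \<Longrightarrow> i \<in> {1..n} \<Longrightarrow> \<omega> \<in> space M \<Longrightarrow> D n i \<omega> \<in> {0, 1}"
    and Y_integrable: "\<And>d i. d \<in> {0, 1} \<Longrightarrow> i \<ge> 1 \<Longrightarrow> integrable M (Y d i)"
    and R_pos: "\<And>d i. d \<in> {0, 1} \<Longrightarrow> i \<ge> 1 \<Longrightarrow> (\<integral>\<omega>. R d i \<omega> \<partial>M) > 0"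
    and R_lipschitz: "\<And>d i. d \<in> {0, 1} \<Longrightarrow> i \<ge> 1 \<Longrightarrow>
        \<exists>L g. L-lipschitz_on UNIV g \<and> cexp_version M (X i) (R d i) g"
    and YR_lipschitz: "\<And>d i. d \<in> {0, 1} \<Longrightarrow> i \<ge> 1 \<Longrightarrow>
        \<exists>L g. L-lipschitz_on UNIV g \<and> cexp_version M (X i) (\<lambda>\<omega>. Y d i \<omega> * R d i \<omega>) g"
    and D_cond_indep: "\<And>n. even n \<Longrightarrow>
        cond_indep M (gen_alg M (vec_space n) (sample_vec n X))
          (vec_space n \<Otimes>\<^sub>M vec_space n \<Otimes>\<^sub>M vec_space n \<Otimes>\<^sub>M vec_space n)
          (\<lambda>\<omega>. (sample_vec n (Y 1) \<omega>, sample_vec n (Y 0) \<omega>,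
                 sample_vec n (R 1) \<omega>, sample_vec n (R 0) \<omega>))
          (vec_space n) (sample_vec n (D n))"
    and pairs_cond_indep: "\<And>n. even n \<Longrightarrow>
        cond_indep_family M (gen_alg M (vec_space n) (sample_vec n X)) borel
          (\<lambda>j \<omega>. (D n (\<pi> n (sample_vec n X \<omega>) (2*j-1)) \<omega>,
                   D n (\<pi> n (sample_vec n X \<omega>) (2*j)) \<omega>)) {1..n div 2}"
    and pairs_uniform: "\<And>n j. even n \<Longrightarrow> j \<in> {1..n div 2} \<Longrightarrow>
        cond_distributed M (gen_alg M (vec_space n) (sample_vec n X)) borel
          (\<lambda>\<omega>. (D n (\<pi> n (sample_vec n X \<omega>) (2*j-1)) \<omega>,
                 D n (\<pi> n (sample_vec n X \<omega>) (2*j)) \<omega>))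
          (pmf_of_set {(0, 1), (1, 0)})"
    and pairs_close: "conv_in_prob M
        (\<lambda>n \<omega>. 1 / real n * (\<Sum>j=1..n div 2.
            norm (X (\<pi> n (sample_vec n X \<omega>) (2*j-1)) \<omega> - X (\<pi> n (sample_vec n X \<omega>) (2*j)) \<omega>)))
        0 even_at_top"
  shows "conv_in_prob M (\<lambda>n. theta_hat n Y R (D n))
           (theta_obs M (\<lambda>d. Y d 1) (\<lambda>d. R d 1)) even_at_top \<and>
         theta_obs M (\<lambda>d. Y d 1) (\<lambda>d. R d 1) =
           cexp_event M {\<omega>\<in>space M. R 1 1 \<omega> = 1} (Y 1 1)
           - cexp_event M {\<omega>\<in>space M. R 0 1 \<omega> = 1} (Y 0 1) \<and>
         (mean_resp_prod M (\<lambda>d. R d 1) (X 1) > 0 \<longrightarrow>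
          conv_in_prob M
            (\<lambda>n \<omega>. theta_hat_drop n (\<pi> n (sample_vec n X \<omega>)) Y R (D n) \<omega>)
            (theta_drop M (\<lambda>d. Y d 1) (\<lambda>d. R d 1) (X 1)) even_at_top)"
proof -
  interpret attrition M Y R X D \<pi>
    by (intro attrition.intro matched_pairs.intro matched_pairs_axioms.intro attrition_axioms.intro assms)
  let ?m = "mean_resp_prod M (\<lambda>d. R d 1) (X 1)"
  have drop: "prob_lim M (\<lambda>n \<omega>. theta_hat_drop n (\<pi> n (sample_vec n X \<omega>)) Y R (D n) \<omega>)
      (theta_drop M (\<lambda>d. Y d 1) (\<lambda>d. R d 1) (X 1)) even_at_top" if m: "?m > 0"
  proof -
    obtain Lp p where p: "Lp-lipschitz_on UNIV p" "cexp_version M (X 1) (\<lambda>\<omega>. resp 1 (W 1 \<omega>)) p"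
      using resp_lipschitz[of 1] by auto
    obtain Lu u where u: "Lu-lipschitz_on UNIV u" "cexp_version M (X 1) (\<lambda>\<omega>. outc 1 (W 1 \<omega>)) u"
      using outc_lipschitz[of 1] by auto
    obtain Lv v where v: "Lv-lipschitz_on UNIV v" "cexp_version M (X 1) (\<lambda>\<omega>. outc 0 (W 1 \<omega>)) v"
      using outc_lipschitz[of 0] by auto
    have "\<exists>g. cexp_version M (X 1) (\<lambda>\<omega>. resp d (W 1 \<omega>)) g \<and> (\<forall>x. \<bar>g x\<bar> \<le> 1)" for d
      by (rule cexp_version_bounded_ex[OF cexp_version_cexp_at integrable_resp resp_bounded]) simp
    then obtain g where g: "\<And>d. cexp_version M (X 1) (\<lambda>\<omega>. resp d (W 1 \<omega>)) (g d)" "\<And>d x. \<bar>g d x\<bar> \<le> 1"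
      by metis
    \<comment> \<open>This identifies the denominator in the estimator's limit with the one in
      \<open>rho\<close>, so positivity of \<open>?m\<close> keeps the limiting denominator away
      from zero.\<close>
    have m_eq: "?m = expectation (\<lambda>\<omega>. p (X 1 \<omega>) * g 0 (X 1 \<omega>))"
      by (rule mean_resp_prod_eq[OF p(2) g(1)])
    show ?thesis
      unfolding theta_drop_eq[OF u(2) v(2) g(1) g(2) g(1) g(2)] m_eq
      by (rule theta_hat_drop_limit[OF p u v g(1) g(2) g(1) g(2)]) (use m m_eq in simp)
  qed
  show ?thesis
    using conv_in_prob_if_prob_lim[OF theta_hat_limit] theta_obs_eq_cexp_event
      conv_in_prob_if_prob_lim[OF drop] by blast
qed

end
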